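(* Let $G=([T],\mathrm{Op},\mathrm{Inv})$ be a computable Baire presentation of a t.d.l.c. group, let $\mathcal W=\mathcal W_{\mathrm{comp}}(G)$, $\widetilde G=\mathcal G_{\mathrm{comp}}(\mathcal W)$, and let $\Phi:G\to\widetilde G$ be the map described in the context. Then (i) $\Phi$, viewed as a map $[T]\to[\mathrm{Tree}(\widetilde G)]$, is computable, and its inverse is computable; (ii) the action $[T]\times\mathbb N\to\mathbb N$, $(g,n)\mapsto m$ where $gA_n=A_m$, is computable.
   Context: Trees: a tree is a nonempty prefix-closed subset of $\mathbb N^*$; $[T]$ its set of infinite paths with Baire-space topology; $[\sigma]_T=\{g\in[T]:\sigma\prec g\}$. A computable leafless tree $T$ is computably locally compact (c.l.c.) if $[T]$ is locally compact, $\{\sigma\in T:[\sigma]_T\text{ compact}\}$ is decidable, and there is a computable $H$ with $\rho(i)\le H(\sigma,i)$ for $i<|\rho|$ whenever $[\sigma]_T$ compact and $\rho\in T$ extends $\sigma$. $\Psi:[T]\to[S]$ is computable if there is a partial computable monotone $P$ from a subset of $T$ to $S$ with $\Psi(g)=\bigcup_n\{P(g\upharpoonright n):g\upharpoonright n\in\mathrm{dom}P\}$; binary functions analogously on pairs of equal-length strings. A function $\Theta:[T]\times\mathbb N\to\mathbb N$ is computable if there is a partial computable $P$ on a subset of $T\times\mathbb N$ with values in $\mathbb N$ such that $\sigma\prec\tau$ and $P(\sigma,n)=k$ imply $P(\tau,n)=k$, and $\Theta(g,w)=k$ iff $P(g\upharpoonright n,w)=k$ for some $n$. A computable Baire presentation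 is a topological group $([T],\mathrm{Op},\mathrm{Inv})$ with $T$ c.l.c. and $\mathrm{Op},\mathrm{Inv}$ computable; groups are infinite. Code numbers: strong index of finite $u\subseteq\mathbb N^*$ is $\sum_{\eta\in u}2^{h(\eta)}$, $h(w)=\prod_{i<|w|}p_i^{w_i+1}$; for finite $u\subseteq T$ with each $[\eta]_T$ compact, $\mathcal K_u=\bigcup_{\eta\in u}[\eta]_T$; $u$ is minimal if no smaller number codes the same set. The set of minimal code numbers $u$ with $\mathcal K_u$ a compact open coset of $G$ is computably enumerable and infinite; fix a computable injection $\theta$ from $\{1,2,\dots\}$ onto it, put $A_0=\emptyset$, $A_n=\mathcal K_{\theta(n)}$. $\mathcal W_{\mathrm{comp}}(G)$ is the structure with domain $\mathbb N$ where $n$ denotes $A_n$, with inverse, intersection and partial product ($A\cdot B=AB$, defined iff for some compact open subgroup $V$, $A$ is a left and $B$ a right coset of $V$) transferred from the compact open cosets. $S_\infty$ is presented as the paths $f\oplus f^{-1}$ ($f$ a permutation of $\mathbb N$, $\oplus$ interleaving: $(f_0\oplus f_1)(2i+b)=f_b(i)$) through the tree $\mathrm{Tree}(S_\infty)$ of strings $\sigma\oplus\tau$ ($\sigma,\tau$ injective of equal length with $\sigma(\tau(k))=k$, $\tau(\sigma(i))=i$ whenever defined), with $(f_0\oplus f_1)^{-1}=f_1\oplus f_0$, $(g_0\oplus g_1)(f_0\oplus f_1)=(g_0\circ f_0)\oplus(f_1\circ g_1)$. $\mathcal G_{\mathrm{comp}}(\mathcal W)$ is the closed subgroup of $S_\infty$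 of those $f\oplus f^{-1}$ such that $f(A\cap B)=f(A)\cap f(B)$ for all $A,B$, and $f(A)\cdot B=f(A\cdot B)$ whenever $A\cdot B$ is defined; $\mathrm{Tree}(\widetilde G)=\{\eta\in\mathrm{Tree}(S_\infty):[\eta]\cap\widetilde G\neq\emptyset\}$. $\Phi(g)=f_g\oplus f_g^{-1}$ where $f_g(n)=m$ iff $gA_n=A_m$; $\Phi$ is an isomorphism of topological groups $G\to\widetilde G$. *)

theory Defs
  imports "HOL-Analysis.Analysis" "HOL-Algebra.Coset" "HOL-Library.Sublist"
    "HOL-Library.Nat_Bijection" "HOL-Library.Infinite_Set"
    "HOL-Computational_Algebra.Primes"
begin

section \<open>Partial computable functions\<close>

definition least_zero :: "(nat \<rightharpoonup> nat) \<Rightarrow> nat option" where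
  "least_zero f =
     (if \<exists>n. f n = Some 0 \<and> (\<forall>m<n. f m \<noteq> None) then Some (LEAST n. f n = Some 0) else None)"

text \<open>
  The partial recursive functions in Kleene's sense (closure of the basic functions under
  composition, primitive recursion and minimization). All functions are unary; several
  arguments are passed through the Cantor pairing \<^const>\<open>prod_encode\<close>, so that the pairing, its
  two projections and pairing of results take the place of the projections and of composition
  with tuples in the many-argument presentation.
\<close>

inductive partial_recursive :: "(nat \<rightharpoonup> nat) \<Rightarrow> bool" where
  zero: "partial_recursive (\<lambda>_. Some 0)"
| succ: "partial_recursive (\<lambda>n. Some (Suc n))"
| proj1: "partial_recursive (\<lambda>n. Some (fst (prod_decode n)))"
| proj2: "partial_recursive (\<lambda>n. Some (snd (prod_decode n)))"
| pair: "partial_recursive f \<Longrightarrow> partial_recursive g \<Longrightarrow>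
    partial_recursive
      (\<lambda>n. Option.bind (f n) (\<lambda>a. Option.bind (g n) (\<lambda>b. Some (prod_encode (a, b)))))"
| comp: "partial_recursive f \<Longrightarrow> partial_recursive g \<Longrightarrow>
    partial_recursive (\<lambda>n. Option.bind (g n) f)"
| prim_rec: "partial_recursive f \<Longrightarrow> partial_recursive g \<Longrightarrow>
    partial_recursive
      (\<lambda>z. rec_nat (f (fst (prod_decode z)))
             (\<lambda>k r. Option.bind r
                (\<lambda>v. g (prod_encode (fst (prod_decode z), prod_encode (k, v)))))
             (snd (prod_decode z)))"
| minimize: "partial_recursive f \<Longrightarrow>
    partial_recursive (\<lambda>a. least_zero (\<lambda>n. f (prod_encode (a, n))))"

text \<open>
  Computability on other countable domains, relative to a bijective decoding \<open>dec\<close> of the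
  arguments and a bijective encoding \<open>enc\<close> of the values. Strings are coded by
  \<^const>\<open>list_encode\<close>.
\<close>

definition partial_computable :: "(nat \<Rightarrow> 'a) \<Rightarrow> ('b \<Rightarrow> nat) \<Rightarrow> ('a \<rightharpoonup> 'b) \<Rightarrow> bool" where
  "partial_computable dec enc P \<longleftrightarrow> partial_recursive (\<lambda>n. map_option enc (P (dec n)))"

definition pair_decode :: "(nat \<Rightarrow> 'a) \<Rightarrow> (nat \<Rightarrow> 'b) \<Rightarrow> nat \<Rightarrow> 'a \<times> 'b" where
  "pair_decode d e n = map_prod d e (prod_decode n)"

definition decidable_strings :: "nat list set \<Rightarrow> bool" where
  "decidable_strings S \<longleftrightarrow>
     partial_computable list_decode id (\<lambda>\<sigma>. Some (if \<sigma> \<in> S then 1 else 0))"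


section \<open>Trees and their paths\<close>

text \<open>
  The type \<^typ>\<open>nat \<Rightarrow> nat\<close> carries the product topology of the discrete topology on
  \<^typ>\<open>nat\<close>, i.e.\ it is Baire space; sets of paths carry the subspace topology.
\<close>

definition restr :: "(nat \<Rightarrow> nat) \<Rightarrow> nat \<Rightarrow> nat list" where
  "restr g n = map g [0..<n]"

definition is_tree :: "nat list set \<Rightarrow> bool" where
  "is_tree T \<longleftrightarrow> T \<noteq> {} \<and> (\<forall>\<tau>\<in>T. \<forall>\<sigma>. prefix \<sigma> \<tau> \<longrightarrow> \<sigma> \<in> T)"

definition leafless :: "nat list set \<Rightarrow> bool" where
  "leafless T \<longleftrightarrow> (\<forall>\<sigma>\<in>T. \<exists>k. \<sigma> @ [k] \<in> T)"

definition paths :: "nat list set \<Rightarrow> (nat \<Rightarrow> nat) set" where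
  "paths T = {g. \<forall>n. restr g n \<in> T}"

definition cylinder :: "nat list set \<Rightarrow> nat list \<Rightarrow> (nat \<Rightarrow> nat) set" where
  "cylinder T \<sigma> = {g \<in> paths T. restr g (length \<sigma>) = \<sigma>}"

definition computably_locally_compact :: "nat list set \<Rightarrow> bool" where
  "computably_locally_compact T \<longleftrightarrow>
     is_tree T \<and> leafless T \<and> decidable_strings T \<and>
     locally_compact_space (top_of_set (paths T)) \<and>
     decidable_strings {\<sigma> \<in> T. compact (cylinder T \<sigma>)} \<and>
     (\<exists>H :: nat list \<Rightarrow> nat \<Rightarrow> nat.
        partial_computable (pair_decode list_decode id) id (\<lambda>(\<sigma>, i). Some (H \<sigma> i)) \<and>
        (\<forall>\<sigma>\<in>T. compact (cylinder T \<sigma>) \<longrightarrow>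
           (\<forall>\<rho>\<in>T. prefix \<sigma> \<rho> \<longrightarrow> (\<forall>i<length \<rho>. \<rho> ! i \<le> H \<sigma> i))))"


section \<open>Computable functions on sets of paths\<close>

definition path_graph :: "(nat \<Rightarrow> nat) \<Rightarrow> (nat \<times> nat) set" where
  "path_graph g = {(i, g i) | i. True}"

definition string_graph :: "nat list \<Rightarrow> (nat \<times> nat) set" where
  "string_graph \<rho> = {(i, \<rho> ! i) | i. i < length \<rho>}"

definition computable_path_fun ::
  "nat list set \<Rightarrow> nat list set \<Rightarrow> ((nat \<Rightarrow> nat) \<Rightarrow> (nat \<Rightarrow> nat)) \<Rightarrow> bool" where
  "computable_path_fun T S \<Psi> \<longleftrightarrow>
     \<Psi> \<in> paths T \<rightarrow> paths S \<and>
     (\<exists>P :: nat list \<rightharpoonup> nat list.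
        partial_computable list_decode list_encode P \<and> dom P \<subseteq> T \<and> ran P \<subseteq> S \<and>
        (\<forall>\<sigma> \<tau> \<alpha> \<beta>. P \<sigma> = Some \<alpha> \<and> P \<tau> = Some \<beta> \<and> prefix \<sigma> \<tau> \<longrightarrow> prefix \<alpha> \<beta>) \<and>
        (\<forall>g\<in>paths T.
           path_graph (\<Psi> g) = (\<Union>{string_graph \<alpha> | \<alpha> n. P (restr g n) = Some \<alpha>})))"

definition computable_path_fun2 ::
  "nat list set \<Rightarrow> nat list set \<Rightarrow> ((nat \<Rightarrow> nat) \<Rightarrow> (nat \<Rightarrow> nat) \<Rightarrow> (nat \<Rightarrow> nat)) \<Rightarrow> bool" where
  "computable_path_fun2 T S \<Psi> \<longleftrightarrow>
     \<Psi> \<in> paths T \<rightarrow> paths T \<rightarrow> paths S \<and>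
     (\<exists>P :: nat list \<times> nat list \<rightharpoonup> nat list.
        partial_computable (pair_decode list_decode list_decode) list_encode P \<and>
        dom P \<subseteq> {(\<sigma>, \<sigma>'). \<sigma> \<in> T \<and> \<sigma>' \<in> T \<and> length \<sigma> = length \<sigma>'} \<and> ran P \<subseteq> S \<and>
        (\<forall>\<sigma> \<sigma>' \<tau> \<tau>' \<alpha> \<beta>. P (\<sigma>, \<sigma>') = Some \<alpha> \<and> P (\<tau>, \<tau>') = Some \<beta> \<and>
           prefix \<sigma> \<tau> \<and> prefix \<sigma>' \<tau>' \<longrightarrow> prefix \<alpha> \<beta>) \<and>
        (\<forall>g\<in>paths T. \<forall>h\<in>paths T.
           path_graph (\<Psi> g h) =
             (\<Union>{string_graph \<alpha> | \<alpha> n. P (restr g n, restr h n) = Some \<alpha>})))"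

definition computable_path_nat_fun ::
  "nat list set \<Rightarrow> ((nat \<Rightarrow> nat) \<Rightarrow> nat \<Rightarrow> nat) \<Rightarrow> bool" where
  "computable_path_nat_fun T \<Theta> \<longleftrightarrow>
     (\<exists>P :: nat list \<times> nat \<rightharpoonup> nat.
        partial_computable (pair_decode list_decode id) id P \<and> dom P \<subseteq> T \<times> UNIV \<and>
        (\<forall>\<sigma>\<in>T. \<forall>\<tau>\<in>T. \<forall>n k. strict_prefix \<sigma> \<tau> \<and> P (\<sigma>, n) = Some k \<longrightarrow> P (\<tau>, n) = Some k) \<and>
        (\<forall>g\<in>paths T. \<forall>w k. \<Theta> g w = k \<longleftrightarrow> (\<exists>n. P (restr g n, w) = Some k)))"


section \<open>Computable Baire presentations\<close>

definition topological_group :: "'a::topological_space monoid \<Rightarrow> bool" where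
  "topological_group G \<longleftrightarrow>
     group G \<and>
     continuous_on (carrier G \<times> carrier G) (\<lambda>(x, y). x \<otimes>\<^bsub>G\<^esub> y) \<and>
     continuous_on (carrier G) (\<lambda>x. inv\<^bsub>G\<^esub> x)"

text \<open>
  \<open>Op\<close> is the multiplication and \<open>Inv\<close> the inversion of \<open>G\<close>. The group is totally disconnected
  because its topology is that of a subspace of Baire space.
\<close>

definition computable_Baire_presentation :: "nat list set \<Rightarrow> (nat \<Rightarrow> nat) monoid \<Rightarrow> bool" where
  "computable_Baire_presentation T G \<longleftrightarrow>
     computably_locally_compact T \<and>
     carrier G = paths T \<and> infinite (carrier G) \<and> topological_group G \<and>
     computable_path_fun2 T T (\<lambda>x y. x \<otimes>\<^bsub>G\<^esub> y) \<and>
     computable_path_fun T T (\<lambda>x. inv\<^bsub>G\<^esub> x)"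

definition compact_open_subgroup :: "'a set \<Rightarrow> 'a::topological_space monoid \<Rightarrow> bool" where
  "compact_open_subgroup U G \<longleftrightarrow>
     subgroup U G \<and> compact U \<and> openin (top_of_set (carrier G)) U"

definition left_coset_of :: "'a monoid \<Rightarrow> 'a set \<Rightarrow> 'a set \<Rightarrow> bool" where
  "left_coset_of G V A \<longleftrightarrow> (\<exists>a\<in>carrier G. A = a <#\<^bsub>G\<^esub> V)"

definition right_coset_of :: "'a monoid \<Rightarrow> 'a set \<Rightarrow> 'a set \<Rightarrow> bool" where
  "right_coset_of G V A \<longleftrightarrow> (\<exists>a\<in>carrier G. A = V #>\<^bsub>G\<^esub> a)"

text \<open>
  Right cosets need not be mentioned: \<open>V a\<close> is the left coset \<open>a (a\<^sup>-\<^sup>1 V a)\<close>.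
\<close>

definition compact_open_coset :: "'a::topological_space monoid \<Rightarrow> 'a set \<Rightarrow> bool" where
  "compact_open_coset G A \<longleftrightarrow> (\<exists>V. compact_open_subgroup V G \<and> left_coset_of G V A)"


section \<open>Code numbers and the enumeration of the compact open cosets\<close>

definition string_code :: "nat list \<Rightarrow> nat" where
  "string_code w = (\<Prod>i<length w. enumerate {p :: nat. prime p} i ^ (w ! i + 1))"

definition strong_index :: "nat list set \<Rightarrow> nat" where
  "strong_index u = (\<Sum>\<eta>\<in>u. 2 ^ string_code \<eta>)"

definition strong_index_decode :: "nat \<Rightarrow> nat list set" where
  "strong_index_decode = inv_into {u. finite u} strong_index"

definition compact_code :: "nat list set \<Rightarrow> nat list set \<Rightarrow> bool" where
  "compact_code T u \<longleftrightarrow> finite u \<and> u \<subseteq> T \<and> (\<forall>\<eta>\<in>u. compact (cylinder T \<eta>))"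

definition coded_set :: "nat list set \<Rightarrow> nat list set \<Rightarrow> (nat \<Rightarrow> nat) set" where
  "coded_set T u = (\<Union>\<eta>\<in>u. cylinder T \<eta>)"

definition minimal_code :: "nat list set \<Rightarrow> nat list set \<Rightarrow> bool" where
  "minimal_code T u \<longleftrightarrow> compact_code T u \<and>
     (\<forall>v. compact_code T v \<and> strong_index v < strong_index u \<longrightarrow> coded_set T v \<noteq> coded_set T u)"

definition coset_code_numbers :: "nat list set \<Rightarrow> (nat \<Rightarrow> nat) monoid \<Rightarrow> nat set" where
  "coset_code_numbers T G =
     {strong_index u | u. minimal_code T u \<and> compact_open_coset G (coded_set T u)}"

text \<open>The value of \<open>\<theta>\<close> at \<open>0\<close> is irrelevant.\<close>

definition coset_enumeration :: "nat list set \<Rightarrow> (nat \<Rightarrow> nat) monoid \<Rightarrow> (nat \<Rightarrow> nat) \<Rightarrow> bool" where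
  "coset_enumeration T G \<theta> \<longleftrightarrow>
     partial_computable id id (\<lambda>n. Some (\<theta> n)) \<and> bij_betw \<theta> {1..} (coset_code_numbers T G)"

definition coset_seq :: "nat list set \<Rightarrow> (nat \<Rightarrow> nat) \<Rightarrow> nat \<Rightarrow> (nat \<Rightarrow> nat) set" where
  "coset_seq T \<theta> n = (if n = 0 then {} else coded_set T (strong_index_decode (\<theta> n)))"

text \<open>
  The index of a set in the sequence; it exists for the empty set and all compact open cosets,
  and is unique because minimal codes are used and \<open>\<theta>\<close> is injective.
\<close>

definition coset_index :: "nat list set \<Rightarrow> (nat \<Rightarrow> nat) \<Rightarrow> (nat \<Rightarrow> nat) set \<Rightarrow> nat" where
  "coset_index T \<theta> C = (THE m. C = coset_seq T \<theta> m)"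


section \<open>The meet groupoid and its group\<close>

record meet_groupoid =
  mg_inv :: "nat \<Rightarrow> nat"
  mg_meet :: "nat \<Rightarrow> nat \<Rightarrow> nat"
  mg_prod :: "nat \<Rightarrow> nat \<Rightarrow> nat option"

definition W_comp :: "nat list set \<Rightarrow> (nat \<Rightarrow> nat) monoid \<Rightarrow> (nat \<Rightarrow> nat) \<Rightarrow> meet_groupoid" where
  "W_comp T G \<theta> =
     \<lparr> mg_inv = (\<lambda>i. coset_index T \<theta> (set_inv\<^bsub>G\<^esub> (coset_seq T \<theta> i))),
       mg_meet = (\<lambda>i j. coset_index T \<theta> (coset_seq T \<theta> i \<inter> coset_seq T \<theta> j)),
       mg_prod = (\<lambda>i j.
         if \<exists>V. compact_open_subgroup V G \<and>
                left_coset_of G V (coset_seq T \<theta> i) \<and> right_coset_of G V (coset_seq T \<theta> j)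
         then Some (coset_index T \<theta> (coset_seq T \<theta> i <#>\<^bsub>G\<^esub> coset_seq T \<theta> j))
         else None) \<rparr>"

definition interleave :: "(nat \<Rightarrow> nat) \<Rightarrow> (nat \<Rightarrow> nat) \<Rightarrow> nat \<Rightarrow> nat" where
  "interleave f0 f1 n = (if even n then f0 (n div 2) else f1 (n div 2))"

definition even_part :: "(nat \<Rightarrow> nat) \<Rightarrow> nat \<Rightarrow> nat" where
  "even_part f i = f (2 * i)"

definition odd_part :: "(nat \<Rightarrow> nat) \<Rightarrow> nat \<Rightarrow> nat" where
  "odd_part f i = f (2 * i + 1)"

text \<open>
  For strings of equal length, \<^const>\<open>splice\<close> is interleaving. Interleavings of equally long
  strings have even length; the tree also contains their prefixes of odd length.
\<close>

definition Tree_S_inf :: "nat list set" where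
  "Tree_S_inf = {\<eta>. \<exists>\<sigma> \<tau>. length \<sigma> = length \<tau> \<and> distinct \<sigma> \<and> distinct \<tau> \<and>
     (\<forall>k<length \<tau>. \<tau> ! k < length \<sigma> \<longrightarrow> \<sigma> ! (\<tau> ! k) = k) \<and>
     (\<forall>i<length \<sigma>. \<sigma> ! i < length \<tau> \<longrightarrow> \<tau> ! (\<sigma> ! i) = i) \<and>
     prefix \<eta> (splice \<sigma> \<tau>)}"

definition S_inf :: "(nat \<Rightarrow> nat) monoid" where
  "S_inf = \<lparr> carrier = paths Tree_S_inf,
     monoid.mult = (\<lambda>g f. interleave (even_part g \<circ> even_part f) (odd_part f \<circ> odd_part g)),
     one = interleave id id \<rparr>"

text \<open>
  The equation \<open>f(A) \<cdot> B = f(A \<cdot> B)\<close> includes that its left-hand side is defined.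
\<close>

definition G_comp :: "meet_groupoid \<Rightarrow> (nat \<Rightarrow> nat) monoid" where
  "G_comp W = S_inf\<lparr> carrier := {interleave f (inv_into UNIV f) | f. bij f \<and>
     (\<forall>a b. f (mg_meet W a b) = mg_meet W (f a) (f b)) \<and>
     (\<forall>a b c. mg_prod W a b = Some c \<longrightarrow> mg_prod W (f a) b = Some (f c))} \<rparr>"

definition Tree_of :: "(nat \<Rightarrow> nat) monoid \<Rightarrow> nat list set" where
  "Tree_of H = {\<eta> \<in> Tree_S_inf. cylinder Tree_S_inf \<eta> \<inter> carrier H \<noteq> {}}"

definition coset_action ::
  "nat list set \<Rightarrow> (nat \<Rightarrow> nat) monoid \<Rightarrow> (nat \<Rightarrow> nat) \<Rightarrow> (nat \<Rightarrow> nat) \<Rightarrow> nat \<Rightarrow> nat" where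
  "coset_action T G \<theta> g n = coset_index T \<theta> (g <#\<^bsub>G\<^esub> coset_seq T \<theta> n)"

definition Phi ::
  "nat list set \<Rightarrow> (nat \<Rightarrow> nat) monoid \<Rightarrow> (nat \<Rightarrow> nat) \<Rightarrow> (nat \<Rightarrow> nat) \<Rightarrow> nat \<Rightarrow> nat" where
  "Phi T G \<theta> g = interleave (coset_action T G \<theta> g) (inv_into UNIV (coset_action T G \<theta> g))"

end

theory Submission
  imports Defs
begin

text \<open>
  Everything is reduced to computably enumerable relations on strings. If a set \<open>Q\<close> of strings is
  computably enumerable, so is the set of all \<open>n\<close> such that every \<open>h\<close> in the compact open coset \<open>A n\<close> has an initial
  segment in \<open>Q\<close>: by compactness one bounded search at a single length suffices. Hence
  \<open>g A n \<subseteq> A m\<close>, and then also \<open>g A n = A m\<close> (that is, \<open>g A n \<subseteq> A m\<close> and \<open>g\<^sup>-\<^sup>1 A m \<subseteq> A n\<close>), are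
  semidecidable from initial segments of \<open>g\<close>. This gives the action, the map \<open>\<Phi>\<close> (the inverse of the
  permutation \<open>f\<^sub>g\<close> is read off from \<open>g A m = A n\<close>), and a computable enumeration of
  \<open>Tree(\<Phi>(G))\<close>. To invert \<open>\<Phi>\<close>, note that \<open>g i\<close> can be read off from the value \<open>g U\<close> of the
  permutation at a small compact open subgroup \<open>U\<close>, because \<open>g \<in> g U\<close>.
\<close>

section \<open>Total computable functions\<close>

text \<open>No program is written for any of the maps. A partial function is partial computable
  exactly when its graph is computably enumerable, so it is enough to enumerate finite certificates:
  a string \<sigma> certifies a value if every path extending it has that value. Closure properties
  of enumerable predicates then do the work. The obstacle is that a computable map between path
  spaces must send comparable strings to comparable strings, which a bare enumeration does not do;
  bounding the enumeration by the input length repairs this. Bijectivity of \<open>Phi\<close> is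
  proved as well. Surjectivity uses compactness without any computation: the images of the compact
  open subgroups under a permutation in the target group have the finite intersection property, and
  a common point \<open>g\<close> induces the permutation. The tree on which the inverse is defined
  is obtained by enumeration only; this suffices because each of its nodes lies on a path. In the
  search for a small set whose image reveals \<open>g i\<close>, any \<open>A n\<close> containing
  the identity is accepted, since this already gives \<open>g \<in> g A n\<close>; that the search
  succeeds is shown with small compact open subgroups.\<close>

class coded =
  fixes enc :: "'a \<Rightarrow> nat" and dec :: "nat \<Rightarrow> 'a"
  assumes dec_enc [simp]: "dec (enc x) = x"
    and enc_dec [simp]: "enc (dec n) = n"

instantiation nat :: coded
begin
definition enc_nat_def [simp]: "enc (n :: nat) = n"
definition dec_nat_def [simp]: "dec n = (n :: nat)"
instance by standard simp_all
end

instantiation prod :: (coded, coded) coded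
begin
definition "enc z = prod_encode (enc (fst z), enc (snd z))"
definition "dec n = (dec (fst (prod_decode n)), dec (snd (prod_decode n)))"
instance by standard (simp_all add: enc_prod_def dec_prod_def)
end

instantiation list :: (coded) coded
begin
definition "enc xs = list_encode (map enc xs)"
definition "dec n = map dec (list_decode n)"
instance by standard (simp_all add: enc_list_def dec_list_def comp_def)
end

lemma enc_nat_list [simp]: "enc = list_encode" "dec = list_decode"
proof -
  have "enc = (\<lambda>x::nat. x)" "dec = (\<lambda>x. x::nat)" by (simp_all add: fun_eq_iff)
  note this [simp]
  show "enc = list_encode" "dec = list_decode"
    by (simp_all add: fun_eq_iff enc_list_def dec_list_def del: enc_nat_def dec_nat_def)
qed

lemma pair_decode_dec: "pair_decode dec dec = dec"
  by (simp add: fun_eq_iff pair_decode_def dec_prod_def map_prod_def split: prod.splits)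

lemma id_dec: "(id :: nat \<Rightarrow> nat) = dec" "(id :: nat \<Rightarrow> nat) = enc"
  by (simp_all add: fun_eq_iff)

text \<open>The codings of class \<open>coded\<close> are bijections, so coding and decoding cost
  nothing and a search through a type is a search through the numbers. Overloading lets the same
  closure rules serve numbers, strings and all their products.\<close>

definition computable :: "('a::coded \<Rightarrow> 'b::coded) \<Rightarrow> bool" where
  "computable f \<longleftrightarrow> partial_recursive (\<lambda>n. Some (enc (f (dec n))))"

definition decidable :: "('a::coded \<Rightarrow> bool) \<Rightarrow> bool" where
  "decidable P \<longleftrightarrow> computable (\<lambda>x. of_bool (P x) :: nat)"

named_theorems comp_intros

lemma computable_nat: "computable f \<longleftrightarrow> partial_recursive (\<lambda>n. Some (f n))" for f :: "nat \<Rightarrow> nat"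
  by (simp add: computable_def)

lemma computable_ident [comp_intros]: "computable (\<lambda>x. x)"
  \<comment> \<open>The identity is not a basic function; it is the pairing of the two
    projections.\<close>
  using partial_recursive.pair[OF partial_recursive.proj1 partial_recursive.proj2]
  by (simp add: computable_def)

lemma computable_compose: "computable f \<Longrightarrow> computable g \<Longrightarrow> computable (\<lambda>x. f (g x))"
  unfolding computable_def by (drule (1) partial_recursive.comp) simp

lemma computable_const [comp_intros]: "computable (\<lambda>_. c)"
proof -
  have "partial_recursive (\<lambda>_. Some n)" for n
  proof (induction n)
    case (Suc n)
    then show ?case using partial_recursive.comp[OF partial_recursive.succ] by fastforce
  qed (rule partial_recursive.zero)
  then show ?thesis by (simp add: computable_def)
qed

lemma computable_enc [comp_intros]: "computable f \<Longrightarrow> computable (\<lambda>x. enc (f x))"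
  by (simp add: computable_def)

lemma computable_dec [comp_intros]: "computable f \<Longrightarrow> computable (\<lambda>x. dec (f x))"
  by (simp add: computable_def)

lemma computable_Suc [comp_intros]: "computable f \<Longrightarrow> computable (\<lambda>x. Suc (f x))"
  by (rule computable_compose[of Suc]) (simp_all add: computable_nat partial_recursive.succ)

lemma computable_Pair [comp_intros]:
  "computable f \<Longrightarrow> computable g \<Longrightarrow> computable (\<lambda>x. (f x, g x))"
  unfolding computable_def by (drule (1) partial_recursive.pair) (simp add: enc_prod_def)

lemma computable_fst [comp_intros]: "computable f \<Longrightarrow> computable (\<lambda>x. fst (f x))"
  by (rule computable_compose[of fst])
    (simp_all add: computable_def dec_prod_def partial_recursive.proj1)

lemma computable_snd [comp_intros]: "computable f \<Longrightarrow> computable (\<lambda>x. snd (f x))"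
  by (rule computable_compose[of snd])
    (simp_all add: computable_def dec_prod_def partial_recursive.proj2)

lemma prod_decode_dec: "prod_decode = dec"
  by (simp add: fun_eq_iff dec_prod_def)

lemma computable_prod_decode [comp_intros]:
  "computable f \<Longrightarrow> computable (\<lambda>x. prod_decode (f x))"
  unfolding prod_decode_dec by (rule computable_dec)

lemma computable_compose2:
  assumes "computable (\<lambda>z. F (fst z) (snd z))" "computable f" "computable g"
  shows "computable (\<lambda>x. F (f x) (g x))"
  using computable_compose[OF assms(1) computable_Pair[OF assms(2,3)]] by simp

text \<open>The base case, the step and the number of steps may all depend on the argument
  \<open>x\<close>, which is carried along as the parameter of the recursion. This is what makes
  later definitions by \<open>rec_nat\<close> computable as they stand.\<close>

lemma computable_rec_nat [comp_intros]:
  assumes b: "computable b" and s: "computable (\<lambda>z. s (fst z) (fst (snd z)) (snd (snd z)))"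
    and n: "computable n"
  shows "computable (\<lambda>x. rec_nat (b x) (s x) (n x))"
proof -
  let ?s = "\<lambda>m. enc (s (dec (fst (prod_decode m))) (fst (prod_decode (snd (prod_decode m))))
    (dec (snd (prod_decode (snd (prod_decode m))))))"
  have s': "partial_recursive (\<lambda>m. Some (?s m))"
    using s by (simp add: computable_def dec_prod_def)
  have "rec_nat (Some (enc (b (dec a)))) (\<lambda>k r. Option.bind r
          (\<lambda>v. Some (?s (prod_encode (a, prod_encode (k, v)))))) m
        = Some (enc (rec_nat (b (dec a)) (s (dec a)) m))" for a m
    by (induction m) simp_all
  then have "computable (\<lambda>z. rec_nat (b (fst z)) (s (fst z)) (snd z))"
    using partial_recursive.prim_rec[OF b[unfolded computable_def] s']
    by (simp add: computable_def dec_prod_def)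
  from computable_compose2[OF this computable_ident n] show ?thesis by simp
qed

lemma computable_add [comp_intros]:
  assumes "computable f" "computable g" shows "computable (\<lambda>x. f x + g x :: nat)"
proof -
  have "m + n = rec_nat m (\<lambda>_ v. Suc v) n" for m n :: nat by (induction n) simp_all
  then show ?thesis by (simp only:) (intro comp_intros assms)
qed

lemma computable_mult [comp_intros]:
  assumes "computable f" "computable g" shows "computable (\<lambda>x. f x * g x :: nat)"
proof -
  have "m * n = rec_nat 0 (\<lambda>_ v. v + m) n" for m n :: nat by (induction n) simp_all
  then show ?thesis
    by (simp only:) (intro comp_intros assms computable_compose[OF assms(1)])
qed

lemma computable_power [comp_intros]:
  assumes "computable f" "computable g" shows "computable (\<lambda>x. f x ^ g x :: nat)"
proof -
  have "m ^ n = rec_nat 1 (\<lambda>_ v. v * m) n" for m n :: nat by (induction n) simp_all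
  then show ?thesis
    by (simp only:) (intro comp_intros assms computable_compose[OF assms(1)])
qed

lemma computable_diff [comp_intros]:
  assumes "computable f" "computable g" shows "computable (\<lambda>x. f x - g x :: nat)"
proof -
  have pred: "n - 1 = rec_nat 0 (\<lambda>k _. k) n" for n :: nat by (cases n) simp_all
  have "m - n = rec_nat m (\<lambda>_ v. rec_nat 0 (\<lambda>k _. k) v) n" for m n :: nat
    by (induction n) (simp_all flip: pred)
  then show ?thesis by (simp only:) (intro comp_intros assms)
qed

section \<open>Decidable predicates, bounded quantifiers, case distinction and minimization\<close>

lemma decidable_compose: "decidable P \<Longrightarrow> computable f \<Longrightarrow> decidable (\<lambda>x. P (f x))"
  unfolding decidable_def by (rule computable_compose)

lemma decidable_not [comp_intros]:
  assumes "decidable P" shows "decidable (\<lambda>x. \<not> P x)"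
proof -
  have "of_bool (\<not> b) = 1 - (of_bool b :: nat)" for b by simp
  then show ?thesis using assms unfolding decidable_def by (simp only:) (intro comp_intros)
qed

lemma decidable_conj [comp_intros]: "decidable P \<Longrightarrow> decidable Q \<Longrightarrow> decidable (\<lambda>x. P x \<and> Q x)"
  unfolding decidable_def of_bool_conj by (rule computable_mult)

lemma decidable_disj [comp_intros]: "decidable P \<Longrightarrow> decidable Q \<Longrightarrow> decidable (\<lambda>x. P x \<or> Q x)"
  using decidable_not[OF decidable_conj[OF decidable_not decidable_not]] by simp

lemma decidable_le [comp_intros]:
  assumes "computable f" "computable g" shows "decidable (\<lambda>x. f x \<le> (g x :: nat))"
proof -
  have "of_bool (m \<le> n) = 1 - (m - n)" for m n :: nat by auto
  then show ?thesis unfolding decidable_def by (simp only:) (intro comp_intros assms)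
qed

lemma decidable_less [comp_intros]:
  "computable f \<Longrightarrow> computable g \<Longrightarrow> decidable (\<lambda>x. f x < (g x :: nat))"
  unfolding less_eq_Suc_le by (intro comp_intros)

lemma decidable_eq [comp_intros]:
  assumes "computable f" "computable g" shows "decidable (\<lambda>x. f x = g x)"
proof -
  have "x = y \<longleftrightarrow> enc x \<le> enc y \<and> enc y \<le> enc x" for x y :: 'b by (metis dec_enc order.antisym order.refl)
  then show ?thesis by (simp only:) (intro comp_intros assms)
qed

lemma decidable_all_less [comp_intros]:
  assumes "decidable (\<lambda>z. P (fst z) (snd z))" "computable n"
  shows "decidable (\<lambda>x. \<forall>k<(n x :: nat). P x k)"
proof -
  have "(of_bool (\<forall>k<n. Q k) :: nat) = rec_nat 1 (\<lambda>k v. v * of_bool (Q k)) n"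
    for n and Q :: "nat \<Rightarrow> bool"
  proof (induction n)
    case (Suc n)
    have "(\<forall>k<Suc n. Q k) \<longleftrightarrow> (\<forall>k<n. Q k) \<and> Q n" by (auto simp: less_Suc_eq)
    then show ?case by (simp only: old.nat.rec Suc.IH of_bool_conj)
  qed simp
  then have "(\<lambda>x. of_bool (\<forall>k<n x. P x k) :: nat) =
      (\<lambda>x. rec_nat 1 (\<lambda>k v. v * of_bool (P x k)) (n x))" by (intro ext)
  then show ?thesis unfolding decidable_def
    by (simp only:)
      (intro comp_intros computable_compose2[OF assms(1)[unfolded decidable_def]] assms(2))
qed

lemma decidable_ex_less [comp_intros]:
  assumes "decidable (\<lambda>z. P (fst z) (snd z))" "computable n"
  shows "decidable (\<lambda>x. \<exists>k<(n x :: nat). P x k)"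
  using decidable_not[OF decidable_all_less[OF decidable_not, OF assms]] by simp

lemma decidable_all_le [comp_intros]:
  "decidable (\<lambda>z. P (fst z) (snd z)) \<Longrightarrow> computable n \<Longrightarrow> decidable (\<lambda>x. \<forall>k\<le>(n x :: nat). P x k)"
  unfolding less_Suc_eq_le[symmetric] by (intro comp_intros)

lemma decidable_ex_le [comp_intros]:
  "decidable (\<lambda>z. P (fst z) (snd z)) \<Longrightarrow> computable n \<Longrightarrow> decidable (\<lambda>x. \<exists>k\<le>(n x :: nat). P x k)"
  unfolding less_Suc_eq_le[symmetric] by (intro comp_intros)

lemma computable_if [comp_intros]:
  assumes "decidable P" "computable f" "computable g"
  shows "computable (\<lambda>x. if P x then f x else g x)"
proof -
  \<comment> \<open>Both branches are total, so the choice can be made by arithmetic on their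
    codes.\<close>
  have "(if b then y else z) = dec (of_bool b * enc y + (1 - of_bool b) * enc z)" for b and y z :: 'b
    by simp
  then show ?thesis
    by (simp only:) (intro comp_intros assms(2,3) assms(1)[unfolded decidable_def])
qed

text \<open>The existence hypothesis turns the unbounded search into a total function.\<close>

lemma computable_Least [comp_intros]:
  fixes P :: "'a::coded \<Rightarrow> nat \<Rightarrow> bool"
  assumes "decidable (\<lambda>z. P (fst z) (snd z))" "\<And>x. \<exists>n. P x n"
  shows "computable (\<lambda>x. LEAST n. P x n)"
proof -
  have "computable (\<lambda>z. of_bool (\<not> P (fst z) (snd z)) :: nat)"
    using decidable_not[OF assms(1)] by (simp add: decidable_def)
  from partial_recursive.minimize[OF this[unfolded computable_def]]
  moreover have "least_zero (\<lambda>n. Some (of_bool (\<not> P x n))) = Some (LEAST n. P x n)" for x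
    using assms(2)[of x] by (simp add: least_zero_def of_bool_def)
  ultimately show ?thesis
    by (simp add: computable_def dec_prod_def)
qed

section \<open>Computable list functions\<close>

text \<open>The value of \<open>xs ! i\<close> beyond the end of the list is unspecified, so nothing
  can be proved about its computability; the default 0 makes access total and computable.\<close>

definition nthd :: "nat list \<Rightarrow> nat \<Rightarrow> nat" where
  "nthd xs i = (if i < length xs then xs ! i else 0)"

lemma nthd_eq [simp]: "i < length xs \<Longrightarrow> nthd xs i = xs ! i"
  by (simp add: nthd_def)

lemma computable_Cons [comp_intros]:
  assumes "computable f" "computable g" shows "computable (\<lambda>x. f x # g x :: nat list)"
proof -
  have "y # ys = dec (Suc (enc (y, ys)))" for y and ys :: "nat list"
    by (simp add: enc_prod_def)
  then show ?thesis by (simp only:) (intro comp_intros assms)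
qed

lemma computable_tl [comp_intros]:
  assumes "computable f" shows "computable (\<lambda>x. tl (f x :: nat list))"
proof -
  \<comment> \<open>A recursion that ignores the previous value is a case distinction between 0, the
    code of the empty list, and a successor, the code of a pair of head and tail.\<close>
  have "tl ys = dec (rec_nat 0 (\<lambda>k _. snd (dec k :: nat \<times> nat)) (enc ys))" for ys :: "nat list"
    by (cases ys) (simp_all add: dec_prod_def)
  then show ?thesis by (simp only:) (intro comp_intros assms)
qed

lemma computable_drop [comp_intros]:
  assumes "computable n" "computable f" shows "computable (\<lambda>x. drop (n x) (f x :: nat list))"
proof -
  have "drop n ys = rec_nat ys (\<lambda>_ v. tl v) n" for n and ys :: "nat list"
    by (induction n) (simp_all add: drop_Suc drop_tl tl_drop)
  then show ?thesis by (simp only:) (intro comp_intros assms)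
qed

lemma computable_length [comp_intros]:
  assumes "computable f" shows "computable (\<lambda>x. length (f x :: nat list))"
proof -
  \<comment> \<open>Recursion is available on numbers only, so the length is found by search instead
    of by recursion on the list.\<close>
  have "length ys = (LEAST l. drop l ys = [])" for ys :: "nat list"
    by (simp add: Least_equality[symmetric])
  moreover have "\<exists>l. drop l ys = []" for ys :: "nat list"
    by (rule exI[of _ "length ys"]) simp
  ultimately show ?thesis
    by (simp only:) (intro comp_intros computable_compose[OF assms])
qed

lemma computable_nthd [comp_intros]:
  assumes "computable f" "computable n" shows "computable (\<lambda>x. nthd (f x) (n x))"
proof -
  have hd0: "nthd ys 0 = rec_nat 0 (\<lambda>k _. fst (dec k :: nat \<times> nat)) (enc ys)" for ys :: "nat list"
    by (cases ys) (simp_all add: dec_prod_def nthd_def)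
  have "nthd ys i = nthd (drop i ys) 0" for i ys
    by (simp add: nthd_def)
  then have "nthd ys i = rec_nat 0 (\<lambda>k _. fst (dec k :: nat \<times> nat)) (enc (drop i ys))" for i ys
    by (simp only: hd0)
  then show ?thesis by (simp only:) (intro comp_intros assms)
qed

lemma computable_take [comp_intros]:
  assumes "computable n" "computable f" shows "computable (\<lambda>x. take (n x) (f x :: nat list))"
proof -
  define l where "l n ys = (if n \<le> length ys then n else length ys)" for n and ys :: "nat list"
  \<comment> \<open>The list is built from its end: after \<open>j\<close> steps it consists of the
    last \<open>j\<close> entries of the required initial part.\<close>
  have rec: "rec_nat [] (\<lambda>k v. nthd ys (m - Suc k) # v) j = drop (m - j) (take m ys)"
    if "j \<le> m" "m \<le> length ys" for j m and ys :: "nat list"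
    using that
  proof (induction j)
    case (Suc j)
    have "drop (m - Suc j) (take m ys) = ys ! (m - Suc j) # drop (Suc (m - Suc j)) (take m ys)"
      using Suc.prems by (subst Cons_nth_drop_Suc[symmetric]) simp_all
    then show ?case using Suc by (simp add: Suc_diff_Suc)
  qed simp
  have "take n ys = rec_nat [] (\<lambda>k v. nthd ys (l n ys - Suc k) # v) (l n ys)" for n and ys :: "nat list"
    using rec[of "l n ys" "l n ys" ys] by (simp add: l_def)
  then show ?thesis unfolding l_def
    by (simp only:) (intro comp_intros computable_compose[OF assms(1)] computable_compose[OF assms(2)] assms)
qed

lemma computable_replicate [comp_intros]:
  assumes "computable n" "computable f" shows "computable (\<lambda>x. replicate (n x) (f x :: nat))"
proof -
  have "replicate n y = rec_nat [] (\<lambda>_ v. y # v) n" for n and y :: nat by (induction n) simp_all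
  then show ?thesis by (simp only:) (intro comp_intros assms computable_compose[OF assms(2)])
qed

lemma decidable_prefix [comp_intros]:
  assumes "computable f" "computable g" shows "decidable (\<lambda>x. prefix (f x) (g x :: nat list))"
proof -
  have "prefix xs ys \<longleftrightarrow> xs = take (length xs) ys" for xs ys :: "nat list"
    by (metis prefix_def append_eq_conv_conj take_is_prefix)
  then show ?thesis by (simp only:) (intro comp_intros assms)
qed

section \<open>Computably enumerable predicates\<close>

definition ce :: "('a::coded \<Rightarrow> bool) \<Rightarrow> bool" where
  "ce P \<longleftrightarrow> (\<exists>D :: 'a \<times> nat \<Rightarrow> bool. decidable D \<and> (\<forall>x. P x \<longleftrightarrow> (\<exists>s. D (x, s))))"

named_theorems ce_intros

lemma ceI: "decidable (\<lambda>z. D (fst z) (snd z :: nat)) \<Longrightarrow> (\<And>x. P x \<longleftrightarrow> (\<exists>s. D x s)) \<Longrightarrow> ce P"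
  unfolding ce_def by (intro exI[of _ "\<lambda>z. D (fst z) (snd z)"]) simp

lemma ce_decidable: "decidable P \<Longrightarrow> ce P"
  by (rule ceI[of "\<lambda>x _. P x"]) (rule decidable_compose[of P], assumption, intro comp_intros, simp)

lemma ce_compose:
  assumes "ce P" "computable f" shows "ce (\<lambda>x. P (f x))"
proof -
  obtain D where D: "decidable D" "\<And>x. P x \<longleftrightarrow> (\<exists>s. D (x, s :: nat))"
    using assms(1) unfolding ce_def by blast
  show ?thesis
    by (rule ceI[of "\<lambda>x s. D (f x, s)"])
      (intro decidable_compose[OF D(1)] comp_intros computable_compose[OF assms(2)], rule D(2))
qed

lemma ce_compose2:
  assumes "ce (\<lambda>z. P (fst z) (snd z))" "computable f" "computable g"
  shows "ce (\<lambda>x. P (f x) (g x))"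
  using ce_compose[OF assms(1) computable_Pair[OF assms(2,3)]] by simp

lemma ce_compose3:
  assumes "ce (\<lambda>z. P (fst z) (fst (snd z)) (snd (snd z)))" "computable f" "computable g" "computable h"
  shows "ce (\<lambda>x. P (f x) (g x) (h x))"
  using ce_compose[OF assms(1) computable_Pair[OF assms(2) computable_Pair[OF assms(3,4)]]] by simp

lemma ce_conj [ce_intros]:
  assumes "ce P" "ce Q" shows "ce (\<lambda>x. P x \<and> Q x)"
proof -
  obtain D where D: "decidable D" "\<And>x. P x \<longleftrightarrow> (\<exists>s. D (x, s :: nat))"
    using assms(1) unfolding ce_def by blast
  obtain E where E: "decidable E" "\<And>x. Q x \<longleftrightarrow> (\<exists>s. E (x, s :: nat))"
    using assms(2) unfolding ce_def by blast
  show ?thesis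
  proof (rule ceI[of "\<lambda>x s. D (x, fst (prod_decode s)) \<and> E (x, snd (prod_decode s))"])
    show "decidable (\<lambda>z. D (fst z, fst (prod_decode (snd z))) \<and> E (fst z, snd (prod_decode (snd z))))"
      by (intro comp_intros decidable_compose[OF D(1)] decidable_compose[OF E(1)])
    show "P x \<and> Q x \<longleftrightarrow> (\<exists>s. D (x, fst (prod_decode s)) \<and> E (x, snd (prod_decode s)))" for x
      unfolding D E by (metis prod_encode_inverse fst_conv snd_conv)
  qed
qed

lemma ce_disj [ce_intros]:
  assumes "ce P" "ce Q" shows "ce (\<lambda>x. P x \<or> Q x)"
proof -
  obtain D where D: "decidable D" "\<And>x. P x \<longleftrightarrow> (\<exists>s. D (x, s :: nat))"
    using assms(1) unfolding ce_def by blast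
  obtain E where E: "decidable E" "\<And>x. Q x \<longleftrightarrow> (\<exists>s. E (x, s :: nat))"
    using assms(2) unfolding ce_def by blast
  show ?thesis
    by (rule ceI[of "\<lambda>x s. D (x, s) \<or> E (x, s)"])
      (intro comp_intros decidable_compose[OF D(1)] decidable_compose[OF E(1)], auto simp: D E)
qed

lemma ce_imp [ce_intros]: "decidable P \<Longrightarrow> ce Q \<Longrightarrow> ce (\<lambda>x. P x \<longrightarrow> Q x)"
  unfolding imp_conv_disj by (rule ce_disj, rule ce_decidable, rule decidable_not)

lemma ce_ex [ce_intros]:
  fixes P :: "'a::coded \<Rightarrow> 'b::coded \<Rightarrow> bool"
  assumes "ce (\<lambda>z. P (fst z) (snd z))" shows "ce (\<lambda>x. \<exists>y. P x y)"
proof -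
  obtain D where D: "decidable D"
      "\<And>z. P (fst z) (snd z) \<longleftrightarrow> (\<exists>s. D (z, s :: nat))"
    using assms unfolding ce_def by blast
  show ?thesis
  proof (rule ceI[of "\<lambda>x s. D ((x, dec (fst (prod_decode s))), snd (prod_decode s))"])
    show "decidable (\<lambda>z. D ((fst z, dec (fst (prod_decode (snd z)))), snd (prod_decode (snd z))))"
      by (intro comp_intros decidable_compose[OF D(1)])
    show "(\<exists>y. P x y) \<longleftrightarrow> (\<exists>s. D ((x, dec (fst (prod_decode s))), snd (prod_decode s)))" for x
    proof
      assume "\<exists>y. P x y"
      then obtain y s where "D ((x, y), s)" using D(2)[of "(x, _)"] by auto
      then show "\<exists>s. D ((x, dec (fst (prod_decode s))), snd (prod_decode s))"
        by (intro exI[of _ "prod_encode (enc y, s)"]) simp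
    qed (use D(2)[of "(x, _)"] in auto)
  qed
qed

text \<open>Finitely many witnesses have a common bound, for instance one above their sum, so the
  unbounded search can be moved in front of the bounded quantifier.\<close>

lemma ce_all_less [ce_intros]:
  assumes "ce (\<lambda>z. P (fst z) (snd z))" "computable n"
  shows "ce (\<lambda>x. \<forall>k<(n x :: nat). P x k)"
proof -
  obtain D where D: "decidable D"
      "\<And>z. P (fst z) (snd z) \<longleftrightarrow> (\<exists>s. D (z, s :: nat))"
    using assms(1) unfolding ce_def by blast
  have P: "P x k \<longleftrightarrow> (\<exists>s. D ((x, k), s))" for x k using D(2)[of "(x, k)"] by simp
  show ?thesis
  proof (rule ceI[of "\<lambda>x S. \<forall>k<n x. \<exists>s<S. D ((x, k), s)"])
    show "decidable (\<lambda>z. \<forall>k<n (fst z). \<exists>s<snd z. D ((fst z, k), s))"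
      by (intro comp_intros decidable_compose[OF D(1)] computable_compose[OF assms(2)])
    show "(\<forall>k<n x. P x k) \<longleftrightarrow> (\<exists>S. \<forall>k<n x. \<exists>s<S. D ((x, k), s))" for x
    proof
      assume "\<forall>k<n x. P x k"
      then obtain s where s: "\<And>k. k < n x \<Longrightarrow> D ((x, k), s k)" unfolding P by metis
      show "\<exists>S. \<forall>k<n x. \<exists>s<S. D ((x, k), s)"
        by (rule exI[of _ "Suc (\<Sum>k<n x. s k)"])
          (use s in \<open>auto intro!: exI[of _ "s _"] member_le_sum simp: less_Suc_eq_le\<close>)
    qed (auto simp: P)
  qed
qed

lemma ce_ex_le [ce_intros]:
  assumes "ce (\<lambda>z. P (fst z) (snd z))" "computable n"
  shows "ce (\<lambda>x. \<exists>k\<le>(n x :: nat). P x k)"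
  by (intro ce_intros assms ce_decidable comp_intros computable_compose[OF assms(2)])

section \<open>Bounded quantification over strings\<close>

text \<open>Pairing is monotone in both arguments and the empty list has code 0. The bound turns a
  quantifier over all strings of bounded length and entries into a bounded quantifier over
  codes.\<close>

lemma list_encode_le_replicate:
  "length xs \<le> k \<Longrightarrow> \<forall>x\<in>set xs. x \<le> M \<Longrightarrow> list_encode xs \<le> list_encode (replicate k M)"
proof (induction xs arbitrary: k)
  case (Cons x xs)
  then obtain k' where k: "k = Suc k'" by (cases k) auto
  have "list_encode xs \<le> list_encode (replicate k' M)" using Cons k by simp
  moreover have "x \<le> M" using Cons by simp
  ultimately have "prod_encode (x, list_encode xs) \<le> prod_encode (M, list_encode (replicate k' M))"
    unfolding prod_encode_def triangle_def split_conv by (intro add_mono div_le_mono mult_mono) auto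
  then show ?case by (simp add: k)
qed simp

definition in_box :: "nat \<Rightarrow> nat \<Rightarrow> nat list \<Rightarrow> bool" where
  "in_box k M xs \<longleftrightarrow> length xs \<le> k \<and> (\<forall>x\<in>set xs. x \<le> M)"

lemma decidable_in_box [comp_intros]:
  assumes "computable k" "computable M" "computable f"
  shows "decidable (\<lambda>x. in_box (k x) (M x) (f x))"
proof -
  have "in_box k M xs \<longleftrightarrow> length xs \<le> k \<and> (\<forall>i<length xs. nthd xs i \<le> M)" for k M xs
    by (force simp: in_box_def in_set_conv_nth)
  then show ?thesis
    by (simp only:) (intro comp_intros assms computable_compose[OF assms(2)] computable_compose[OF assms(3)])
qed

lemma ce_all_box [ce_intros]:
  assumes P: "ce (\<lambda>z. P (fst z) (snd z))" and k: "computable k" and M: "computable M"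
  shows "ce (\<lambda>x. \<forall>xs. in_box (k x) (M x) xs \<longrightarrow> P x xs)"
proof -
  have "(\<forall>xs. in_box k M xs \<longrightarrow> Q xs) \<longleftrightarrow>
      (\<forall>e<Suc (enc (replicate k M)). in_box k M (dec e) \<longrightarrow> Q (dec e))" for k M and Q :: "nat list \<Rightarrow> bool"
    by (auto simp: less_Suc_eq_le in_box_def)
      (metis list_encode_inverse list_encode_le_replicate in_box_def)
  then show ?thesis
    by (simp only:) (intro ce_intros comp_intros k M ce_compose2[OF P] computable_compose[OF k]
      computable_compose[OF M])
qed

section \<open>Partial recursive functions and computably enumerable graphs\<close>

lemma least_zero_eq_Some:
  "least_zero f = Some y \<longleftrightarrow> f y = Some 0 \<and> (\<forall>m<y. \<exists>v. f m = Some (Suc v))"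
proof
  assume "least_zero f = Some y"
  then obtain n where n: "f n = Some 0" "\<forall>m<n. f m \<noteq> None" and y: "y = (LEAST n. f n = Some 0)"
    by (auto simp: least_zero_def split: if_splits)
  have "y \<le> n" using n(1) y by (simp add: Least_le)
  have "f y = Some 0" unfolding y by (rule LeastI) (rule n(1))
  moreover have "\<exists>v. f m = Some (Suc v)" if "m < y" for m
  proof -
    have "m < n" using that \<open>y \<le> n\<close> by simp
    then obtain w where "f m = Some w" using n(2) by auto
    moreover have "f m \<noteq> Some 0" using that not_less_Least y by blast
    ultimately show ?thesis by (cases w) auto
  qed
  ultimately show "f y = Some 0 \<and> (\<forall>m<y. \<exists>v. f m = Some (Suc v))" by blast
next
  assume f: "f y = Some 0 \<and> (\<forall>m<y. \<exists>v. f m = Some (Suc v))"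
  have "(LEAST n. f n = Some 0) = y"
  proof (rule Least_equality)
    show "y \<le> n" if "f n = Some 0" for n using f that by (metis linorder_not_le nat.distinct(1) option.inject)
  qed (use f in simp)
  moreover have "\<exists>n. f n = Some 0 \<and> (\<forall>m<n. f m \<noteq> None)" using f by (intro exI[of _ y]) auto
  ultimately show "least_zero f = Some y" by (simp add: least_zero_def)
qed

text \<open>The list \<open>vs\<close> is the history of the recursion. Being coded by one number,
  it makes the graph of a primitive recursion existential over conditions on single steps.\<close>

lemma rec_nat_option_eq_Some:
  "rec_nat b (\<lambda>k r. Option.bind r (g k)) n = Some y \<longleftrightarrow>
     (\<exists>vs. length vs = Suc n \<and> b = Some (nthd vs 0) \<and>
       (\<forall>k<n. g k (nthd vs k) = Some (nthd vs (Suc k))) \<and> y = nthd vs n)"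
proof (induction n arbitrary: y)
  case 0
  show ?case by (auto intro!: exI[of _ "[y]"])
next
  case (Suc n)
  show ?case
  proof
    assume "rec_nat b (\<lambda>k r. Option.bind r (g k)) (Suc n) = Some y"
    then obtain v where "rec_nat b (\<lambda>k r. Option.bind r (g k)) n = Some v" and y: "g n v = Some y"
      by (auto simp: bind_eq_Some_conv)
    then obtain vs where "length vs = Suc n" "b = Some (nthd vs 0)"
        "\<forall>k<n. g k (nthd vs k) = Some (nthd vs (Suc k))" "v = nthd vs n"
      using Suc.IH by blast
    with y show "\<exists>vs. length vs = Suc (Suc n) \<and> b = Some (nthd vs 0) \<and>
       (\<forall>k<Suc n. g k (nthd vs k) = Some (nthd vs (Suc k))) \<and> y = nthd vs (Suc n)"
      by (intro exI[of _ "vs @ [y]"]) (auto simp: nthd_def nth_append less_Suc_eq)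
  next
    assume "\<exists>vs. length vs = Suc (Suc n) \<and> b = Some (nthd vs 0) \<and>
       (\<forall>k<Suc n. g k (nthd vs k) = Some (nthd vs (Suc k))) \<and> y = nthd vs (Suc n)"
    then obtain vs where vs: "length vs = Suc (Suc n)" "b = Some (nthd vs 0)"
       "\<forall>k<Suc n. g k (nthd vs k) = Some (nthd vs (Suc k))" "y = nthd vs (Suc n)" by blast
    have "rec_nat b (\<lambda>k r. Option.bind r (g k)) n = Some (nthd vs n)"
      unfolding Suc.IH using vs
      by (intro exI[of _ "take (Suc n) vs"]) (auto simp: nthd_def)
    moreover have "g n (nthd vs n) = Some y" using vs(3,4) by simp
    ultimately show "rec_nat b (\<lambda>k r. Option.bind r (g k)) (Suc n) = Some y" by simp
  qed
qed

text \<open>Induction on the generation of \<open>f\<close>: a composition contributes its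
  intermediate value, a primitive recursion its history, a minimization the positive values below
  the result.\<close>

lemma ce_graph_partial_recursive:
  "partial_recursive f \<Longrightarrow> ce (\<lambda>z. f (fst z) = Some (snd z))"
proof (induction rule: partial_recursive.induct)
  case (pair f g)
  have "Option.bind (f n) (\<lambda>a. Option.bind (g n) (\<lambda>b. Some (prod_encode (a, b)))) = Some y \<longleftrightarrow>
      (\<exists>a b. f n = Some a \<and> g n = Some b \<and> y = enc (a, b))" for n y
    by (auto simp: bind_eq_Some_conv enc_prod_def)
  then show ?case
    by (simp only:) (intro ce_intros ce_compose2[OF pair.IH(1)] ce_compose2[OF pair.IH(2)]
      ce_decidable comp_intros)
next
  case (comp f g)
  show ?case unfolding bind_eq_Some_conv
    by (intro ce_intros ce_compose2[OF comp.IH(1)] ce_compose2[OF comp.IH(2)] comp_intros)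
next
  case (prim_rec f g)
  have enc: "prod_encode (a, prod_encode (b, c)) = enc (a, b, c)" for a b c :: nat
    by (simp add: enc_prod_def)
  show ?case unfolding rec_nat_option_eq_Some enc
    by (intro ce_intros ce_compose2[OF prim_rec.IH(1)] ce_compose2[OF prim_rec.IH(2)]
      ce_decidable comp_intros)
next
  case (minimize f)
  have enc: "prod_encode z = enc z" for z :: "nat \<times> nat" by (simp add: enc_prod_def)
  show ?case unfolding least_zero_eq_Some enc
    by (intro ce_intros ce_compose2[OF minimize.IH] comp_intros)
qed (auto intro!: ce_decidable comp_intros)

lemma ce_graph:
  assumes "partial_computable dec enc (f :: 'a::coded \<rightharpoonup> 'b::coded)"
  shows "ce (\<lambda>z. f (fst z) = Some (snd z))"
proof -
  have "f x = Some y \<longleftrightarrow> map_option enc (f (dec (enc x))) = Some (enc y)" for x y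
    by (cases "f x") (auto, metis dec_enc)
  moreover have "partial_recursive (\<lambda>n. map_option enc (f (dec n)))"
    using assms by (simp add: partial_computable_def)
  note ce_compose2[OF ce_graph_partial_recursive[OF this], OF
      computable_enc[OF computable_fst[OF computable_ident]]
      computable_enc[OF computable_snd[OF computable_ident]]]
  ultimately show ?thesis by (simp only:)
qed

text \<open>The program searches for a number coding a candidate value together with a stage at
  which it is confirmed, and returns the first component. Different successful searches agree
  because the graph is that of a function.\<close>

lemma partial_computable_of_ce_graph:
  fixes f :: "'a::coded \<rightharpoonup> 'b::coded"
  assumes "ce (\<lambda>z. f (fst z) = Some (snd z))"
  shows "partial_computable dec enc f"
proof -
  obtain D where D: "decidable D"
      "\<And>z. f (fst z) = Some (snd z) \<longleftrightarrow> (\<exists>s. D (z, s :: nat))"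
    using assms unfolding ce_def by blast
  define E where "E n w \<longleftrightarrow> D ((dec n, dec (fst (prod_decode w))), snd (prod_decode w))" for n w :: nat
  have "decidable (\<lambda>z. \<not> E (fst z) (snd z))"
    unfolding E_def by (intro comp_intros decidable_compose[OF D(1)])
  then have "partial_recursive (\<lambda>n. Some (of_bool (\<not> E (fst (prod_decode n)) (snd (prod_decode n)))))"
    by (simp add: decidable_def computable_def flip: prod_decode_dec)
  from partial_recursive.comp[OF partial_recursive.proj1 partial_recursive.minimize[OF this]]
  have "partial_recursive (\<lambda>n. Option.bind (least_zero (\<lambda>w. Some (of_bool (\<not> E n w))))
      (\<lambda>w. Some (fst (prod_decode w))))"
    by simp
  also have "(\<lambda>n. Option.bind (least_zero (\<lambda>w. Some (of_bool (\<not> E n w))))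
      (\<lambda>w. Some (fst (prod_decode w)))) = (\<lambda>n. map_option enc (f (dec n)))"
  proof
    fix n
    have E': "E n w \<Longrightarrow> f (dec n) = Some (dec (fst (prod_decode w)))" for w
      using D(2)[of "(dec n, dec (fst (prod_decode w)))"] by (auto simp: E_def)
    show "Option.bind (least_zero (\<lambda>w. Some (of_bool (\<not> E n w))))
      (\<lambda>w. Some (fst (prod_decode w))) = map_option enc (f (dec n))"
    proof (cases "\<exists>w. E n w")
      case True
      define w where "w = (LEAST w. E n w)"
      have "E n w" unfolding w_def using True by (rule LeastI_ex)
      moreover have "least_zero (\<lambda>w. Some (of_bool (\<not> E n w))) = Some w"
        using True by (simp add: least_zero_def w_def of_bool_def)
      ultimately show ?thesis using E' by simp
    next
      case False
      have "f (dec n) = None"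
      proof (rule ccontr)
        assume "f (dec n) \<noteq> None"
        then obtain y where "f (dec n) = Some y" by auto
        then obtain s where "D ((dec n, y), s)" using D(2)[of "(dec n, y)"] by auto
        then have "E n (prod_encode (enc y, s))" by (simp add: E_def)
        with False show False by blast
      qed
      with False show ?thesis by (simp add: least_zero_def)
    qed
  qed
  finally show ?thesis by (simp add: partial_computable_def)
qed

section \<open>Paths and computable functions on paths\<close>

lemma length_restr [simp]: "length (restr g n) = n"
  by (simp add: restr_def)

lemma nth_restr [simp]: "i < n \<Longrightarrow> restr g n ! i = g i"
  by (simp add: restr_def)

lemma take_restr [simp]: "take j (restr g n) = restr g (min j n)"
  by (simp add: restr_def take_map min_def)

lemma restr_eq_iff: "restr g n = restr h n \<longleftrightarrow> (\<forall>i<n. g i = h i)"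
  by (auto simp: list_eq_iff_nth_eq)

lemma restr_eq_mono: "restr g n = restr h n \<Longrightarrow> m \<le> n \<Longrightarrow> restr g m = restr h m"
  by (auto simp: restr_eq_iff)

lemma prefix_restr_iff: "prefix \<sigma> (restr g n) \<longleftrightarrow> length \<sigma> \<le> n \<and> restr g (length \<sigma>) = \<sigma>"
proof
  assume "prefix \<sigma> (restr g n)"
  then have "length \<sigma> \<le> n" "\<sigma> = take (length \<sigma>) (restr g n)"
    using prefix_length_le by (fastforce, metis prefix_def append_eq_conv_conj)
  then show "length \<sigma> \<le> n \<and> restr g (length \<sigma>) = \<sigma>" by (simp add: min_def)
next
  assume "length \<sigma> \<le> n \<and> restr g (length \<sigma>) = \<sigma>"
  then have "\<sigma> = take (length \<sigma>) (restr g n)" by (simp add: min_def)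
  then show "prefix \<sigma> (restr g n)" by (metis take_is_prefix)
qed

lemma prefix_restr_mono [intro]: "m \<le> n \<Longrightarrow> prefix (restr g m) (restr g n)"
  by (simp add: prefix_restr_iff)

lemma prefix_nth: "prefix xs ys \<Longrightarrow> i < length xs \<Longrightarrow> ys ! i = xs ! i"
  by (auto simp: prefix_def nth_append)

lemma take_prefix_eq: "prefix xs ys \<Longrightarrow> j \<le> length xs \<Longrightarrow> take j ys = take j xs"
  by (auto simp: prefix_def)

lemma restr_in_tree: "g \<in> paths T \<Longrightarrow> restr g n \<in> T"
  by (simp add: paths_def)

lemma leafless_tree_path:
  assumes T: "is_tree T" "leafless T" and \<sigma>: "\<sigma> \<in> T"
  shows "\<exists>g\<in>paths T. restr g (length \<sigma>) = \<sigma>"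
proof -
  have "\<exists>f. \<forall>n. (f n \<in> T \<and> length (f n) = length \<sigma> + n \<and> prefix \<sigma> (f n)) \<and> prefix (f n) (f (Suc n))"
  proof (rule dependent_nat_choice)
    show "\<exists>x. x \<in> T \<and> length x = length \<sigma> + 0 \<and> prefix \<sigma> x"
      using \<sigma> by auto
    fix x n assume x: "x \<in> T \<and> length x = length \<sigma> + n \<and> prefix \<sigma> x"
    then obtain k where "x @ [k] \<in> T" using T(2) by (auto simp: leafless_def)
    with x show "\<exists>y. (y \<in> T \<and> length y = length \<sigma> + Suc n \<and> prefix \<sigma> y) \<and> prefix x y"
      by (intro exI[of _ "x @ [k]"]) auto
  qed
  then obtain f where f: "\<And>n. f n \<in> T" "\<And>n. length (f n) = length \<sigma> + n" "\<And>n. prefix \<sigma> (f n)"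
    and fS: "\<And>n. prefix (f n) (f (Suc n))" by blast
  have mono: "prefix (f m) (f n)" if "m \<le> n" for m n
    using that by (induction rule: dec_induct) (auto intro: prefix_order.trans fS)
  \<comment> \<open>The string \<open>f (Suc i)\<close> has length at least \<open>Suc i\<close>, so
    position \<open>i\<close> exists in it.\<close>
  define g where "g i = f (Suc i) ! i" for i
  have fg: "f n ! i = g i" if "i < length (f n)" for n i
  proof (cases "Suc i \<le> n")
    case True
    then show ?thesis using prefix_nth[OF mono[OF True], of i] f(2)[of "Suc i"] by (simp add: g_def)
  next
    case False
    then show ?thesis using prefix_nth[OF mono[of n "Suc i"] that] by (simp add: g_def)
  qed
  have "restr g n = take n (f n)" for n
    by (rule nth_equalityI) (simp_all add: f(2) fg)
  then have "g \<in> paths T"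
    using T(1) f(1) unfolding paths_def is_tree_def mem_Collect_eq by (metis take_is_prefix)
  moreover have "restr g (length \<sigma>) = \<sigma>"
  proof -
    have "f 0 = \<sigma>" using f(2,3)[of 0] by (auto simp: prefix_def)
    then show ?thesis using fg[of _ 0] by (intro nth_equalityI) simp_all
  qed
  ultimately show ?thesis by blast
qed

lemma dec_pair_list_list: "pair_decode list_decode list_decode = dec"
  using pair_decode_dec[where 'a = "nat list" and 'b = "nat list"] by simp

lemma dec_pair_list_nat: "pair_decode list_decode id = dec"
  using pair_decode_dec[where 'a = "nat list" and 'b = nat] by (simp add: id_dec(1) del: dec_nat_def)

lemma decidable_strings_iff: "decidable_strings S \<longleftrightarrow> decidable (\<lambda>\<sigma>. \<sigma> \<in> S)"
  by (simp add: decidable_strings_def partial_computable_def decidable_def computable_def of_bool_def)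

text \<open>\<open>A \<sigma> \<alpha>\<close> holds if \<alpha> is an initial segment of a value of
  \<open>P\<close> on some initial segment of \<sigma>. Passing to initial segments on both sides
  makes the relation persist under extension of \<sigma> and certifies initial segments of every
  exact length, although \<open>P\<close> may skip lengths.\<close>

lemma computable_path_fun_approx:
  assumes "computable_path_fun T S \<Psi>"
  obtains A where "ce (\<lambda>z. A (fst z) (snd z))"
    and "\<And>\<sigma> \<tau> \<alpha>. A \<sigma> \<alpha> \<Longrightarrow> prefix \<sigma> \<tau> \<Longrightarrow> A \<tau> \<alpha>"
    and "\<And>g k \<alpha>. g \<in> paths T \<Longrightarrow> A (restr g k) \<alpha> \<Longrightarrow> restr (\<Psi> g) (length \<alpha>) = \<alpha>"
    and "\<And>g n. g \<in> paths T \<Longrightarrow> \<exists>k. A (restr g k) (restr (\<Psi> g) n)"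
proof -
  obtain P where P: "partial_computable list_decode list_encode P"
    and graph: "\<forall>g\<in>paths T.
      path_graph (\<Psi> g) = (\<Union>{string_graph \<alpha> | \<alpha> n. P (restr g n) = Some \<alpha>})"
    using assms unfolding computable_path_fun_def by (elim conjE exE) (rule that)
  note graph = bspec[OF graph]
  have sound: "restr (\<Psi> g) (length \<beta>) = \<beta>" if g: "g \<in> paths T" and "P (restr g n) = Some \<beta>" for g n \<beta>
  proof -
    have "string_graph \<beta> \<subseteq> path_graph (\<Psi> g)" using graph[OF g] that(2) by blast
    then have "\<forall>i<length \<beta>. \<beta> ! i = \<Psi> g i" by (auto simp: string_graph_def path_graph_def)
    then show ?thesis by (simp add: list_eq_iff_nth_eq)
  qed
  define A where "A \<sigma> \<alpha> \<longleftrightarrow> (\<exists>j\<le>length \<sigma>. \<exists>\<beta>. P (take j \<sigma>) = Some \<beta> \<and> prefix \<alpha> \<beta>)" for \<sigma> \<alpha>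
  show ?thesis
  proof
    have ceP: "ce (\<lambda>z. P (fst z) = Some (snd z))"
      using P by (intro ce_graph) simp
    show "ce (\<lambda>z. A (fst z) (snd z))"
      unfolding A_def by (intro ce_intros ce_compose2[of "\<lambda>a b. P a = Some b", OF ceP] ce_decidable comp_intros)
    show "A \<tau> \<alpha>" if "A \<sigma> \<alpha>" and p: "prefix \<sigma> \<tau>" for \<sigma> \<tau> \<alpha>
      using that(1) prefix_length_le[OF p] unfolding A_def
      by (metis take_prefix_eq[OF p] order.trans)
    show "restr (\<Psi> g) (length \<alpha>) = \<alpha>" if g: "g \<in> paths T" and A: "A (restr g k) \<alpha>" for g k \<alpha>
    proof -
      obtain j \<beta> where "P (restr g j) = Some \<beta>" "prefix \<alpha> \<beta>"
        using A by (auto simp: A_def)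
      with sound[OF g this(1)] show ?thesis by (metis prefix_restr_iff)
    qed
    show "\<exists>k. A (restr g k) (restr (\<Psi> g) n)" if g: "g \<in> paths T" for g n
    proof -
      have "(n, \<Psi> g n) \<in> path_graph (\<Psi> g)" by (auto simp: path_graph_def)
      then obtain k \<beta> where k: "P (restr g k) = Some \<beta>" and "n < length \<beta>"
        unfolding graph[OF g] by (auto simp: string_graph_def)
      then have "prefix (restr (\<Psi> g) n) \<beta>"
        using sound[OF g k] prefix_restr_mono[of n "length \<beta>" "\<Psi> g"] by simp
      with k show ?thesis by (intro exI[of _ k]) (auto simp: A_def)
    qed
  qed
qed

lemma computable_path_fun2_approx:
  assumes "computable_path_fun2 T S \<Psi>"
  obtains A where "ce (\<lambda>z. A (fst z) (fst (snd z)) (snd (snd z)))"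
    and "\<And>\<sigma> \<tau> \<sigma>' \<tau>' \<alpha>. A \<sigma> \<tau> \<alpha> \<Longrightarrow> prefix \<sigma> \<sigma>' \<Longrightarrow> prefix \<tau> \<tau>' \<Longrightarrow> A \<sigma>' \<tau>' \<alpha>"
    and "\<And>g h k l \<alpha>. g \<in> paths T \<Longrightarrow> h \<in> paths T \<Longrightarrow> A (restr g k) (restr h l) \<alpha> \<Longrightarrow>
      restr (\<Psi> g h) (length \<alpha>) = \<alpha>"
    and "\<And>g h n. g \<in> paths T \<Longrightarrow> h \<in> paths T \<Longrightarrow> \<exists>k. A (restr g k) (restr h k) (restr (\<Psi> g h) n)"
proof -
  obtain P where P: "partial_computable (pair_decode list_decode list_decode) list_encode P"
    and graph: "\<forall>g\<in>paths T. \<forall>h\<in>paths T.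
      path_graph (\<Psi> g h) = (\<Union>{string_graph \<alpha> | \<alpha> n. P (restr g n, restr h n) = Some \<alpha>})"
    using assms unfolding computable_path_fun2_def by (elim conjE exE) (rule that)
  note graph = bspec[OF bspec[OF graph]]
  have sound: "restr (\<Psi> g h) (length \<beta>) = \<beta>"
    if gh: "g \<in> paths T" "h \<in> paths T" and "P (restr g n, restr h n) = Some \<beta>" for g h n \<beta>
  proof -
    have "string_graph \<beta> \<subseteq> path_graph (\<Psi> g h)" using graph[OF gh] that(3) by blast
    then have "\<forall>i<length \<beta>. \<beta> ! i = \<Psi> g h i" by (auto simp: string_graph_def path_graph_def)
    then show ?thesis by (simp add: list_eq_iff_nth_eq)
  qed
  \<comment> \<open>Cutting both arguments to a common length \<open>j\<close> allows strings of
    different lengths, while \<open>P\<close> accepts equally long ones only.\<close>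
  define A where "A \<sigma> \<tau> \<alpha> \<longleftrightarrow> (\<exists>j\<le>length \<sigma>. j \<le> length \<tau> \<and>
    (\<exists>\<beta>. P (take j \<sigma>, take j \<tau>) = Some \<beta> \<and> prefix \<alpha> \<beta>))" for \<sigma> \<tau> \<alpha>
  show ?thesis
  proof
    have ceP: "ce (\<lambda>z. P (fst z) = Some (snd z))"
      using P by (intro ce_graph) (simp add: dec_pair_list_list)
    show "ce (\<lambda>z. A (fst z) (fst (snd z)) (snd (snd z)))"
      unfolding A_def by (intro ce_intros ce_compose2[of "\<lambda>a b. P a = Some b", OF ceP] ce_decidable comp_intros)
    show "A \<sigma>' \<tau>' \<alpha>" if "A \<sigma> \<tau> \<alpha>" and p: "prefix \<sigma> \<sigma>'" "prefix \<tau> \<tau>'" for \<sigma> \<tau> \<sigma>' \<tau>' \<alpha>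
      using that(1) prefix_length_le[OF p(1)] prefix_length_le[OF p(2)] unfolding A_def
      by (metis take_prefix_eq[OF p(1)] take_prefix_eq[OF p(2)] order.trans)
    show "restr (\<Psi> g h) (length \<alpha>) = \<alpha>"
      if gh: "g \<in> paths T" "h \<in> paths T" and A: "A (restr g k) (restr h l) \<alpha>" for g h k l \<alpha>
    proof -
      obtain j \<beta> where j: "P (restr g j, restr h j) = Some \<beta>" and "prefix \<alpha> \<beta>"
        using A by (auto simp: A_def)
      with sound[OF gh j] show ?thesis by (metis prefix_restr_iff)
    qed
    show "\<exists>k. A (restr g k) (restr h k) (restr (\<Psi> g h) n)"
      if gh: "g \<in> paths T" "h \<in> paths T" for g h n
    proof -
      have "(n, \<Psi> g h n) \<in> path_graph (\<Psi> g h)" by (auto simp: path_graph_def)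
      then obtain k \<beta> where k: "P (restr g k, restr h k) = Some \<beta>" and "n < length \<beta>"
        unfolding graph[OF gh] by (auto simp: string_graph_def)
      then have "prefix (restr (\<Psi> g h) n) \<beta>"
        using sound[OF gh k] prefix_restr_mono[of n "length \<beta>" "\<Psi> g h"] by simp
      with k show ?thesis by (intro exI[of _ k]) (auto simp: A_def)
    qed
  qed
qed

section \<open>From enumerable certificates to computable functions on paths\<close>

text \<open>Each string of \<open>T\<close> lies on a path, where all values it certifies coincide
  with that of \<Theta>. So \<open>Q\<close> is single-valued on \<open>T\<close>, and its
  restriction to \<open>T\<close> is the enumerable graph of a partial function.\<close>

lemma computable_path_nat_funI:
  assumes T: "ce (\<lambda>\<sigma>. \<sigma> \<in> T)" "\<And>\<sigma>. \<sigma> \<in> T \<Longrightarrow> \<exists>g\<in>paths T. restr g (length \<sigma>) = \<sigma>"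
    and Q: "ce (\<lambda>z. Q (fst z) (fst (snd z)) (snd (snd z)))"
    and mono: "\<And>\<sigma> \<tau> n m. Q \<sigma> n m \<Longrightarrow> prefix \<sigma> \<tau> \<Longrightarrow> \<tau> \<in> T \<Longrightarrow> Q \<tau> n m"
    and \<Theta>: "\<And>g n m. g \<in> paths T \<Longrightarrow> \<Theta> g n = m \<longleftrightarrow> (\<exists>k. Q (restr g k) n m)"
  shows "computable_path_nat_fun T \<Theta>"
proof -
  have uniq: "m = m'" if "\<sigma> \<in> T" "Q \<sigma> n m" "Q \<sigma> n m'" for \<sigma> n m m'
    using T(2)[OF that(1)] that(2,3) \<Theta> by metis
  define P where "P = (\<lambda>(\<sigma>, n). if \<sigma> \<in> T \<and> (\<exists>m. Q \<sigma> n m) then Some (THE m. Q \<sigma> n m) else None)"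
  have P: "P z = Some m \<longleftrightarrow> fst z \<in> T \<and> Q (fst z) (snd z) m" for z m
  proof -
    have "(THE m. Q \<sigma> n m) = m" if "\<sigma> \<in> T" "Q \<sigma> n m" for \<sigma> n m
      using that uniq by blast
    then show ?thesis by (auto simp: P_def split: prod.splits)
  qed
  have "ce (\<lambda>z. P (fst z) = Some (snd z))"
    unfolding P by (intro ce_intros ce_compose3[OF Q] ce_compose[OF T(1)] comp_intros)
  then have "partial_computable (pair_decode list_decode id) id P"
    by (subst dec_pair_list_nat, subst id_dec(2)) (rule partial_computable_of_ce_graph)
  moreover have "dom P \<subseteq> T \<times> UNIV" using P by (auto simp: dom_def)
  moreover have "\<forall>\<sigma>\<in>T. \<forall>\<tau>\<in>T. \<forall>n k. strict_prefix \<sigma> \<tau> \<and> P (\<sigma>, n) = Some k \<longrightarrow> P (\<tau>, n) = Some k"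
    by (auto simp: P intro: mono)
  moreover have "\<forall>g\<in>paths T. \<forall>w k. \<Theta> g w = k \<longleftrightarrow> (\<exists>n. P (restr g n, w) = Some k)"
    by (simp add: P \<Theta> restr_in_tree)
  ultimately show ?thesis unfolding computable_path_nat_fun_def by blast
qed

text \<open>
  A string of length \<open>n\<close> is mapped to the longest initial segment of the value that can be
  certified with searches bounded by \<open>n\<close>; this makes the approximation monotone.
\<close>

lemma computable_path_funI:
  assumes T: "ce (\<lambda>\<sigma>. \<sigma> \<in> T)" "\<And>\<sigma>. \<sigma> \<in> T \<Longrightarrow> \<exists>g\<in>paths T. restr g (length \<sigma>) = \<sigma>"
    and \<Psi>: "\<Psi> \<in> paths T \<rightarrow> paths S"
    and Q: "ce (\<lambda>z. Q (fst z) (fst (snd z)) (snd (snd z)))"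
    and Q_iff: "\<And>g i m. g \<in> paths T \<Longrightarrow> \<Psi> g i = m \<longleftrightarrow> (\<exists>k. Q (restr g k) i m)"
  shows "computable_path_fun T S \<Psi>"
proof -
  obtain D where D: "decidable D" and QD: "\<And>\<sigma> i m. Q \<sigma> i m \<longleftrightarrow> (\<exists>s. D ((\<sigma>, i, m), s :: nat))"
    using Q unfolding ce_def by auto
  \<comment> \<open>Bounding both the segment consulted and the stage by the length of \<sigma>
    makes the certificates decidable. Enumerability would not do, since \<open>R\<close> below also
    contains the negation of \<open>E\<close>.\<close>
  define E where "E \<sigma> i m \<longleftrightarrow> (\<exists>j\<le>length \<sigma>. \<exists>s\<le>length \<sigma>. D ((take j \<sigma>, i, m), s))" for \<sigma> i m
  have E_sound: "\<Psi> g i = m" if "g \<in> paths T" "E (restr g n) i m" for g n i m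
    using that(2) Q_iff[OF that(1)] QD by (auto simp: E_def)
  have E_mono: "E \<tau> i m" if "E \<sigma> i m" "prefix \<sigma> \<tau>" for \<sigma> \<tau> i m
  proof -
    note p = that(2)
    from that(1) obtain j s where j: "j \<le> length \<sigma>" "s \<le> length \<sigma>" "D ((take j \<sigma>, i, m), s)"
      by (auto simp: E_def)
    with p prefix_length_le[OF p] show ?thesis
      unfolding E_def by (intro exI[of _ j] exI[of _ s] conjI) (simp_all add: take_prefix_eq)
  qed
  have E_complete: "\<exists>n. E (restr g n) i (\<Psi> g i)" if g: "g \<in> paths T" for g i
  proof -
    obtain k s where "D ((restr g k, i, \<Psi> g i), s)" using Q_iff[OF g] QD by blast
    then have "E (restr g (max k s)) i (\<Psi> g i)"
      unfolding E_def by (intro exI[of _ k] conjI exI[of _ s]) simp_all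
    then show ?thesis ..
  qed
  \<comment> \<open>The bound on the entries makes the search in the last clause finite. That clause
    lets \<alpha> end only at the cap given by the length of \<sigma> or at the first position
    without a certified value.\<close>
  define R where "R \<sigma> \<alpha> \<longleftrightarrow> \<sigma> \<in> T \<and> length \<alpha> \<le> length \<sigma> \<and>
    (\<forall>i<length \<alpha>. nthd \<alpha> i \<le> length \<sigma> \<and> E \<sigma> i (nthd \<alpha> i)) \<and>
    (length \<alpha> = length \<sigma> \<or> (\<forall>m\<le>length \<sigma>. \<not> E \<sigma> (length \<alpha>) m))" for \<sigma> \<alpha>
  have R_sound: "restr (\<Psi> g) (length \<alpha>) = \<alpha>" if "g \<in> paths T" "R (restr g n) \<alpha>" for g n \<alpha>
    using E_sound[OF that(1)] that(2) by (auto simp: R_def list_eq_iff_nth_eq)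
  have R_length: "length \<alpha> \<le> length \<beta>" if R: "R \<sigma> \<alpha>" "R \<tau> \<beta>" and p: "prefix \<sigma> \<tau>" for \<sigma> \<tau> \<alpha> \<beta>
  proof (rule ccontr)
    assume less: "\<not> length \<alpha> \<le> length \<beta>"
    have "length \<sigma> \<le> length \<tau>" using p by (rule prefix_length_le)
    with less R have "nthd \<alpha> (length \<beta>) \<le> length \<tau>" "E \<sigma> (length \<beta>) (nthd \<alpha> (length \<beta>))"
      "length \<beta> \<noteq> length \<tau>"
      by (auto simp: R_def not_le intro: order.trans)
    with R(2) E_mono[OF _ p] show False by (auto simp: R_def)
  qed
  \<comment> \<open>A path through \<tau> makes both outputs initial segments of the same value, so
    only their lengths have to be compared.\<close>
  have R_mono: "prefix \<alpha> \<beta>" if R: "R \<sigma> \<alpha>" "R \<tau> \<beta>" and p: "prefix \<sigma> \<tau>" for \<sigma> \<tau> \<alpha> \<beta>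
  proof -
    obtain g where g: "g \<in> paths T" "restr g (length \<tau>) = \<tau>"
      using T(2)[of \<tau>] R(2) unfolding R_def by blast
    with p have "restr g (length \<sigma>) = \<sigma>" by (metis prefix_restr_iff)
    with R_sound[OF g(1)] R g(2) have "restr (\<Psi> g) (length \<alpha>) = \<alpha>" "restr (\<Psi> g) (length \<beta>) = \<beta>"
      by metis+
    with R_length[OF R p] show ?thesis by (metis prefix_restr_iff)
  qed
  have R_complete: "\<exists>n \<alpha>. R (restr g n) \<alpha> \<and> i < length \<alpha>" if g: "g \<in> paths T" for g i
  proof -
    obtain N where N: "\<And>i. E (restr g (N i)) i (\<Psi> g i)" using E_complete[OF g] by metis
    \<comment> \<open>This dominates, for all positions up to \<open>i\<close>, the stage needed and
      the value to be found; \<open>Suc i\<close> keeps the cap on the length beyond position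
      \<open>i\<close>.\<close>
    define n where "n = Suc i + (\<Sum>j\<le>i. N j + \<Psi> g j)"
    have n: "\<Psi> g j \<le> n \<and> E (restr g n) j (\<Psi> g j)" if "j \<le> i" for j
    proof -
      have "N j + \<Psi> g j \<le> (\<Sum>j\<le>i. N j + \<Psi> g j)"
        using that by (intro member_le_sum) auto
      then have "N j \<le> n" "\<Psi> g j \<le> n" by (simp_all add: n_def)
      then show ?thesis using E_mono[OF N] by blast
    qed
    define l where "l = (LEAST l. l = n \<or> (\<forall>m\<le>n. \<not> E (restr g n) l m))"
    have l: "l = n \<or> (\<forall>m\<le>n. \<not> E (restr g n) l m)" unfolding l_def by (rule LeastI) auto
    have "l \<le> n" unfolding l_def by (rule Least_le) auto
    have "i < l" using l n by (metis Suc_n_not_le_n add_leD1 n_def not_less)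
    moreover have "R (restr g n) (restr (\<Psi> g) l)"
    proof -
      have "\<Psi> g j \<le> n \<and> E (restr g n) j (\<Psi> g j)" if "j < l" for j
        using not_less_Least[OF that[unfolded l_def]] E_sound[OF g] by metis
      then show ?thesis using l \<open>l \<le> n\<close> g by (auto simp: R_def restr_in_tree)
    qed
    ultimately show ?thesis by (metis length_restr)
  qed
  define P where "P \<sigma> = (if \<exists>\<alpha>. R \<sigma> \<alpha> then Some (THE \<alpha>. R \<sigma> \<alpha>) else None)" for \<sigma>
  have P: "P \<sigma> = Some \<alpha> \<longleftrightarrow> R \<sigma> \<alpha>" for \<sigma> \<alpha>
  proof -
    have "(THE \<alpha>. R \<sigma> \<alpha>) = \<alpha>" if "R \<sigma> \<alpha>" for \<alpha>
      using that R_mono[of \<sigma> _ \<sigma>] by (blast intro: prefix_order.antisym)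
    then show ?thesis by (auto simp: P_def)
  qed
  have "ce (\<lambda>z. P (fst z) = Some (snd z))"
    unfolding P R_def E_def
    by (rule ce_conj, rule ce_compose[OF T(1)], rule computable_fst[OF computable_ident],
      rule ce_decidable, intro comp_intros decidable_compose[OF D])
  then have "partial_computable list_decode list_encode P"
    using partial_computable_of_ce_graph by fastforce
  moreover have "dom P \<subseteq> T" by (auto simp: dom_def P R_def)
  moreover have "ran P \<subseteq> S"
  proof -
    have "\<alpha> \<in> S" if R: "R \<sigma> \<alpha>" for \<sigma> \<alpha>
    proof -
      obtain g where g: "g \<in> paths T" "restr g (length \<sigma>) = \<sigma>"
        using T(2)[of \<sigma>] R unfolding R_def by blast
      then have "restr (\<Psi> g) (length \<alpha>) = \<alpha>" using R_sound R by metis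
      then show ?thesis using \<Psi> g(1) by (metis Pi_mem restr_in_tree)
    qed
    then show ?thesis by (auto simp: ran_def P)
  qed
  moreover have "\<forall>\<sigma> \<tau> \<alpha> \<beta>. P \<sigma> = Some \<alpha> \<and> P \<tau> = Some \<beta> \<and> prefix \<sigma> \<tau> \<longrightarrow> prefix \<alpha> \<beta>"
    unfolding P using R_mono by blast
  moreover have "path_graph (\<Psi> g) = (\<Union>{string_graph \<alpha> | \<alpha> n. P (restr g n) = Some \<alpha>})"
    if g: "g \<in> paths T" for g
  proof -
    have eq: "\<alpha> ! i = \<Psi> g i" if "R (restr g n) \<alpha>" "i < length \<alpha>" for n \<alpha> i
      using R_sound[OF g that(1)] that(2) by (metis nth_restr)
    show ?thesis
    proof (intro subset_antisym subsetI)
      fix z assume "z \<in> path_graph (\<Psi> g)"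
      then obtain i where z: "z = (i, \<Psi> g i)" by (auto simp: path_graph_def)
      obtain n \<alpha> where R: "R (restr g n) \<alpha>" "i < length \<alpha>" using R_complete[OF g] by blast
      then have "z \<in> string_graph \<alpha>" using eq z by (auto simp: string_graph_def)
      then show "z \<in> \<Union>{string_graph \<alpha> | \<alpha> n. P (restr g n) = Some \<alpha>}"
        unfolding P using R(1) by blast
    next
      fix z assume "z \<in> \<Union>{string_graph \<alpha> | \<alpha> n. P (restr g n) = Some \<alpha>}"
      then obtain \<alpha> n where "R (restr g n) \<alpha>" "z \<in> string_graph \<alpha>" unfolding P by blast
      then show "z \<in> path_graph (\<Psi> g)" by (auto simp: string_graph_def path_graph_def eq)
    qed
  qed
  ultimately show ?thesis using \<Psi> unfolding computable_path_fun_def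
    by (intro conjI exI[of _ P] ballI)
qed

section \<open>Topology of path spaces\<close>

lemma open_restr: "open {x :: nat \<Rightarrow> nat. P (restr x n)}"
proof -
  have eq: "{x. P (restr x n)} = (\<Union>y\<in>{y. P (restr y n)}. \<Inter>i\<in>{..<n}. (\<lambda>x. x i) -` {y i})" (is "_ = ?U")
  proof (intro subset_antisym subsetI)
    fix x assume "x \<in> ?U"
    then obtain y where "P (restr y n)" "\<forall>i<n. x i = y i" by auto
    then show "x \<in> {x. P (restr x n)}" using restr_eq_iff[of x n y] by simp
  qed auto
  have "open ((\<lambda>x :: nat \<Rightarrow> nat. x i) -` {k})" for i k
    by (intro open_vimage open_discrete continuous_on_product_coordinates)
  then show ?thesis by (subst eq) (intro open_UN open_INT ballI finite_lessThan)
qed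

lemma closed_restr: "closed {x :: nat \<Rightarrow> nat. P (restr x n)}"
  using open_restr[of "\<lambda>\<sigma>. \<not> P \<sigma>" n] by (simp add: closed_def Collect_neg_eq)

text \<open>Translates the product topology into agreement of initial segments, the form in which
  openness is checked from here on.\<close>

lemma openin_paths_iff:
  fixes K S :: "(nat \<Rightarrow> nat) set"
  shows "openin (top_of_set S) K \<longleftrightarrow>
    K \<subseteq> S \<and> (\<forall>g\<in>K. \<exists>n. \<forall>h\<in>S. restr h n = restr g n \<longrightarrow> h \<in> K)"
proof
  assume "openin (top_of_set S) K"
  then obtain U where U: "open U" "K = S \<inter> U" by (auto simp: openin_open)
  have "\<exists>n. \<forall>h\<in>S. restr h n = restr g n \<longrightarrow> h \<in> K" if g: "g \<in> K" for g
  proof -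
    have "openin (product_topology (\<lambda>i. euclidean) UNIV) U" "g \<in> U"
      using U g by (simp_all add: open_fun_def)
    from product_topology_open_contains_basis[OF this]
    obtain X where X: "g \<in> (\<Pi>\<^sub>E i\<in>UNIV. X i)" "(\<Pi>\<^sub>E i\<in>UNIV. X i) \<subseteq> U"
      and fin: "finite {i. X i \<noteq> topspace (euclidean :: nat topology)}"
      by (elim exE conjE) (rule that)
    then obtain n where n: "\<And>i. X i \<noteq> UNIV \<Longrightarrow> i < n"
      by (auto simp: finite_nat_set_iff_bounded)
    have "h \<in> K" if "h \<in> S" "restr h n = restr g n" for h
    proof -
      have "h i \<in> X i" for i
        using n[of i] X(1) that(2) by (cases "X i = UNIV") (auto simp: restr_eq_iff PiE_iff)
      then show ?thesis using X(2) U(2) that(1) by (auto simp: PiE_iff)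
    qed
    then show ?thesis by blast
  qed
  then show "K \<subseteq> S \<and> (\<forall>g\<in>K. \<exists>n. \<forall>h\<in>S. restr h n = restr g n \<longrightarrow> h \<in> K)"
    using U(2) by blast
next
  assume K: "K \<subseteq> S \<and> (\<forall>g\<in>K. \<exists>n. \<forall>h\<in>S. restr h n = restr g n \<longrightarrow> h \<in> K)"
  then obtain n where n: "\<And>g h. g \<in> K \<Longrightarrow> h \<in> S \<Longrightarrow> restr h (n g) = restr g (n g) \<Longrightarrow> h \<in> K"
    by metis
  define U where "U = (\<Union>g\<in>K. {x. restr x (n g) = restr g (n g)})"
  have "open {x. restr x (n g) = restr g (n g)}" for g
    by (rule open_restr[of "\<lambda>\<sigma>. \<sigma> = restr g (n g)"])
  then have "open U" unfolding U_def by (rule open_UN[OF ballI])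
  moreover have "K = S \<inter> U"
  proof (intro subset_antisym subsetI)
    fix x assume "x \<in> S \<inter> U"
    then show "x \<in> K" using n by (auto simp: U_def)
  qed (use K in \<open>auto simp: U_def\<close>)
  ultimately show "openin (top_of_set S) K" unfolding openin_open by (intro exI conjI)
qed

text \<open>The form in which compactness enters the search arguments. A condition on an initial
  segment of fixed length defines an open set; by monotonicity the largest index of a finite
  subcover works for all points at once.\<close>

lemma compact_uniform:
  assumes K: "compact K" and ex: "\<And>h. h \<in> K \<Longrightarrow> \<exists>k. Z k (restr h k)"
    and mono: "\<And>h k l. h \<in> K \<Longrightarrow> Z k (restr h k) \<Longrightarrow> k \<le> l \<Longrightarrow> Z l (restr h l)"
  shows "\<exists>k. \<forall>h\<in>K. Z k (restr h k)"
proof -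
  have "K \<subseteq> (\<Union>k\<in>UNIV. {x. Z k (restr x k)})" using ex by blast
  then obtain C where C: "finite C" "K \<subseteq> (\<Union>k\<in>C. {x. Z k (restr x k)})"
    using compactE_image[OF K, of UNIV "\<lambda>k. {x. Z k (restr x k)}"] open_restr[of "Z k" k for k]
    by metis
  have "Z (Max C) (restr h (Max C))" if h: "h \<in> K" for h
  proof -
    obtain k where "k \<in> C" "Z k (restr h k)" using C h by blast
    then show ?thesis using mono[OF h] C(1) by auto
  qed
  then show ?thesis by blast
qed

lemma compact_imp_closed_paths:
  fixes K :: "(nat \<Rightarrow> nat) set"
  assumes K: "compact K" shows "closed K"
proof -
  have "\<exists>S. open S \<and> x \<in> S \<and> S \<subseteq> - K" if x: "x \<in> - K" for x
  proof -
    have "\<exists>k. \<forall>h\<in>K. restr h k \<noteq> restr x k"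
    proof (rule compact_uniform[OF K, where Z = "\<lambda>k \<tau>. \<tau> \<noteq> restr x k"])
      fix h assume "h \<in> K"
      with x have "h \<noteq> x" by auto
      then obtain i where "h i \<noteq> x i" by blast
      then show "\<exists>k. restr h k \<noteq> restr x k" by (auto simp: restr_eq_iff)
    qed (auto dest: restr_eq_mono)
    then obtain k where "\<forall>h\<in>K. restr h k \<noteq> restr x k" by blast
    then have "{y. restr y k = restr x k} \<subseteq> - K" by auto
    moreover have "open {y. restr y k = restr x k}"
      by (rule open_restr[of "\<lambda>\<sigma>. \<sigma> = restr x k"])
    ultimately show ?thesis by blast
  qed
  then have "open (- K)" by (intro open_subopen[THEN iffD2] ballI)
  then show ?thesis by (simp add: closed_def)
qed

lemma finite_restr_image:
  assumes "compact K" shows "finite ((\<lambda>h. restr h n) ` K)"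
proof -
  obtain k where k: "\<forall>h\<in>K. n \<le> k \<and> (\<forall>i<n. restr h k ! i \<le> k)"
  proof -
    have "\<exists>k. \<forall>h\<in>K. n \<le> k \<and> (\<forall>i<n. restr h k ! i \<le> k)"
    proof (rule compact_uniform[OF assms])
      fix h :: "nat \<Rightarrow> nat"
      have "h i \<le> n + (\<Sum>i<n. h i)" if "i < n" for i
        using member_le_sum[of i "{..<n}" h] that by simp
      then show "\<exists>k. n \<le> k \<and> (\<forall>i<n. restr h k ! i \<le> k)"
        by (intro exI[of _ "n + (\<Sum>i<n. h i)"]) simp
    next
      show "n \<le> l \<and> (\<forall>i<n. restr h l ! i \<le> l)"
        if "n \<le> k \<and> (\<forall>i<n. restr h k ! i \<le> k)" "k \<le> l" for h k l
        using that by fastforce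
    qed
    then show ?thesis using that by blast
  qed
  have "(\<lambda>h. restr h n) ` K \<subseteq> {xs. set xs \<subseteq> {..k} \<and> length xs = n}"
    using k by (force simp: in_set_conv_nth)
  then show ?thesis by (rule finite_subset) (simp add: finite_lists_length_eq)
qed

lemma cylinder_subset_compact:
  assumes "compact K" "cylinder T \<sigma> \<subseteq> K" "K \<subseteq> paths T"
  shows "compact (cylinder T \<sigma>)"
proof -
  have "cylinder T \<sigma> = K \<inter> {x. restr x (length \<sigma>) = \<sigma>}"
    using assms(2,3) by (auto simp: cylinder_def)
  then show ?thesis
    using compact_Int_closed[OF assms(1) closed_restr[of "\<lambda>\<tau>. \<tau> = \<sigma>"]] by simp
qed

section \<open>Codes of compact open sets\<close>

abbreviation prm :: "nat \<Rightarrow> nat" where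
  "prm \<equiv> enumerate {p. prime p}"

lemma prm: "prime (prm i)" "inj prm" "i \<le> prm i"
  using enumerate_in_set[OF primes_infinite, of i] inj_enumerate[OF primes_infinite]
    le_enumerate[OF primes_infinite, of i] by simp_all

text \<open>The exponents in the prime factorization recover the string; adding 1 to each entry
  distinguishes an entry 0 from a missing entry.\<close>

lemma multiplicity_string_code:
  "multiplicity (prm i) (string_code w) = (if i < length w then w ! i + 1 else 0)"
proof -
  define f where "f p = w ! (inv_into UNIV prm p) + 1" for p
  have "string_code w = (\<Prod>p\<in>prm ` {..<length w}. p ^ f p)"
    unfolding string_code_def f_def
    by (subst prod.reindex) (auto simp: inj_on_subset[OF prm(2)] prm(2))
  then have "multiplicity (prm i) (string_code w) = (if prm i \<in> prm ` {..<length w} then f (prm i) else 0)"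
    by (simp only:) (rule multiplicity_prod_prime_powers, auto simp: prm(1))
  then show ?thesis using prm(2) by (auto simp: f_def inj_image_mem_iff)
qed

lemma inj_string_code: "inj string_code"
proof (rule injI)
  fix v w assume "string_code v = string_code w"
  then have *: "(if i < length v then v ! i + 1 else 0) = (if i < length w then w ! i + 1 else 0)" for i
    using multiplicity_string_code by metis
  have "i < length v \<longleftrightarrow> i < length w" for i using *[of i] by (simp split: if_splits)
  then have "length v = length w" by (metis linorder_neqE_nat less_irrefl)
  then show "v = w"
  proof (rule nth_equalityI)
    show "v ! i = w ! i" if "i < length v" for i
      using *[of i] that \<open>length v = length w\<close> by simp
  qed
qed

text \<open>Every prime power in the product is at most the code. Its exponent bounds the entry,
  because the base is at least 2, and the last prime that occurs bounds the length, because
  \<open>i \<le> prm i\<close>.\<close>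

lemma in_box_string_code:
  assumes "string_code w < c" shows "in_box c c w"
proof -
  have le: "prm i ^ (w ! i + 1) \<le> string_code w" if "i < length w" for i
    unfolding string_code_def using that prm(1)
    by (intro dvd_imp_le dvd_prodI) (auto simp: prime_gt_0_nat intro!: prod_pos)
  have "w ! i \<le> c" if "i < length w" for i
  proof -
    have "w ! i + 1 < 2 ^ (w ! i + 1)" by (rule less_exp)
    also have "\<dots> \<le> prm i ^ (w ! i + 1)" using prm(1) by (intro power_mono prime_ge_2_nat) auto
    finally show ?thesis using le[OF that] assms by simp
  qed
  moreover have "length w \<le> c"
  proof (cases "length w")
    case (Suc n)
    have "n \<le> prm n" by (rule prm(3))
    also have "\<dots> \<le> prm n ^ (w ! n + 1)" using prime_ge_1_nat[OF prm(1)] by (intro self_le_power) auto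
    also have "\<dots> \<le> string_code w" using le[of n] Suc by simp
    finally show ?thesis using Suc assms by simp
  qed simp
  ultimately show ?thesis by (auto simp: in_box_def in_set_conv_nth)
qed

text \<open>\<open>strong_index_decode\<close> is an abstract inverse function without an evident
  algorithm. Membership in the decoded set is the test of one binary digit, which is
  decidable.\<close>

definition code_mem :: "nat \<Rightarrow> nat list \<Rightarrow> bool" where
  "code_mem c \<eta> \<longleftrightarrow> string_code \<eta> \<in> set_decode c"

lemma strong_index_set_encode:
  "finite u \<Longrightarrow> strong_index u = set_encode (string_code ` u)"
  unfolding strong_index_def set_encode_def
  by (subst sum.reindex) (auto simp: inj_on_subset[OF inj_string_code])

lemma code_mem_strong_index: "finite u \<Longrightarrow> code_mem (strong_index u) \<eta> \<longleftrightarrow> \<eta> \<in> u"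
  by (simp add: code_mem_def strong_index_set_encode inj_image_mem_iff[OF inj_string_code])

lemma inj_on_strong_index: "inj_on strong_index {u. finite u}"
  by (rule inj_onI) (metis mem_Collect_eq code_mem_strong_index subsetI subset_antisym)

lemma strong_index_decode: "finite u \<Longrightarrow> strong_index_decode (strong_index u) = u"
  unfolding strong_index_decode_def by (rule inv_into_f_f[OF inj_on_strong_index]) simp

text \<open>A binary digit 1 at position \<open>string_code \<eta>\<close> forces the power of 2
  there to be at most \<open>c\<close>. Hence quantifiers over the strings of a code are bounded by
  the code.\<close>

lemma code_mem_in_box: "code_mem c \<eta> \<Longrightarrow> in_box c c \<eta>"
proof (rule in_box_string_code)
  assume "code_mem c \<eta>"
  then have "c div 2 ^ string_code \<eta> \<noteq> 0" by (auto simp: code_mem_def set_decode_def intro: ccontr)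
  then have "2 ^ string_code \<eta> \<le> c" by (metis div_less not_le)
  then show "string_code \<eta> < c" by (meson less_exp order.strict_trans2)
qed

lemma computable_prm [comp_intros]: "computable f \<Longrightarrow> computable (\<lambda>x. prm (f x))"
proof -
  assume f: "computable f"
  \<comment> \<open>Primality is rewritten with bounded quantifiers and multiplication so that the
    rules for decidable predicates apply.\<close>
  have prime: "prime p \<longleftrightarrow> 1 < p \<and> (\<forall>m<p. \<forall>k<p. m * k \<noteq> p)" for p :: nat
  proof
    assume p: "prime p"
    have "m * k \<noteq> p" if "m < p" "k < p" for m k
    proof
      assume "m * k = p"
      then have "m dvd p" by auto
      then have "m = 1 \<or> m = p" using p unfolding prime_nat_iff by blast
      then show False using that \<open>m * k = p\<close> by auto
    qed
    then show "1 < p \<and> (\<forall>m<p. \<forall>k<p. m * k \<noteq> p)" using p prime_gt_1_nat by blast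
  next
    assume p: "1 < p \<and> (\<forall>m<p. \<forall>k<p. m * k \<noteq> p)"
    have "m = 1 \<or> m = p" if "m dvd p" for m
    proof (rule ccontr)
      obtain k where k: "p = m * k" using \<open>m dvd p\<close> by (auto simp: dvd_def)
      assume "\<not> (m = 1 \<or> m = p)"
      moreover have "m \<noteq> 0" "k \<noteq> 0" using p k by (metis mult_0 mult_0_right not_less0)+
      moreover from this have "m \<le> p" using k by simp
      ultimately have "m < p" "k < p" using k by auto
      then show False using p k by metis
    qed
    then show "prime p" using p by (simp add: prime_nat_iff)
  qed
  have Suc: "prm (Suc n) = (LEAST p. prime p \<and> prm n < p)" for n
    using enumerate_Suc''[OF primes_infinite] by simp
  have "prm n = rec_nat 2 (\<lambda>_ q. LEAST p. prime p \<and> q < p) n" for n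
  proof (induction n)
    case 0
    show ?case by (auto simp: enumerate_0 intro!: Least_equality prime_ge_2_nat)
  qed (simp add: Suc)
  moreover have "\<exists>p. (1 < p \<and> (\<forall>m<p. \<forall>k<p. m * k \<noteq> p)) \<and> q < p" for q :: nat
    using bigger_prime[of q] by (simp only: prime)
  ultimately show ?thesis
    unfolding prime by (simp only:) (intro comp_intros f)
qed

lemma decidable_code_mem [comp_intros]:
  assumes c: "computable c" and f: "computable f" shows "decidable (\<lambda>x. code_mem (c x) (f x))"
proof -
  have "string_code w = rec_nat 1 (\<lambda>i v. v * prm i ^ (nthd w i + 1)) (length w)" for w
  proof -
    have "rec_nat 1 (\<lambda>i v. v * prm i ^ (nthd w i + 1)) n = (\<Prod>i<n. prm i ^ (nthd w i + 1))" for n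
      by (induction n) simp_all
    then show ?thesis by (simp add: string_code_def)
  qed
  then have sc: "computable (\<lambda>x. string_code (f x))"
    by (simp only:) (intro comp_intros f computable_compose[OF f])
  \<comment> \<open>The binary digit is expressed by a bounded search for quotient and remainder,
    which avoids division.\<close>
  have odd: "odd (c div 2 ^ j) \<longleftrightarrow> (\<exists>q\<le>c. \<exists>r<2 ^ j. c = (2 * q + 1) * 2 ^ j + r)" for c j :: nat
  proof
    assume "odd (c div 2 ^ j)"
    then obtain q where q: "c div 2 ^ j = 2 * q + 1" by (auto elim: oddE)
    have c: "c = (2 * q + 1) * 2 ^ j + c mod 2 ^ j" unfolding q[symmetric] by (rule div_mult_mod_eq[symmetric])
    have "q \<le> (2 * q + 1) * 1" by simp
    also have "\<dots> \<le> (2 * q + 1) * 2 ^ j" by (intro mult_le_mono2) simp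
    also have "\<dots> \<le> c" using c by (metis le_add1)
    finally have "q \<le> c" .
    with c show "\<exists>q\<le>c. \<exists>r<2 ^ j. c = (2 * q + 1) * 2 ^ j + r" by (metis mod_less_divisor pos2 zero_less_power)
  next
    assume "\<exists>q\<le>c. \<exists>r<2 ^ j. c = (2 * q + 1) * 2 ^ j + r"
    then obtain q r where "r < 2 ^ j" "c = (2 * q + 1) * 2 ^ j + r" by blast
    then have "c div 2 ^ j = 2 * q + 1" by (intro div_nat_eqI) (simp_all add: algebra_simps)
    then show "odd (c div 2 ^ j)" by simp
  qed
  show ?thesis unfolding code_mem_def set_decode_def mem_Collect_eq odd
    by (intro comp_intros c sc computable_compose[OF c] computable_compose[OF sc])
qed

text \<open>By compactness there is one length \<open>n\<close> at which the cylinder around every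
  point of \<open>K\<close> stays inside \<open>K\<close>. The initial segments of that length are
  finitely many and form a code; a code of \<open>K\<close> with least strong index is
  minimal.\<close>

lemma compact_open_has_minimal_code:
  assumes K: "compact K" and op: "openin (top_of_set (paths T)) K"
  shows "\<exists>u. minimal_code T u \<and> coded_set T u = K"
proof -
  have sub: "K \<subseteq> paths T" using op openin_paths_iff by blast
  have "\<exists>n. \<forall>h\<in>K. cylinder T (restr h n) \<subseteq> K"
  proof (rule compact_uniform[OF K, where Z = "\<lambda>_ \<tau>. cylinder T \<tau> \<subseteq> K"])
    show "\<exists>k. cylinder T (restr h k) \<subseteq> K" if "h \<in> K" for h
      using op that unfolding openin_paths_iff cylinder_def by fastforce
    show "cylinder T (restr h l) \<subseteq> K" if "cylinder T (restr h k) \<subseteq> K" "k \<le> l" for h k l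
      using that by (auto simp: cylinder_def dest: restr_eq_mono)
  qed
  then obtain n where n: "\<And>h. h \<in> K \<Longrightarrow> cylinder T (restr h n) \<subseteq> K" by blast
  define u where "u = (\<lambda>h. restr h n) ` K"
  have "coded_set T u = K" using n sub by (fastforce simp: coded_set_def u_def cylinder_def)
  moreover have "compact_code T u"
    unfolding compact_code_def using finite_restr_image[OF K] n sub cylinder_subset_compact[OF K]
    by (auto simp: u_def restr_in_tree)
  ultimately have "compact_code T u \<and> coded_set T u = K" by blast
  then obtain v where v: "compact_code T v \<and> coded_set T v = K"
    "\<And>w. compact_code T w \<and> coded_set T w = K \<Longrightarrow> strong_index v \<le> strong_index w"
    using ex_has_least_nat[of "\<lambda>u. compact_code T u \<and> coded_set T u = K" u strong_index] by blast
  then have "minimal_code T v"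
    unfolding minimal_code_def by (meson not_le)
  with v(1) show ?thesis by blast
qed

lemma minimal_code_unique:
  assumes "minimal_code T u" "minimal_code T v" "coded_set T u = coded_set T v"
  shows "u = v"
proof -
  have "strong_index u = strong_index v"
    using assms unfolding minimal_code_def by (metis linorder_neqE_nat)
  then show ?thesis
    using assms inj_on_strong_index by (auto simp: minimal_code_def compact_code_def inj_on_def)
qed

section \<open>Compact open cosets\<close>

text \<open>
  \<open>Mul \<sigma> \<tau> \<alpha>\<close> and \<open>Invr \<sigma> \<alpha>\<close> enumerate the finite information about products and inverses:
  \<open>\<alpha>\<close> is an initial segment of \<open>g h\<close>, respectively of \<open>g\<^sup>-\<^sup>1\<close>, whenever \<open>g\<close> extends \<open>\<sigma>\<close> and \<open>h\<close> extends \<open>\<tau>\<close>.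
\<close>

locale baire_presentation =
  fixes T :: "nat list set" and G :: "(nat \<Rightarrow> nat) monoid" (structure)
    and Mul :: "nat list \<Rightarrow> nat list \<Rightarrow> nat list \<Rightarrow> bool" and Invr :: "nat list \<Rightarrow> nat list \<Rightarrow> bool"
  assumes presentation: "computable_Baire_presentation T G"
    and Mul_ce: "ce (\<lambda>z. Mul (fst z) (fst (snd z)) (snd (snd z)))"
    and Mul_mono: "\<And>\<sigma> \<tau> \<sigma>' \<tau>' \<alpha>. Mul \<sigma> \<tau> \<alpha> \<Longrightarrow> prefix \<sigma> \<sigma>' \<Longrightarrow> prefix \<tau> \<tau>' \<Longrightarrow> Mul \<sigma>' \<tau>' \<alpha>"
    and Mul_sound: "\<And>g h k l \<alpha>. g \<in> paths T \<Longrightarrow> h \<in> paths T \<Longrightarrow> Mul (restr g k) (restr h l) \<alpha> \<Longrightarrow>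
      restr (g \<otimes> h) (length \<alpha>) = \<alpha>"
    and Mul_complete: "\<And>g h n. g \<in> paths T \<Longrightarrow> h \<in> paths T \<Longrightarrow>
      \<exists>k. Mul (restr g k) (restr h k) (restr (g \<otimes> h) n)"
    and Invr_ce: "ce (\<lambda>z. Invr (fst z) (snd z))"
    and Invr_mono: "\<And>\<sigma> \<tau> \<alpha>. Invr \<sigma> \<alpha> \<Longrightarrow> prefix \<sigma> \<tau> \<Longrightarrow> Invr \<tau> \<alpha>"
    and Invr_sound: "\<And>g k \<alpha>. g \<in> paths T \<Longrightarrow> Invr (restr g k) \<alpha> \<Longrightarrow> restr (inv g) (length \<alpha>) = \<alpha>"
    and Invr_complete: "\<And>g n. g \<in> paths T \<Longrightarrow> \<exists>k. Invr (restr g k) (restr (inv g) n)"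
begin

lemma carrier: "carrier G = paths T" and tree: "is_tree T" "leafless T"
  and lcs: "locally_compact_space (top_of_set (paths T))"
  and top_group: "topological_group G"
  using presentation by (auto simp: computable_Baire_presentation_def computably_locally_compact_def)

sublocale group G
  using top_group by (simp add: topological_group_def)

lemma closed_paths [simp]:
  "g \<in> paths T \<Longrightarrow> h \<in> paths T \<Longrightarrow> g \<otimes> h \<in> paths T" "g \<in> paths T \<Longrightarrow> inv g \<in> paths T" "\<one> \<in> paths T"
  using m_closed inv_closed one_closed by (simp_all add: carrier)

lemma inv_cancel [simp]:
  "g \<in> paths T \<Longrightarrow> h \<in> paths T \<Longrightarrow> g \<otimes> (inv g \<otimes> h) = h"
  "g \<in> paths T \<Longrightarrow> h \<in> paths T \<Longrightarrow> inv g \<otimes> (g \<otimes> h) = h"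
  by (simp_all add: carrier[symmetric] m_assoc[symmetric])

text \<open>Joint continuity in terms of initial segments: a finite certificate in
  \<open>Mul\<close> for \<open>n\<close> entries of the product uses only finitely many entries of
  the factors.\<close>

lemma mult_cont:
  assumes "g \<in> paths T" "h \<in> paths T"
  obtains l where "\<And>g' h'. g' \<in> paths T \<Longrightarrow> h' \<in> paths T \<Longrightarrow> restr g' l = restr g l \<Longrightarrow>
    restr h' l = restr h l \<Longrightarrow> restr (g' \<otimes> h') n = restr (g \<otimes> h) n"
proof -
  obtain k where k: "Mul (restr g k) (restr h k) (restr (g \<otimes> h) n)"
    using Mul_complete[OF assms] by blast
  show ?thesis
  proof (rule that)
    show "restr (g' \<otimes> h') n = restr (g \<otimes> h) n" if "g' \<in> paths T" "h' \<in> paths T"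
      "restr g' k = restr g k" "restr h' k = restr h k" for g' h'
      using Mul_sound[OF that(1,2), of k k "restr (g \<otimes> h) n"] k that(3,4) by simp
  qed
qed

lemma inv_cont:
  assumes "g \<in> paths T"
  obtains l where "\<And>g'. g' \<in> paths T \<Longrightarrow> restr g' l = restr g l \<Longrightarrow> restr (inv g') n = restr (inv g) n"
proof -
  obtain k where k: "Invr (restr g k) (restr (inv g) n)"
    using Invr_complete[OF assms] by blast
  show ?thesis
  proof (rule that)
    show "restr (inv g') n = restr (inv g) n" if "g' \<in> paths T" "restr g' k = restr g k" for g'
      using Invr_sound[OF that(1), of k "restr (inv g) n"] k that(2) by simp
  qed
qed

lemma mem_l_coset_iff:
  assumes "g \<in> paths T" "A \<subseteq> paths T"
  shows "x \<in> g <# A \<longleftrightarrow> x \<in> paths T \<and> inv g \<otimes> x \<in> A"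
proof
  assume "x \<in> g <# A"
  then obtain a where "a \<in> A" "x = g \<otimes> a" by (auto simp: l_coset_def)
  then show "x \<in> paths T \<and> inv g \<otimes> x \<in> A"
    using assms by (simp add: subset_iff carrier inv_solve_left' m_assoc[symmetric])
next
  assume x: "x \<in> paths T \<and> inv g \<otimes> x \<in> A"
  then have "x = g \<otimes> (inv g \<otimes> x)"
    using assms by (simp add: carrier m_assoc[symmetric])
  with x show "x \<in> g <# A" by (auto simp: l_coset_def)
qed

lemma openin_translate:
  assumes g: "g \<in> paths T" and A: "openin (top_of_set (paths T)) A"
  shows "openin (top_of_set (paths T)) (g <# A)"
proof -
  have sub: "A \<subseteq> paths T" using A openin_paths_iff by blast
  show ?thesis unfolding openin_paths_iff
  proof (intro conjI ballI)
    show "g <# A \<subseteq> paths T" using mem_l_coset_iff[OF g sub] by blast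
    fix x assume "x \<in> g <# A"
    then have x: "x \<in> paths T" "inv g \<otimes> x \<in> A" using mem_l_coset_iff[OF g sub] by blast+
    then obtain n where n: "\<And>h. h \<in> paths T \<Longrightarrow> restr h n = restr (inv g \<otimes> x) n \<Longrightarrow> h \<in> A"
      using A openin_paths_iff by meson
    obtain l where "\<And>g' h'. g' \<in> paths T \<Longrightarrow> h' \<in> paths T \<Longrightarrow> restr g' l = restr (inv g) l \<Longrightarrow>
        restr h' l = restr x l \<Longrightarrow> restr (g' \<otimes> h') n = restr (inv g \<otimes> x) n"
      using mult_cont[of "inv g" x n] g x(1) by auto
    then show "\<exists>l. \<forall>h\<in>paths T. restr h l = restr x l \<longrightarrow> h \<in> g <# A"
      using n g mem_l_coset_iff[OF g sub] by (intro exI[of _ l]) simp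
  qed
qed

text \<open>An open subgroup is closed, since its complement is a union of cosets.\<close>

lemma compact_Int_open_subgroup:
  assumes K: "compact K" "K \<subseteq> paths T" and U: "subgroup U G" "openin (top_of_set (paths T)) U"
  shows "compact (K \<inter> U)"
proof -
  have sub: "U \<subseteq> paths T" using U(2) openin_paths_iff by blast
  have "openin (top_of_set (paths T)) (paths T - U)"
    unfolding openin_paths_iff
  proof (intro conjI ballI)
    fix x assume x: "x \<in> paths T - U"
    then have x': "x \<in> paths T" by blast
    have "x \<in> x <# U"
      using x' sub subgroup.one_closed[OF U(1)] mem_l_coset_iff[OF x' sub] by (simp add: carrier)
    then obtain n where n: "\<And>h. h \<in> paths T \<Longrightarrow> restr h n = restr x n \<Longrightarrow> h \<in> x <# U"
      using openin_translate[OF x' U(2)] openin_paths_iff by meson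
    have "h \<notin> U" if "h \<in> x <# U" for h
    proof
      assume "h \<in> U"
      have h: "h \<in> paths T" "inv x \<otimes> h \<in> U" using that mem_l_coset_iff[OF x' sub] by blast+
      then have "h \<otimes> inv (inv x \<otimes> h) \<in> U"
        using \<open>h \<in> U\<close> U(1) by (simp add: subgroup.m_closed subgroup.m_inv_closed)
      moreover have "h \<otimes> inv (inv x \<otimes> h) = x"
        using h(1) x' by (simp add: carrier inv_mult_group)
      ultimately show False using x by simp
    qed
    then show "\<exists>n. \<forall>h\<in>paths T. restr h n = restr x n \<longrightarrow> h \<in> paths T - U"
      using n by blast
  qed simp
  then obtain S where S: "open S" "paths T - U = paths T \<inter> S" by (auto simp: openin_open)
  have "K \<inter> U = K \<inter> - S" using K(2) sub S(2) by blast
  then show ?thesis using compact_Int_closed[OF K(1), of "- S"] S(1) by (simp add: closed_def)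
qed

lemma compact_translate:
  assumes g: "g \<in> paths T" and A: "compact A" "A \<subseteq> paths T"
  shows "compact (g <# A)"
proof -
  have "continuous_on (paths T \<times> paths T) (\<lambda>(x, y). x \<otimes> y)"
    using top_group by (simp add: topological_group_def carrier)
  moreover have "continuous_on A (\<lambda>y. (g, y))"
    by (intro continuous_intros)
  moreover have "(\<lambda>y. (g, y)) ` A \<subseteq> paths T \<times> paths T" using g A(2) by auto
  ultimately have "continuous_on A (\<lambda>y. case (g, y) of (x, y) \<Rightarrow> x \<otimes> y)"
    by (rule continuous_on_compose2)
  then have "compact ((\<lambda>y. g \<otimes> y) ` A)"
    using A(1) by (simp add: compact_continuous_image)
  moreover have "(\<lambda>y. g \<otimes> y) ` A = g <# A" by (auto simp: l_coset_def)
  ultimately show ?thesis by simp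
qed

section \<open>Algebra of compact open subgroups and cosets\<close>

lemma compact_open_subgroupD:
  assumes "compact_open_subgroup V G"
  shows "subgroup V G" "compact V" "openin (top_of_set (paths T)) V" "V \<subseteq> paths T"
  using assms subgroup.subset by (force simp: compact_open_subgroup_def carrier)+

lemma compact_open_cosetD:
  assumes "compact_open_coset G A"
  shows "compact A" "openin (top_of_set (paths T)) A" "A \<subseteq> paths T" "A \<noteq> {}"
proof -
  obtain V a where V: "compact_open_subgroup V G" "a \<in> paths T" "A = a <# V"
    using assms by (auto simp: compact_open_coset_def left_coset_of_def carrier)
  note V' = compact_open_subgroupD[OF V(1)]
  show "compact A" "openin (top_of_set (paths T)) A"
    unfolding V(3) by (intro compact_translate openin_translate V' V(2))+
  then show "A \<subseteq> paths T" using openin_paths_iff by blast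
  show "A \<noteq> {}" using subgroup.one_closed[OF V'(1)] by (auto simp: V(3) l_coset_def)
qed

lemma compact_open_coset_obtain:
  assumes "compact_open_coset G A" "x \<in> A"
  obtains V where "compact_open_subgroup V G" "A = x <# V" "x \<in> paths T"
proof -
  obtain V a where V: "compact_open_subgroup V G" "a \<in> paths T" "A = a <# V"
    using assms(1) by (auto simp: compact_open_coset_def left_coset_of_def carrier)
  have "a <# V = x <# V"
    using l_repr_independence[of x a V] V assms(2) compact_open_subgroupD(1)[OF V(1)] by (simp add: carrier)
  moreover have "x \<in> paths T" using compact_open_cosetD(3)[OF assms(1)] assms(2) by blast
  ultimately show ?thesis using that V by metis
qed

lemma compact_open_cosetI:
  "compact_open_subgroup V G \<Longrightarrow> x \<in> paths T \<Longrightarrow> compact_open_coset G (x <# V)"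
  by (auto simp: compact_open_coset_def left_coset_of_def carrier)

lemma compact_open_subgroup_coset:
  assumes "compact_open_subgroup V G" shows "compact_open_coset G V"
  using compact_open_cosetI[OF assms, of \<one>] lcos_mult_one compact_open_subgroupD(4)[OF assms]
  by (simp add: carrier)

lemma compact_open_subgroup_Int:
  assumes "compact_open_subgroup U G" "compact_open_subgroup V G"
  shows "compact_open_subgroup (U \<inter> V) G"
proof -
  note U = compact_open_subgroupD[OF assms(1)] and V = compact_open_subgroupD[OF assms(2)]
  show ?thesis
    using subgroups_Inter_pair[OF U(1) V(1)] compact_Int_open_subgroup[OF U(2,4) V(1,3)]
      openin_Int[OF U(3) V(3)]
    by (simp add: compact_open_subgroup_def carrier)
qed

lemma l_coset_Int:
  assumes "g \<in> paths T" "A \<subseteq> paths T" "B \<subseteq> paths T"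
  shows "g <# (A \<inter> B) = (g <# A) \<inter> (g <# B)"
  using assms mem_l_coset_iff[OF assms(1)] by (intro subset_antisym subsetI) (auto simp: le_infI1)

text \<open>Any point of a coset can be taken as its representative, so a common point
  \<open>x\<close> reduces the claim to \<open>xU \<inter> xV = x(U \<inter> V)\<close>.\<close>

lemma compact_open_coset_Int:
  assumes A: "compact_open_coset G A" and B: "compact_open_coset G B" and ne: "A \<inter> B \<noteq> {}"
  shows "compact_open_coset G (A \<inter> B)"
proof -
  obtain x where x: "x \<in> A" "x \<in> B" using ne by blast
  obtain U where U: "compact_open_subgroup U G" "A = x <# U" "x \<in> paths T"
    using A x(1) by (rule compact_open_coset_obtain)
  obtain V where V: "compact_open_subgroup V G" "B = x <# V"
    using B x(2) by (rule compact_open_coset_obtain)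
  have "A \<inter> B = x <# (U \<inter> V)"
    using l_coset_Int[OF U(3)] compact_open_subgroupD(4) U V by simp
  then show ?thesis using compact_open_cosetI[OF compact_open_subgroup_Int] U V by simp
qed

lemma left_coset_of_translate:
  assumes "g \<in> paths T" "V \<subseteq> paths T" "left_coset_of G V A"
  shows "left_coset_of G V (g <# A)"
proof -
  obtain a where "a \<in> paths T" "A = a <# V" using assms(3) by (auto simp: left_coset_of_def carrier)
  then show ?thesis using assms(1,2)
    by (auto simp: left_coset_of_def carrier lcos_m_assoc intro!: bexI[of _ "g \<otimes> a"])
qed

lemma compact_open_coset_translate:
  assumes "g \<in> paths T" "compact_open_coset G A"
  shows "compact_open_coset G (g <# A)"
  using assms left_coset_of_translate compact_open_subgroupD(4) unfolding compact_open_coset_def by meson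

text \<open>A right coset \<open>B\<close> of \<open>V\<close> absorbs \<open>V\<close> on the left.
  The partial product of cosets is therefore a left translate of its second factor.\<close>

lemma coset_product:
  assumes V: "compact_open_subgroup V G" and x: "x \<in> paths T" and B: "right_coset_of G V B"
  shows "(x <# V) <#> B = x <# B"
proof -
  obtain y where y: "y \<in> paths T" "B = V #> y" using B by (auto simp: right_coset_of_def carrier)
  note V' = compact_open_subgroupD[OF V]
  have "V <#> B = B"
    unfolding y(2) using V'(1,4) y(1) setmult_rcos_assoc[of V V y] subgroup_mult_id[OF V'(1)]
    by (simp add: carrier)
  moreover have "B \<subseteq> paths T" using y V'(4) r_coset_subset_G[of V y] by (simp add: carrier)
  ultimately show ?thesis using setmult_lcos_assoc[of V B x] V'(4) x by (simp add: carrier)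
qed

lemma compact_open_coset_right:
  assumes V: "compact_open_subgroup V G" and B: "compact_open_coset G B"
    and A: "left_coset_of G V A" "right_coset_of G V B"
  shows "compact_open_coset G (A <#> B)"
proof -
  obtain x where "x \<in> paths T" "A = x <# V" using A(1) by (auto simp: left_coset_of_def carrier)
  then show ?thesis using coset_product[OF V _ A(2)] compact_open_coset_translate B by simp
qed

text \<open>A left coset \<open>b U\<close> is a right coset of the conjugate
  \<open>b U b\<^sup>-\<^sup>1\<close>. Surjectivity of \<open>Phi\<close> needs this in order to
  write an arbitrary coset \<open>B\<close> as a defined product \<open>V B\<close>.\<close>

lemma compact_open_coset_is_right:
  assumes "compact_open_coset G B"
  obtains V where "compact_open_subgroup V G" "right_coset_of G V B"
proof -
  obtain b where b: "b \<in> B" using compact_open_cosetD(4)[OF assms] by blast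
  obtain U where U: "compact_open_subgroup U G" "B = b <# U" "b \<in> paths T"
    using assms b by (rule compact_open_coset_obtain)
  note U' = compact_open_subgroupD[OF U(1)]
  define V where "V = {x \<in> paths T. inv b \<otimes> (x \<otimes> b) \<in> U}"
  \<comment> \<open>In this form openness of \<open>V\<close> follows from continuity of
    multiplication by \<open>b\<close>, and compactness from
    \<open>V = B b\<^sup>-\<^sup>1\<close>.\<close>
  have V_B: "V = {x \<in> paths T. x \<otimes> b \<in> B}"
    using mem_l_coset_iff[OF U(3) U'(4)] U(3) by (auto simp: V_def U(2))
  have "subgroup V G"
  proof (rule subgroupI)
    show "V \<subseteq> carrier G" by (auto simp: V_def carrier)
    have "\<one> \<in> V" using U(3) subgroup.one_closed[OF U'(1)] by (simp add: V_def carrier)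
    then show "V \<noteq> {}" by blast
    show "inv x \<in> V" if x: "x \<in> V" for x
    proof -
      have "inv b \<otimes> (inv x \<otimes> b) = inv (inv b \<otimes> (x \<otimes> b))"
        using x U(3) by (simp add: V_def carrier inv_mult_group m_assoc)
      then show ?thesis using x U(3) subgroup.m_inv_closed[OF U'(1)] by (simp add: V_def)
    qed
    show "x \<otimes> y \<in> V" if x: "x \<in> V" and y: "y \<in> V" for x y
    proof -
      have "inv b \<otimes> ((x \<otimes> y) \<otimes> b) = (inv b \<otimes> (x \<otimes> b)) \<otimes> (inv b \<otimes> (y \<otimes> b))"
        using x y U(3) by (simp add: V_def carrier m_assoc)
      then show ?thesis using x y U(3) subgroup.m_closed[OF U'(1)] by (simp add: V_def)
    qed
  qed
  moreover have "openin (top_of_set (paths T)) V"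
    unfolding openin_paths_iff
  proof (intro conjI ballI)
    fix x assume "x \<in> V"
    then have x: "x \<in> paths T" "x \<otimes> b \<in> B" by (auto simp: V_B)
    then obtain n where n: "\<And>h. h \<in> paths T \<Longrightarrow> restr h n = restr (x \<otimes> b) n \<Longrightarrow> h \<in> B"
      using compact_open_cosetD(2)[OF assms] openin_paths_iff by meson
    obtain l where "\<And>g' h'. g' \<in> paths T \<Longrightarrow> h' \<in> paths T \<Longrightarrow> restr g' l = restr x l \<Longrightarrow>
        restr h' l = restr b l \<Longrightarrow> restr (g' \<otimes> h') n = restr (x \<otimes> b) n"
      using mult_cont[OF x(1) U(3), of n] by blast
    then show "\<exists>l. \<forall>h\<in>paths T. restr h l = restr x l \<longrightarrow> h \<in> V"
      using n U(3) by (intro exI[of _ l]) (simp add: V_B)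
  qed (simp add: V_def)
  moreover have "compact V"
  proof -
    have "continuous_on (paths T \<times> paths T) (\<lambda>(x, y). x \<otimes> y)"
      using top_group by (simp add: topological_group_def carrier)
    moreover have "continuous_on B (\<lambda>y. (y, inv b))"
      by (intro continuous_intros)
    moreover have "(\<lambda>y. (y, inv b)) ` B \<subseteq> paths T \<times> paths T"
      using U(3) compact_open_cosetD(3)[OF assms] by auto
    ultimately have "continuous_on B (\<lambda>y. case (y, inv b) of (x, y) \<Rightarrow> x \<otimes> y)"
      by (rule continuous_on_compose2)
    then have "compact ((\<lambda>y. y \<otimes> inv b) ` B)"
      using compact_open_cosetD(1)[OF assms] by (simp add: compact_continuous_image)
    moreover have "(\<lambda>y. y \<otimes> inv b) ` B = V"
    proof (intro subset_antisym subsetI)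
      fix x assume "x \<in> V"
      then have "x = (x \<otimes> b) \<otimes> inv b" "x \<otimes> b \<in> B"
        using U(3) by (auto simp: V_B carrier m_assoc)
      then show "x \<in> (\<lambda>y. y \<otimes> inv b) ` B" by blast
    next
      fix x assume "x \<in> (\<lambda>y. y \<otimes> inv b) ` B"
      then show "x \<in> V" using U(3) compact_open_cosetD(3)[OF assms]
        by (auto simp: V_B carrier m_assoc subset_iff)
    qed
    ultimately show ?thesis by simp
  qed
  ultimately have "compact_open_subgroup V G"
    by (simp add: compact_open_subgroup_def carrier)
  moreover have "B = V #> b"
  proof (intro subset_antisym subsetI)
    fix x assume x: "x \<in> B"
    then have "x \<in> paths T" using compact_open_cosetD(3)[OF assms] by blast
    then have "x = (x \<otimes> inv b) \<otimes> b" "x \<otimes> inv b \<in> V"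
      using U(3) x by (auto simp: V_B carrier m_assoc)
    then show "x \<in> V #> b" by (auto simp: r_coset_def)
  qed (auto simp: r_coset_def V_B)
  then have "right_coset_of G V B" using U(3) by (auto simp: right_coset_of_def carrier)
  ultimately show ?thesis by (rule that)
qed

text \<open>
  Van Dantzig: for a compact open neighbourhood \<open>K\<close> of the identity, the stabiliser of \<open>K\<close> under
  left translation is an open subgroup contained in \<open>K\<close>.
\<close>

lemma compact_open_subgroup_in_nbhd:
  assumes K: "compact K" "openin (top_of_set (paths T)) K" "\<one> \<in> K"
  obtains U where "compact_open_subgroup U G" "U \<subseteq> K"
proof -
  have sub: "K \<subseteq> paths T" using K(2) openin_paths_iff by blast
  \<comment> \<open>Imposing the condition on both \<open>x\<close> and \<open>inv x\<close> makes
    closure under inverses immediate.\<close>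
  define U where "U = {x \<in> paths T. (\<forall>k\<in>K. x \<otimes> k \<in> K) \<and> (\<forall>k\<in>K. inv x \<otimes> k \<in> K)}"
  have sg: "subgroup U G"
  proof (rule subgroupI)
    show "U \<subseteq> carrier G" by (auto simp: U_def carrier)
    have "\<one> \<in> U" using sub by (auto simp: U_def subset_iff carrier[symmetric])
    then show "U \<noteq> {}" by blast
    show "inv x \<in> U" if "x \<in> U" for x
      using that by (auto simp: U_def carrier[symmetric])
    show "x \<otimes> y \<in> U" if x: "x \<in> U" and y: "y \<in> U" for x y
    proof -
      have "x \<otimes> y \<otimes> k = x \<otimes> (y \<otimes> k)" "inv (x \<otimes> y) \<otimes> k = inv y \<otimes> (inv x \<otimes> k)" if "k \<in> K" for k
        using x y that sub by (auto simp: U_def carrier m_assoc inv_mult_group subset_iff)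
      then show ?thesis using x y by (simp add: U_def)
    qed
  qed
  \<comment> \<open>The quantifier over all \<open>h'\<close> that share the initial segment of
    \<open>h\<close> makes the condition depend on that segment alone, as
    \<open>compact_uniform\<close> requires.\<close>
  have "\<exists>l. \<forall>h\<in>K. \<forall>x\<in>paths T. restr x l = restr \<one> l \<longrightarrow>
    (\<forall>h'\<in>paths T. restr h' l = restr h l \<longrightarrow> x \<otimes> h' \<in> K)"
  proof (rule compact_uniform[OF K(1), where Z = "\<lambda>l \<tau>. \<forall>x\<in>paths T. restr x l = restr \<one> l \<longrightarrow>
      (\<forall>h'\<in>paths T. restr h' l = \<tau> \<longrightarrow> x \<otimes> h' \<in> K)"])
    fix h assume h: "h \<in> K"
    then have h': "h \<in> paths T" using sub by blast
    obtain n where n: "\<And>x. x \<in> paths T \<Longrightarrow> restr x n = restr h n \<Longrightarrow> x \<in> K"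
      using K(2) h openin_paths_iff by meson
    obtain l where "\<And>g' h'. g' \<in> paths T \<Longrightarrow> h' \<in> paths T \<Longrightarrow> restr g' l = restr \<one> l \<Longrightarrow>
        restr h' l = restr h l \<Longrightarrow> restr (g' \<otimes> h') n = restr (\<one> \<otimes> h) n"
      using mult_cont[OF closed_paths(3) h', of n] by blast
    then show "\<exists>l. \<forall>x\<in>paths T. restr x l = restr \<one> l \<longrightarrow>
      (\<forall>h'\<in>paths T. restr h' l = restr h l \<longrightarrow> x \<otimes> h' \<in> K)"
      using n h' by (intro exI[of _ l]) (simp add: carrier)
  next
    fix h k l
    assume "\<forall>x\<in>paths T. restr x k = restr \<one> k \<longrightarrow>
      (\<forall>h'\<in>paths T. restr h' k = restr h k \<longrightarrow> x \<otimes> h' \<in> K)" "k \<le> l"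
    then show "\<forall>x\<in>paths T. restr x l = restr \<one> l \<longrightarrow>
      (\<forall>h'\<in>paths T. restr h' l = restr h l \<longrightarrow> x \<otimes> h' \<in> K)"
      using restr_eq_mono by metis
  qed
  then obtain l where l: "\<And>h x. h \<in> K \<Longrightarrow> x \<in> paths T \<Longrightarrow> restr x l = restr \<one> l \<Longrightarrow> x \<otimes> h \<in> K"
    using sub by blast
  obtain m where m: "\<And>x. x \<in> paths T \<Longrightarrow> restr x m = restr \<one> m \<Longrightarrow> restr (inv x) l = restr \<one> l"
    using inv_cont[OF closed_paths(3), of l] by auto
  \<comment> \<open>\<open>U\<close> contains a basic neighbourhood of the identity; translating it
    by elements of the subgroup makes \<open>U\<close> open at every point.\<close>
  have U_nbhd: "x \<in> U" if x: "x \<in> paths T" "restr x (max l m) = restr \<one> (max l m)" for x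
  proof -
    have "restr x l = restr \<one> l" "restr x m = restr \<one> m" using restr_eq_mono[OF x(2)] by simp_all
    then show ?thesis using l m x(1) by (simp add: U_def)
  qed
  have op: "openin (top_of_set (paths T)) U"
    unfolding openin_paths_iff
  proof (intro conjI ballI)
    fix x assume x: "x \<in> U"
    then have x': "x \<in> paths T" by (simp add: U_def)
    obtain n where n: "\<And>g' h'. g' \<in> paths T \<Longrightarrow> h' \<in> paths T \<Longrightarrow> restr g' n = restr (inv x) n \<Longrightarrow>
        restr h' n = restr x n \<Longrightarrow> restr (g' \<otimes> h') (max l m) = restr (inv x \<otimes> x) (max l m)"
      using mult_cont[of "inv x" x "max l m"] x' by auto
    have "h \<in> U" if h: "h \<in> paths T" "restr h n = restr x n" for h
    proof -
      have "restr (inv x \<otimes> h) (max l m) = restr \<one> (max l m)"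
        using n[of "inv x" h] x' h by (simp add: carrier)
      then have "inv x \<otimes> h \<in> U" using U_nbhd x' h(1) by simp
      then have "x \<otimes> (inv x \<otimes> h) \<in> U" by (rule subgroup.m_closed[OF sg x])
      then show ?thesis using x' h(1) by (simp add: carrier m_assoc[symmetric])
    qed
    then show "\<exists>n. \<forall>h\<in>paths T. restr h n = restr x n \<longrightarrow> h \<in> U" by blast
  qed (simp add: U_def)
  have "U \<subseteq> K"
  proof
    fix x assume "x \<in> U"
    then have "x \<otimes> \<one> \<in> K" "x \<in> carrier G" using K(3) by (auto simp: U_def carrier)
    then show "x \<in> K" by simp
  qed
  then have "compact (K \<inter> U)" "K \<inter> U = U"
    using compact_Int_open_subgroup[OF K(1) sub sg op] by auto
  then show ?thesis using that sg op \<open>U \<subseteq> K\<close> by (simp add: compact_open_subgroup_def carrier)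
qed

text \<open>Continuity of multiplication at the identity keeps \<open>n\<close> entries of
  \<open>g h\<close> fixed for \<open>h\<close> near the identity, and local compactness provides a
  compact cylinder there, inside which a compact open subgroup exists. Thus \<open>n\<close> entries
  of \<open>g\<close> are determined by the set \<open>g U\<close>.\<close>

lemma small_compact_open_subgroup:
  assumes g: "g \<in> paths T"
  obtains U where "compact_open_subgroup U G" "\<forall>x\<in>g <# U. restr x n = restr g n"
proof -
  obtain l where l: "\<And>h. h \<in> paths T \<Longrightarrow> restr h l = restr \<one> l \<Longrightarrow> restr (g \<otimes> h) n = restr g n"
  proof -
    obtain l where "\<And>g' h'. g' \<in> paths T \<Longrightarrow> h' \<in> paths T \<Longrightarrow> restr g' l = restr g l \<Longrightarrow>
        restr h' l = restr \<one> l \<Longrightarrow> restr (g' \<otimes> h') n = restr (g \<otimes> \<one>) n"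
      using mult_cont[OF g closed_paths(3), of n] by blast
    with g show ?thesis by (intro that[of l]) (simp add: carrier)
  qed
  have "\<exists>W K. openin (top_of_set (paths T)) W \<and> compactin (top_of_set (paths T)) K \<and> \<one> \<in> W \<and> W \<subseteq> K"
    using lcs closed_paths(3) unfolding locally_compact_space_def topspace_euclidean_subtopology by blast
  then obtain W K where WK: "openin (top_of_set (paths T)) W" "compactin (top_of_set (paths T)) K"
    "\<one> \<in> W" "W \<subseteq> K" by blast
  then obtain m where m: "\<And>h. h \<in> paths T \<Longrightarrow> restr h m = restr \<one> m \<Longrightarrow> h \<in> W"
    using openin_paths_iff by meson
  \<comment> \<open>The length \<open>l\<close> controls the entries of the translates, and
    \<open>m\<close> keeps the cylinder inside the compact set \<open>K\<close>.\<close>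
  define C where "C = cylinder T (restr \<one> (max l m))"
  have C: "x \<in> C \<longleftrightarrow> x \<in> paths T \<and> restr x (max l m) = restr \<one> (max l m)" for x
    by (simp add: C_def cylinder_def)
  have agree: "restr x l = restr \<one> l" "restr x m = restr \<one> m" if "x \<in> C" for x
    using that restr_eq_mono[of x "max l m" \<one>] by (simp_all add: C)
  have "C \<subseteq> K" using m WK(4) agree(2) C by blast
  then have "compact C"
    using WK(2) cylinder_subset_compact unfolding C_def by (auto simp: compactin_subtopology)
  moreover have "openin (top_of_set (paths T)) C"
    unfolding openin_paths_iff by (auto simp: C intro!: exI[of _ "max l m"])
  moreover have "\<one> \<in> C" by (simp add: C)
  ultimately obtain U where U: "compact_open_subgroup U G" "U \<subseteq> C"
    by (rule compact_open_subgroup_in_nbhd)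
  show ?thesis
  proof (rule that[OF U(1)], rule ballI)
    fix x assume "x \<in> g <# U"
    then obtain h where h: "h \<in> U" "x = g \<otimes> h" by (auto simp: l_coset_def)
    then have "h \<in> paths T" "restr h l = restr \<one> l"
      using U(2) agree(1) C by blast+
    then show "restr x n = restr g n" using l h(2) by simp
  qed
qed

end

section \<open>The action on compact open cosets\<close>

locale coset_presentation = baire_presentation +
  fixes \<theta> :: "nat \<Rightarrow> nat"
  assumes enumeration: "coset_enumeration T G \<theta>"
begin

abbreviation A :: "nat \<Rightarrow> (nat \<Rightarrow> nat) set" where
  "A \<equiv> coset_seq T \<theta>"

abbreviation act :: "(nat \<Rightarrow> nat) \<Rightarrow> nat \<Rightarrow> nat" where
  "act \<equiv> coset_action T G \<theta>"

abbreviation index :: "(nat \<Rightarrow> nat) set \<Rightarrow> nat" where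
  "index \<equiv> coset_index T \<theta>"

abbreviation W :: meet_groupoid where
  "W \<equiv> W_comp T G \<theta>"

text \<open>The strong index of the code of \<open>A n\<close>, with \<open>0\<close> as the index of the empty code.\<close>

definition code :: "nat \<Rightarrow> nat" where
  "code n = (if n = 0 then 0 else \<theta> n)"

lemma coset_seq_0 [simp]: "A 0 = {}"
  by (simp add: coset_seq_def)

lemma theta_minimal_code:
  assumes "n \<noteq> 0"
  obtains u where "minimal_code T u" "finite u" "\<theta> n = strong_index u" "A n = coded_set T u"
    "compact_open_coset G (A n)"
proof -
  have "\<theta> n \<in> coset_code_numbers T G"
    using enumeration assms by (auto simp: coset_enumeration_def bij_betw_def)
  then obtain u where u: "\<theta> n = strong_index u" "minimal_code T u" "compact_open_coset G (coded_set T u)"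
    by (auto simp: coset_code_numbers_def)
  moreover have fin: "finite u" using u(2) by (simp add: minimal_code_def compact_code_def)
  moreover have "A n = coded_set T u" using assms u(1) fin by (simp add: coset_seq_def strong_index_decode)
  ultimately show ?thesis using that by simp
qed

lemma coset_seq_coset: "n \<noteq> 0 \<Longrightarrow> compact_open_coset G (A n)"
  by (rule theta_minimal_code)

lemma coset_seq_subset: "A n \<subseteq> paths T"
  using coset_seq_coset[of n] compact_open_cosetD(3) by (cases "n = 0") auto

lemma compact_coset_seq: "compact (A n)"
  using coset_seq_coset[of n] compact_open_cosetD(1) by (cases "n = 0") auto

text \<open>Minimal codes are determined by the sets they code, \<theta> is injective on positive
  numbers, and cosets differ from \<open>A 0\<close> by being nonempty. This justifies the definite
  description in \<open>coset_index\<close>.\<close>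

lemma coset_seq_inj: "A m = A n \<Longrightarrow> m = n"
proof -
  assume eq: "A m = A n"
  show "m = n"
  proof (cases "m = 0 \<or> n = 0")
    case True
    then show ?thesis using eq coset_seq_coset compact_open_cosetD(4) by (metis coset_seq_0)
  next
    case False
    then obtain u v where "minimal_code T u" "\<theta> m = strong_index u" "A m = coded_set T u"
      "minimal_code T v" "\<theta> n = strong_index v" "A n = coded_set T v"
      by (meson theta_minimal_code)
    then have "\<theta> m = \<theta> n" using minimal_code_unique eq by metis
    then show ?thesis using enumeration False by (auto simp: coset_enumeration_def bij_betw_def inj_on_def)
  qed
qed

lemma coset_index_coset_seq [simp]: "index (A n) = n"
  unfolding coset_index_def by (rule the_equality) (auto dest: coset_seq_inj)

lemma ex_coset_index:
  assumes "compact_open_coset G C"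
  shows "\<exists>n. A n = C"
proof -
  obtain u where u: "minimal_code T u" "coded_set T u = C"
    using compact_open_has_minimal_code compact_open_cosetD[OF assms] by meson
  then have "strong_index u \<in> coset_code_numbers T G"
    using assms by (auto simp: coset_code_numbers_def)
  then obtain n where n: "n \<ge> 1" "\<theta> n = strong_index u"
    using enumeration by (force simp: coset_enumeration_def bij_betw_def)
  moreover have "finite u" using u(1) by (simp add: minimal_code_def compact_code_def)
  ultimately show ?thesis using u(2) by (intro exI[of _ n]) (simp add: coset_seq_def strong_index_decode)
qed

lemma ex_coset_seq_subgroup: "\<exists>n. compact_open_subgroup (A n) G"
proof -
  obtain U where U: "compact_open_subgroup U G"
    by (rule small_compact_open_subgroup[OF closed_paths(3)])
  with ex_coset_index[OF compact_open_subgroup_coset[OF U]] show ?thesis by metis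
qed

lemma coset_seq_index: "C = {} \<or> compact_open_coset G C \<Longrightarrow> A (index C) = C"
  using ex_coset_index coset_index_coset_seq coset_seq_0 by metis

lemma coset_seq_action:
  assumes "g \<in> paths T" shows "A (act g n) = g <# A n"
  unfolding coset_action_def
proof (rule coset_seq_index)
  show "g <# A n = {} \<or> compact_open_coset G (g <# A n)"
    using compact_open_coset_translate[OF assms coset_seq_coset] by (cases "n = 0") (auto simp: l_coset_def)
qed

lemma action_eq_iff: "g \<in> paths T \<Longrightarrow> act g n = m \<longleftrightarrow> g <# A n = A m"
  using coset_seq_action coset_seq_inj by metis

lemma coset_seq_meet: "A (mg_meet W a b) = A a \<inter> A b"
  unfolding W_comp_def meet_groupoid.simps
proof (rule coset_seq_index)
  show "A a \<inter> A b = {} \<or> compact_open_coset G (A a \<inter> A b)"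
    using compact_open_coset_Int coset_seq_coset by (cases "a = 0"; cases "b = 0") auto
qed

text \<open>A defined product is again a compact open coset, so it has an index, and an equation
  between indices becomes one between sets.\<close>

lemma mg_prod_eq_Some:
  "mg_prod W a b = Some c \<longleftrightarrow>
    (\<exists>V. compact_open_subgroup V G \<and> left_coset_of G V (A a) \<and> right_coset_of G V (A b)) \<and>
    A c = A a <#> A b" (is "_ \<longleftrightarrow> ?V \<and> _")
proof (cases ?V)
  case True
  then obtain V where V: "compact_open_subgroup V G" "left_coset_of G V (A a)" "right_coset_of G V (A b)"
    by blast
  have "A b \<noteq> {}"
    using V(1,3) compact_open_subgroupD(1) subgroup.one_closed
    by (fastforce simp: right_coset_of_def r_coset_def)
  then have "b \<noteq> 0" by auto
  then have "compact_open_coset G (A a <#> A b)"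
    using compact_open_coset_right V coset_seq_coset by blast
  then have "A (index (A a <#> A b)) = A a <#> A b" by (simp add: coset_seq_index)
  then have "index (A a <#> A b) = c \<longleftrightarrow> A c = A a <#> A b" using coset_seq_inj by metis
  then show ?thesis using True by (simp add: W_comp_def)
next
  case False
  then have "mg_prod W a b = None" unfolding W_comp_def meet_groupoid.simps by (rule if_not_P)
  with False show ?thesis by simp
qed

lemma action_inverse:
  assumes "g \<in> paths T"
  shows "act (inv g) (act g n) = n" "act g (act (inv g) n) = n"
proof -
  have "A (act (inv g) (act g n)) = A n" "A (act g (act (inv g) n)) = A n"
    using assms coset_seq_subset[of n] by (simp_all add: coset_seq_action lcos_m_assoc carrier lcos_mult_one)
  then show "act (inv g) (act g n) = n" "act g (act (inv g) n) = n"
    using coset_seq_inj by blast+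
qed

lemma bij_action: "g \<in> paths T \<Longrightarrow> bij (act g)"
  by (rule o_bij[of "act (inv g)"]) (auto simp: action_inverse)

lemma inv_action_eq_iff: "g \<in> paths T \<Longrightarrow> inv_into UNIV (act g) n = m \<longleftrightarrow> act g m = n"
  using bij_action by (metis bij_inv_eq_iff)

section \<open>The map Phi is a bijection onto the group of the meet groupoid\<close>

text \<open>Left translation commutes with intersections and with multiplication from the right. It
  also sends left cosets of \<open>V\<close> to left cosets of \<open>V\<close>, so definedness of
  products is preserved.\<close>

lemma Phi_in_carrier:
  assumes g: "g \<in> paths T"
  shows "Phi T G \<theta> g \<in> carrier (G_comp W)"
proof -
  have "act g (mg_meet W a b) = mg_meet W (act g a) (act g b)" for a b
    by (rule coset_seq_inj)
      (simp add: coset_seq_action[OF g] coset_seq_meet l_coset_Int[OF g] coset_seq_subset)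
  moreover have "mg_prod W (act g a) b = Some (act g c)" if "mg_prod W a b = Some c" for a b c
  proof -
    obtain V where V: "compact_open_subgroup V G" "left_coset_of G V (A a)" "right_coset_of G V (A b)"
      and c: "A c = A a <#> A b"
      using \<open>mg_prod W a b = Some c\<close> unfolding mg_prod_eq_Some by blast
    have "left_coset_of G V (g <# A a)"
      using left_coset_of_translate[OF g _ V(2)] compact_open_subgroupD(4)[OF V(1)] by blast
    moreover have "g <# (A a <#> A b) = (g <# A a) <#> A b"
      using setmult_lcos_assoc[of "A a" "A b" g] g coset_seq_subset by (simp add: carrier)
    ultimately show ?thesis
      unfolding mg_prod_eq_Some coset_seq_action[OF g] c using V(1,3) by blast
  qed
  ultimately show ?thesis
    using bij_action[OF g] by (auto simp: G_comp_def Phi_def)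
qed

text \<open>If \<open>g\<close> and \<open>h\<close> act alike, then \<open>h\<close> lies in
  \<open>h U = g U\<close>; for small \<open>U\<close> all points of \<open>g U\<close> agree with
  \<open>g\<close> on any given number of entries.\<close>

lemma inj_on_Phi: "inj_on (Phi T G \<theta>) (paths T)"
proof (rule inj_onI)
  fix g h assume g: "g \<in> paths T" and h: "h \<in> paths T" and eq: "Phi T G \<theta> g = Phi T G \<theta> h"
  have "act g n = act h n" for n
    using fun_cong[OF eq, of "2 * n"] by (simp add: Phi_def interleave_def)
  then have act: "g <# A n = h <# A n" for n
    using coset_seq_action g h by metis
  have "restr h n = restr g n" for n
  proof -
    obtain U where U: "compact_open_subgroup U G" "\<forall>x\<in>g <# U. restr x n = restr g n"
      by (rule small_compact_open_subgroup[OF g, of n])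
    obtain m where "A m = U" using ex_coset_index[OF compact_open_subgroup_coset[OF U(1)]] by blast
    then have "h \<in> g <# U"
      using act[of m] mem_l_coset_iff[OF h compact_open_subgroupD(4)[OF U(1)]] h
        subgroup.one_closed[OF compact_open_subgroupD(1)[OF U(1)]] by (simp add: carrier)
    then show ?thesis using U(2) by blast
  qed
  then show "g = h" by (metis restr_eq_iff ext lessI)
qed

text \<open>For compact open subgroups \<open>U\<close>, the sets \<open>f(U)\<close> are left
  cosets of \<open>U\<close> with the finite intersection property, so by compactness some
  \<open>g\<close> lies in all of them and \<open>f(U) = g U\<close>. A general coset
  \<open>B\<close> equals \<open>V B\<close> for some \<open>V\<close>, whence
  \<open>f(B) = f(V) B = g V B = g B\<close>.\<close>

lemma Phi_surj:
  assumes f: "bij f" "\<And>a b. f (mg_meet W a b) = mg_meet W (f a) (f b)"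
    and prod: "\<And>a b c. mg_prod W a b = Some c \<Longrightarrow> mg_prod W (f a) b = Some (f c)"
  shows "\<exists>g\<in>paths T. act g = f"
proof -
  have ne: "A (f n) \<noteq> {}" if n: "A n \<noteq> {}" for n
  proof
    assume "A (f n) = {}"
    \<comment> \<open>The empty set is absorbing for intersection. Comparing it with a preimage
      \<open>z\<close> of 0 gives \<open>f 0 = 0\<close>, and injectivity then excludes further
      zeros.\<close>
    obtain z where z: "f z = 0" using f(1) by (metis bij_pointE)
    have "f n = 0" using \<open>A (f n) = {}\<close> coset_seq_inj by (metis coset_seq_0)
    have "mg_meet W 0 n = 0" "mg_meet W 0 z = 0" "mg_meet W 0 (f 0) = 0"
      by (rule coset_seq_inj, simp add: coset_seq_meet)+
    then have "f 0 = mg_meet W (f 0) (f z)" using f(2)[of 0 z] by simp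
    also have "\<dots> = 0" unfolding z by (rule coset_seq_inj) (simp add: coset_seq_meet)
    finally have "n = 0" using \<open>f n = 0\<close> f(1) by (metis bij_is_inj injD)
    with n show False by simp
  qed
  have subgp: "left_coset_of G (A n) (A (f n))" if n: "compact_open_subgroup (A n) G" for n
  proof -
    note A = compact_open_subgroupD[OF n]
    have "A n <#> A n = A n" by (rule subgroup_mult_id[OF A(1)])
    moreover have "left_coset_of G (A n) (A n)" "right_coset_of G (A n) (A n)"
      using A(4) by (auto simp: left_coset_of_def right_coset_of_def carrier lcos_mult_one coset_mult_one
          intro!: bexI[of _ \<one>])
    \<comment> \<open>For a subgroup \<open>U\<close>, the product \<open>U U = U\<close> is sent to
      a defined product \<open>f(U) U\<close>. So \<open>f(U)\<close> is a left coset of some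
      \<open>V\<close> of which \<open>U\<close> is a right coset, and \<open>V = U\<close> because
      \<open>U\<close> contains the identity.\<close>
    ultimately have "mg_prod W n n = Some n" unfolding mg_prod_eq_Some using n by auto
    from prod[OF this] obtain V where V: "compact_open_subgroup V G" "left_coset_of G V (A (f n))"
      "right_coset_of G V (A n)" unfolding mg_prod_eq_Some by blast
    obtain y where y: "y \<in> carrier G" "A n = V #> y" using V(3) by (auto simp: right_coset_of_def)
    have "V = A n"
      using coset_join1 repr_independence[of \<one> V y] y subgroup.one_closed[OF A(1)]
        compact_open_subgroupD[OF V(1)] by (simp add: carrier coset_mult_one)
    with V(2) show ?thesis by simp
  qed
  define F where "F = {A (f n) | n. compact_open_subgroup (A n) G}"
  have F: "compact X \<and> X \<subseteq> paths T" if "X \<in> F" for X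
    using that compact_coset_seq coset_seq_subset by (auto simp: F_def)
  have fin_Int: "\<exists>n. compact_open_subgroup (A n) G \<and> A (f n) \<subseteq> \<Inter>E" if "finite E" "E \<subseteq> F" for E
    using that
  proof (induction E)
    case empty
    show ?case using ex_coset_seq_subgroup by simp
  next
    case (insert X E)
    then obtain n where n: "compact_open_subgroup (A n) G" "A (f n) \<subseteq> \<Inter>E" by auto
    obtain m where m: "compact_open_subgroup (A m) G" "X = A (f m)" using insert.prems by (auto simp: F_def)
    have "A (f (mg_meet W n m)) = A (f n) \<inter> A (f m)" by (simp add: f(2) coset_seq_meet)
    moreover have "compact_open_subgroup (A (mg_meet W n m)) G"
      using compact_open_subgroup_Int[OF n(1) m(1)] by (simp add: coset_seq_meet)
    ultimately show ?case using n(2) m(2) by (intro exI[of _ "mg_meet W n m"]) auto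
  qed
  have "\<exists>g. g \<in> \<Inter>F"
  proof -
    obtain n0 where n0: "compact_open_subgroup (A n0) G" using ex_coset_seq_subgroup by blast
    \<comment> \<open>The fixed member \<open>A (f n0)\<close> provides the compact set in which the
      other members, being closed, are intersected.\<close>
    have "A (f n0) \<inter> (\<Inter>n\<in>{n. compact_open_subgroup (A n) G}. A (f n)) \<noteq> {}"
    proof (rule compact_imp_fip_image[OF compact_coset_seq])
      show "closed (A (f n))" for n by (rule compact_imp_closed_paths[OF compact_coset_seq])
      show "A (f n0) \<inter> (\<Inter>n\<in>I. A (f n)) \<noteq> {}"
        if I: "finite I" "I \<subseteq> {n. compact_open_subgroup (A n) G}" for I
      proof -
        obtain n where n: "compact_open_subgroup (A n) G" "A (f n) \<subseteq> \<Inter>((\<lambda>n. A (f n)) ` insert n0 I)"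
          using fin_Int[of "(\<lambda>n. A (f n)) ` insert n0 I"] I n0 by (auto simp: F_def)
        then have "A n \<noteq> {}" using compact_open_subgroupD(1) subgroup.one_closed by blast
        with ne[of n] n(2) show ?thesis by fastforce
      qed
    qed
    then show ?thesis by (auto simp: F_def)
  qed
  then obtain g where g: "\<And>n. compact_open_subgroup (A n) G \<Longrightarrow> g \<in> A (f n)" by (auto simp: F_def)
  have gT: "g \<in> paths T"
    using g ex_coset_seq_subgroup coset_seq_subset by blast
  have sub: "A (f n) = g <# A n" if n: "compact_open_subgroup (A n) G" for n
  proof -
    obtain a where a: "a \<in> carrier G" "A (f n) = a <# A n" using subgp[OF n] by (auto simp: left_coset_of_def)
    with g[OF n] show ?thesis using l_repr_independence compact_open_subgroupD(1)[OF n] by metis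
  qed
  have "act g b = f b" for b
  proof (cases "b = 0")
    case True
    have "f 0 = 0"
    proof -
      obtain z where z: "f z = 0" using f(1) by (metis bij_pointE)
      have "mg_meet W 0 z = 0" by (rule coset_seq_inj) (simp add: coset_seq_meet)
      then have "f 0 = mg_meet W (f 0) 0" using f(2)[of 0 z] z by simp
      also have "\<dots> = 0" by (rule coset_seq_inj) (simp add: coset_seq_meet)
      finally show ?thesis .
    qed
    then show ?thesis using True gT by (simp add: action_eq_iff l_coset_def)
  next
    case False
    obtain V where V: "compact_open_subgroup V G" "right_coset_of G V (A b)"
      using coset_seq_coset[OF False] by (rule compact_open_coset_is_right)
    obtain v where v: "A v = V" using ex_coset_index[OF compact_open_subgroup_coset[OF V(1)]] by blast
    have "left_coset_of G V V" using compact_open_subgroupD(4)[OF V(1)]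
      by (auto simp: left_coset_of_def carrier lcos_mult_one intro!: bexI[of _ \<one>])
    moreover have "A b = V <#> A b"
      using coset_product[OF V(1) closed_paths(3) V(2)] compact_open_subgroupD(4)[OF V(1)] coset_seq_subset[of b]
      by (simp add: carrier lcos_mult_one)
    ultimately have "mg_prod W v b = Some b" unfolding mg_prod_eq_Some v using V by blast
    from prod[OF this] have "A (f b) = A (f v) <#> A b" unfolding mg_prod_eq_Some by blast
    also have "A (f v) = g <# V" using sub[of v] v V(1) by simp
    also have "(g <# V) <#> A b = g <# A b" by (rule coset_product[OF V(1) gT V(2)])
    finally show ?thesis using gT by (simp add: action_eq_iff)
  qed
  then show ?thesis using gT by blast
qed

lemma Phi_image: "Phi T G \<theta> ` paths T = carrier (G_comp W)"
proof (intro subset_antisym subsetI)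
  fix h assume "h \<in> carrier (G_comp W)"
  then obtain f where f: "h = interleave f (inv_into UNIV f)" "bij f"
     "\<forall>a b. f (mg_meet W a b) = mg_meet W (f a) (f b)"
     "\<forall>a b c. mg_prod W a b = Some c \<longrightarrow> mg_prod W (f a) b = Some (f c)"
    by (auto simp: G_comp_def)
  then obtain g where "g \<in> paths T" "act g = f" using Phi_surj by blast
  with f(1) show "h \<in> Phi T G \<theta> ` paths T" by (auto simp: Phi_def)
qed (use Phi_in_carrier in auto)

end

section \<open>Closed subgroups of the symmetric group\<close>

lemma splice_restr: "splice (restr f n) (restr g n) = restr (interleave f g) (2 * n)"
proof -
  have "splice (map f [0..<n]) (map g [0..<n]) = map (interleave f g) [0..<2 * n]" for f g
  proof (induction n arbitrary: f g)
    case (Suc n)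
    have shift: "map h [0..<Suc k] = h 0 # map (\<lambda>i. h (Suc i)) [0..<k]" for h :: "nat \<Rightarrow> nat" and k
      by (simp add: upt_conv_Cons map_Suc_upt[symmetric] del: upt_Suc)
    have "(\<lambda>i. interleave f g (Suc (Suc i))) = interleave (\<lambda>i. f (Suc i)) (\<lambda>i. g (Suc i))"
      by (auto simp: interleave_def fun_eq_iff)
    moreover have "interleave f g 0 = f 0" "interleave f g (Suc 0) = g 0"
      by (simp_all add: interleave_def)
    ultimately show ?case
      using Suc.IH[of "\<lambda>i. f (Suc i)" "\<lambda>i. g (Suc i)"] by (simp add: shift del: upt_Suc)
  qed simp
  then show ?thesis by (simp add: restr_def)
qed

lemma interleave_in_paths:
  assumes f: "bij f"
  shows "interleave f (inv_into UNIV f) \<in> paths Tree_S_inf"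
proof -
  let ?f' = "inv_into UNIV f"
  have inv: "f (?f' i) = i" "?f' (f i) = i" for i
    using f by (simp_all add: bij_is_surj surj_f_inv_f bij_is_inj)
  have "restr (interleave f ?f') n \<in> Tree_S_inf" for n
  proof -
    have "inj f" "inj ?f'" using f bij_is_inj bij_imp_bij_inv by blast+
    then have "distinct (restr f n)" "distinct (restr ?f' n)"
      by (auto simp: restr_def distinct_map intro: inj_on_subset[OF _ subset_UNIV])
    moreover have "prefix (restr (interleave f ?f') n) (splice (restr f n) (restr ?f' n))"
      unfolding splice_restr by (rule prefix_restr_mono) simp
    ultimately show ?thesis unfolding Tree_S_inf_def
      by (intro CollectI exI[of _ "restr f n"] exI[of _ "restr ?f' n"]) (simp add: inv)
  qed
  then show ?thesis by (simp add: paths_def)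
qed

lemma carrier_G_comp_subset: "carrier (G_comp W) \<subseteq> paths Tree_S_inf"
  using interleave_in_paths by (auto simp: G_comp_def)

lemma Tree_of_iff:
  assumes "carrier H \<subseteq> paths Tree_S_inf"
  shows "\<eta> \<in> Tree_of H \<longleftrightarrow> (\<exists>h\<in>carrier H. restr h (length \<eta>) = \<eta>)"
proof -
  have "h \<in> carrier H \<Longrightarrow> restr h (length \<eta>) = \<eta> \<Longrightarrow> \<eta> \<in> Tree_S_inf" for h
    using assms restr_in_tree by (metis subsetD)
  then show ?thesis using assms by (auto simp: Tree_of_def cylinder_def)
qed

text \<open>The group is closed: every instance of a defining condition concerns finitely many
  values, hence can be checked on a group element that agrees with \<open>h\<close> far enough.
  Bijectivity is of this kind because the inverse is carried along in the odd part.\<close>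

lemma paths_Tree_of_G_comp: "paths (Tree_of (G_comp W)) = carrier (G_comp W)"
proof (intro subset_antisym subsetI)
  fix h assume "h \<in> carrier (G_comp W)"
  then show "h \<in> paths (Tree_of (G_comp W))"
    by (auto simp: paths_def Tree_of_iff[OF carrier_G_comp_subset])
next
  fix h assume h: "h \<in> paths (Tree_of (G_comp W))"
  have approx: "\<exists>f. bij f \<and> (\<forall>a b. f (mg_meet W a b) = mg_meet W (f a) (f b)) \<and>
     (\<forall>a b c. mg_prod W a b = Some c \<longrightarrow> mg_prod W (f a) b = Some (f c)) \<and>
     (\<forall>i<n. even_part h i = f i \<and> odd_part h i = inv_into UNIV f i)" for n
  proof -
    have "restr h (2 * n) \<in> Tree_of (G_comp W)" using h by (simp add: paths_def)
    then obtain h' where "h' \<in> carrier (G_comp W)" and eq: "restr h' (2 * n) = restr h (2 * n)"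
      using Tree_of_iff[OF carrier_G_comp_subset] by force
    then obtain f where f: "h' = interleave f (inv_into UNIV f)" "bij f"
       "\<forall>a b. f (mg_meet W a b) = mg_meet W (f a) (f b)"
       "\<forall>a b c. mg_prod W a b = Some c \<longrightarrow> mg_prod W (f a) b = Some (f c)"
      by (auto simp: G_comp_def)
    have "even_part h i = f i \<and> odd_part h i = inv_into UNIV f i" if "i < n" for i
    proof -
      have "h (2 * i) = h' (2 * i)" "h (2 * i + 1) = h' (2 * i + 1)"
        using eq that by (simp_all add: restr_eq_iff)
      then show ?thesis by (simp add: f(1) interleave_def even_part_def odd_part_def)
    qed
    with f show ?thesis by blast
  qed
  define f where "f = even_part h"
  have left: "odd_part h (f i) = i" for i
  proof -
    \<comment> \<open>The bound covers both positions involved, \<open>i\<close> in the even part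
      and \<open>f i\<close> in the odd part.\<close>
    obtain f' where "bij f'" "\<forall>j<Suc (i + f i). f j = f' j \<and> odd_part h j = inv_into UNIV f' j"
      using approx[of "Suc (i + f i)"] unfolding f_def by blast
    then show ?thesis by (simp add: bij_is_inj)
  qed
  have right: "f (odd_part h i) = i" for i
  proof -
    obtain f' where "bij f'" "\<forall>j<Suc (i + odd_part h i). f j = f' j \<and> odd_part h j = inv_into UNIV f' j"
      using approx[of "Suc (i + odd_part h i)"] unfolding f_def by blast
    then show ?thesis by (simp add: bij_is_surj surj_f_inv_f)
  qed
  have bij: "bij f" by (rule o_bij[of "odd_part h"]) (auto simp: left right)
  have inv: "inv_into UNIV f = odd_part h" using left right by (intro inv_equality)
  have "f (mg_meet W a b) = mg_meet W (f a) (f b)" for a b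
  proof -
    obtain f' where "\<forall>a b. f' (mg_meet W a b) = mg_meet W (f' a) (f' b)"
      "\<forall>j<Suc (mg_meet W a b + a + b). f j = f' j"
      using approx[of "Suc (mg_meet W a b + a + b)"] unfolding f_def by blast
    then show ?thesis by simp
  qed
  moreover have "mg_prod W (f a) b = Some (f c)" if p: "mg_prod W a b = Some c" for a b c
  proof -
    obtain f' where "\<forall>a b c. mg_prod W a b = Some c \<longrightarrow> mg_prod W (f' a) b = Some (f' c)"
      "\<forall>j<Suc (a + c). f j = f' j"
      using approx[of "Suc (a + c)"] unfolding f_def by blast
    then show ?thesis using p by simp
  qed
  moreover have "h = interleave f (inv_into UNIV f)"
    unfolding inv by (auto simp: f_def interleave_def even_part_def odd_part_def fun_eq_iff)
  ultimately show "h \<in> carrier (G_comp W)" using bij by (auto simp: G_comp_def)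
qed

section \<open>Computability of the action and of the isomorphism\<close>

context coset_presentation
begin

lemma decidable_tree [comp_intros]:
  assumes "computable f" shows "decidable (\<lambda>x. f x \<in> T)"
proof -
  have "decidable (\<lambda>\<sigma>. \<sigma> \<in> T)"
    using presentation
    by (simp add: computable_Baire_presentation_def computably_locally_compact_def decidable_strings_iff)
  then show ?thesis using assms by (rule decidable_compose)
qed

lemma computable_code [comp_intros]:
  assumes "computable f" shows "computable (\<lambda>x. code (f x))"
proof -
  have \<theta>: "computable \<theta>"
    using enumeration by (simp add: coset_enumeration_def partial_computable_def computable_nat)
  show ?thesis unfolding code_def
    by (intro comp_intros computable_compose[OF \<theta>] assms)
qed

lemma compact_bound:
  obtains H where "computable (\<lambda>z. H (fst z) (snd z) :: nat)"
    "\<forall>\<sigma>\<in>T. compact (cylinder T \<sigma>) \<longrightarrow> (\<forall>\<rho>\<in>T. prefix \<sigma> \<rho> \<longrightarrow> (\<forall>i<length \<rho>. \<rho> ! i \<le> H \<sigma> i))"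
proof -
  have "computably_locally_compact T"
    using presentation by (simp add: computable_Baire_presentation_def)
  then obtain H where H: "partial_computable (pair_decode list_decode id) id (\<lambda>(\<sigma>, i). Some (H \<sigma> i))"
    and b: "\<forall>\<sigma>\<in>T. compact (cylinder T \<sigma>) \<longrightarrow>
           (\<forall>\<rho>\<in>T. prefix \<sigma> \<rho> \<longrightarrow> (\<forall>i<length \<rho>. \<rho> ! i \<le> H \<sigma> i))"
    unfolding computably_locally_compact_def by (elim conjE exE) (rule that)
  have "computable (\<lambda>z. H (fst z) (snd z))"
    using H unfolding partial_computable_def dec_pair_list_nat computable_def
    by (simp add: case_prod_beta)
  then show ?thesis using b by (rule that)
qed

lemma code_mem_code:
  assumes "code_mem (code n) \<eta>"
  shows "\<eta> \<in> T" "compact (cylinder T \<eta>)" "n \<noteq> 0"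
proof -
  show n: "n \<noteq> 0"
  proof
    assume "n = 0"
    with assms show False by (simp add: code_def code_mem_def)
  qed
  obtain u where u: "minimal_code T u" "finite u" "\<theta> n = strong_index u"
    using n by (rule theta_minimal_code)
  then have "\<eta> \<in> u" using assms n by (simp add: code_def code_mem_strong_index)
  then show "\<eta> \<in> T" "compact (cylinder T \<eta>)"
    using u(1) by (auto simp: minimal_code_def compact_code_def)
qed

lemma mem_coset_seq_iff: "x \<in> A n \<longleftrightarrow> x \<in> paths T \<and> (\<exists>j. code_mem (code n) (restr x j))"
proof (cases "n = 0")
  case True
  then show ?thesis using code_mem_code(3) by auto
next
  case False
  obtain u where u: "finite u" "\<theta> n = strong_index u" "A n = coded_set T u"
    using False by (rule theta_minimal_code)
  have mem: "code_mem (code n) \<eta> \<longleftrightarrow> \<eta> \<in> u" for \<eta>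
    using u(1,2) False by (simp add: code_def code_mem_strong_index)
  have "x \<in> A n \<longleftrightarrow> x \<in> paths T \<and> (\<exists>\<eta>\<in>u. restr x (length \<eta>) = \<eta>)"
    unfolding u(3) by (auto simp: coded_set_def cylinder_def)
  also have "(\<exists>\<eta>\<in>u. restr x (length \<eta>) = \<eta>) \<longleftrightarrow> (\<exists>j. restr x j \<in> u)"
    by (metis length_restr)
  finally show ?thesis unfolding mem .
qed

lemma tree_path: "\<sigma> \<in> T \<Longrightarrow> \<exists>g\<in>paths T. restr g (length \<sigma>) = \<sigma>"
  by (rule leafless_tree_path[OF tree])

text \<open>
  Universal quantification over a compact open coset amounts to a bounded search through the strings
  of one sufficiently large length \<open>L\<close>, whose entries are bounded by means of the function \<open>H\<close>.
\<close>

lemma ce_all_coset: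
  fixes Q :: "'p::coded \<Rightarrow> nat list \<Rightarrow> bool"
  assumes Q: "ce (\<lambda>z. Q (fst z) (snd z))"
  shows "ce (\<lambda>z. \<forall>h\<in>A (snd z). \<exists>l. Q (fst z) (restr h l))"
proof -
  obtain H where H: "computable (\<lambda>z. H (fst z) (snd z) :: nat)"
    and bound: "\<forall>\<sigma>\<in>T. compact (cylinder T \<sigma>) \<longrightarrow>
      (\<forall>\<rho>\<in>T. prefix \<sigma> \<rho> \<longrightarrow> (\<forall>i<length \<rho>. \<rho> ! i \<le> H \<sigma> i))"
    by (rule compact_bound)
  \<comment> \<open>Once \<open>L\<close> and \<open>M\<close> are guessed, only bounded quantifiers
    remain. The first clause ensures that the initial segment of length \<open>L\<close> of every
    point of \<open>A n\<close> lies in the box; the second treats the strings of the box that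
    extend a string of the code.\<close>
  have "(\<forall>h\<in>A n. \<exists>l. Q p (restr h l)) \<longleftrightarrow>
    (\<exists>L M. (\<forall>\<eta>. in_box (code n) (code n) \<eta> \<longrightarrow> code_mem (code n) \<eta> \<longrightarrow>
        length \<eta> \<le> L \<and> (\<forall>i<L. H \<eta> i \<le> M)) \<and>
      (\<forall>t. in_box L M t \<longrightarrow> length t = L \<and> t \<in> T \<and> (\<exists>j\<le>L. code_mem (code n) (take j t)) \<longrightarrow>
        (\<exists>j\<le>L. Q p (take j t))))" (is "?l \<longleftrightarrow> ?r") for n p
  proof
    assume ?r
    then obtain L M where
      LM: "\<And>\<eta>. in_box (code n) (code n) \<eta> \<Longrightarrow> code_mem (code n) \<eta> \<Longrightarrow>
        length \<eta> \<le> L \<and> (\<forall>i<L. H \<eta> i \<le> M)"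
      and Qt: "\<And>t. in_box L M t \<Longrightarrow> length t = L \<and> t \<in> T \<and> (\<exists>j\<le>L. code_mem (code n) (take j t)) \<Longrightarrow>
        \<exists>j\<le>L. Q p (take j t)" by blast
    show ?l
    proof
      fix h assume "h \<in> A n"
      then obtain k where h: "h \<in> paths T" and k: "code_mem (code n) (restr h k)"
        using mem_coset_seq_iff by blast
      have L: "k \<le> L" "\<forall>i<L. H (restr h k) i \<le> M" using LM[OF code_mem_in_box[OF k] k] by auto
      have "h i \<le> M" if "i < L" for i
      proof -
        have "\<forall>i<length (restr h L). restr h L ! i \<le> H (restr h k) i"
          using bound code_mem_code(1,2)[OF k] restr_in_tree[OF h, of L] prefix_restr_mono[OF L(1), of h]
          by blast
        then have "h i \<le> H (restr h k) i" using that by simp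
        then show ?thesis using L(2) that by fastforce
      qed
      then have "in_box L M (restr h L)" by (auto simp: in_box_def restr_def)
      moreover have "\<exists>j\<le>L. code_mem (code n) (take j (restr h L))"
        using k L(1) by (intro exI[of _ k]) (simp add: min_def)
      ultimately obtain j where "Q p (take j (restr h L))"
        using Qt[of "restr h L"] restr_in_tree[OF h] by auto
      then show "\<exists>l. Q p (restr h l)" by auto
    qed
  next
    assume l: ?l
    have "\<exists>k. \<forall>h\<in>A n. \<exists>j\<le>k. Q p (take j (restr h k))"
    proof (rule compact_uniform[OF compact_coset_seq])
      fix h assume "h \<in> A n"
      then obtain j where "Q p (restr h j)" using l by blast
      then show "\<exists>k. \<exists>j\<le>k. Q p (take j (restr h k))" by (intro exI[of _ j]) simp
    next
      fix h k l assume "\<exists>j\<le>k. Q p (take j (restr h k))" "k \<le> (l :: nat)"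
      then obtain j where "j \<le> k" "Q p (restr h j)" by (auto simp: min_def)
      then show "\<exists>j\<le>l. Q p (take j (restr h l))" using \<open>k \<le> l\<close>
        by (intro exI[of _ j]) (simp add: min_def)
    qed
    then obtain k where "\<forall>h\<in>A n. \<exists>j\<le>k. Q p (take j (restr h k))" by blast
    then have k: "\<exists>j\<le>k. Q p (restr h j)" if "h \<in> A n" for h
      using that by (simp add: min_absorb1 cong: conj_cong)
    \<comment> \<open>The summand \<open>k\<close> comes from compactness; the summand
      \<open>code n\<close> makes \<open>L\<close> at least the length of every string in the
      code.\<close>
    define L where "L = k + code n"
    have "finite {\<eta>. in_box (code n) (code n) \<eta>}"
      by (rule finite_subset[OF _ finite_lists_length_le[of "{..code n}" "code n"]])
        (auto simp: in_box_def)
    then have "finite ((\<lambda>(\<eta>, i). H \<eta> i) ` ({\<eta>. in_box (code n) (code n) \<eta>} \<times> {..<L}))" by simp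
    then obtain M where "\<forall>m\<in>(\<lambda>(\<eta>, i). H \<eta> i) ` ({\<eta>. in_box (code n) (code n) \<eta>} \<times> {..<L}). m \<le> M"
      unfolding finite_nat_set_iff_bounded_le by blast
    then have M: "H \<eta> i \<le> M" if "in_box (code n) (code n) \<eta>" "i < L" for \<eta> i
      using that by fastforce
    show ?r
    proof (rule exI[of _ L], rule exI[of _ M], intro conjI allI impI)
      fix \<eta> assume "in_box (code n) (code n) \<eta>"
      then show "length \<eta> \<le> L" by (simp add: in_box_def L_def)
    next
      fix \<eta> i assume "in_box (code n) (code n) \<eta>" "i < L"
      then show "H \<eta> i \<le> M" by (rule M)
    next
      fix t assume t: "length t = L \<and> t \<in> T \<and> (\<exists>j\<le>L. code_mem (code n) (take j t))"
      \<comment> \<open>Every string of \<open>T\<close> lies on a path, so the strings searched are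
        all initial segments of points of \<open>A n\<close> and no spurious one can fail.\<close>
      then obtain h where h: "h \<in> paths T" "restr h L = t" using tree_path by metis
      then have "h \<in> A n" using t mem_coset_seq_iff by auto
      then obtain j where j: "j \<le> k" "Q p (restr h j)" using k by blast
      then have "take j t = restr h j" using h(2) by (auto simp: L_def min_def)
      then show "\<exists>j\<le>L. Q p (take j t)" using j by (intro exI[of _ j]) (simp add: L_def)
    qed
  qed
  then show ?thesis
    by (simp only:) (intro ce_intros ce_compose2[OF Q] ce_decidable comp_intros computable_compose2[OF H])
qed

section \<open>Finite certificates for the action\<close>

text \<open>A certificate that every path through \<sigma> maps \<open>A n\<close> into
  \<open>A m\<close>. Each \<open>h\<close> may use its own length \<open>l\<close>, which gives the
  predicate the form treated by \<open>ce_all_coset\<close>.\<close>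

definition maps_into :: "nat list \<Rightarrow> nat \<Rightarrow> nat \<Rightarrow> bool" where
  "maps_into \<sigma> n m \<longleftrightarrow> (\<forall>h\<in>A n. \<exists>l \<alpha>. Mul \<sigma> (restr h l) \<alpha> \<and> code_mem (code m) \<alpha>)"

lemma ce_maps_into: "ce (\<lambda>z. maps_into (fst z) (fst (snd z)) (snd (snd z)))"
proof -
  have "ce (\<lambda>z. \<exists>\<alpha>. Mul (fst (fst z)) (snd z) \<alpha> \<and> code_mem (code (snd (fst z))) \<alpha>)"
    by (intro ce_intros ce_compose3[OF Mul_ce] ce_decidable comp_intros)
  from ce_compose[OF ce_all_coset[OF this], of "\<lambda>z. ((fst z, snd (snd z)), fst (snd z))"]
  show ?thesis unfolding maps_into_def by (simp add: comp_intros)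
qed

lemma maps_into_mono: "maps_into \<sigma> n m \<Longrightarrow> prefix \<sigma> \<tau> \<Longrightarrow> maps_into \<tau> n m"
  unfolding maps_into_def using Mul_mono by blast

lemma maps_into_sound:
  assumes g: "g \<in> paths T" and "maps_into (restr g k) n m"
  shows "g <# A n \<subseteq> A m"
proof
  fix x assume "x \<in> g <# A n"
  then obtain h where h: "h \<in> A n" "x = g \<otimes> h" by (auto simp: l_coset_def)
  then have "h \<in> paths T" using coset_seq_subset by blast
  moreover obtain l \<alpha> where "Mul (restr g k) (restr h l) \<alpha>" "code_mem (code m) \<alpha>"
    using assms(2) h(1) by (auto simp: maps_into_def)
  ultimately have "code_mem (code m) (restr x (length \<alpha>))" "x \<in> paths T"
    using Mul_sound g h(2) by auto
  then show "x \<in> A m" using mem_coset_seq_iff by blast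
qed

text \<open>Each \<open>h\<close> in \<open>A n\<close> needs some finite part of \<open>g\<close>;
  compactness of \<open>A n\<close> yields one part that serves all of them.\<close>

lemma maps_into_complete:
  assumes g: "g \<in> paths T" and sub: "g <# A n \<subseteq> A m"
  shows "\<exists>k. maps_into (restr g k) n m"
proof -
  have "\<exists>k. \<forall>h\<in>A n. \<exists>\<alpha>. Mul (restr g k) (restr h k) \<alpha> \<and> code_mem (code m) \<alpha>"
  proof (rule compact_uniform[OF compact_coset_seq])
    fix h assume h: "h \<in> A n"
    then have "g \<otimes> h \<in> A m" using sub by (auto simp: l_coset_def)
    then obtain j where "code_mem (code m) (restr (g \<otimes> h) j)" using mem_coset_seq_iff by blast
    moreover have "h \<in> paths T" using h coset_seq_subset by blast
    ultimately show "\<exists>k \<alpha>. Mul (restr g k) (restr h k) \<alpha> \<and> code_mem (code m) \<alpha>"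
      using Mul_complete[OF g, of h j] by blast
  next
    fix h k l assume "\<exists>\<alpha>. Mul (restr g k) (restr h k) \<alpha> \<and> code_mem (code m) \<alpha>" "k \<le> l"
    then show "\<exists>\<alpha>. Mul (restr g l) (restr h l) \<alpha> \<and> code_mem (code m) \<alpha>"
      using Mul_mono prefix_restr_mono by metis
  qed
  then show ?thesis unfolding maps_into_def by blast
qed

definition maps_onto :: "nat list \<Rightarrow> nat \<Rightarrow> nat \<Rightarrow> bool" where
  "maps_onto \<sigma> n m \<longleftrightarrow> maps_into \<sigma> n m \<and> (\<exists>\<alpha>. Invr \<sigma> \<alpha> \<and> maps_into \<alpha> m n)"

lemma ce_maps_onto: "ce (\<lambda>z. maps_onto (fst z) (fst (snd z)) (snd (snd z)))"
  unfolding maps_onto_def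
  by (intro ce_intros ce_compose3[OF ce_maps_into] ce_compose2[OF Invr_ce] comp_intros)

lemma maps_onto_mono: "maps_onto \<sigma> n m \<Longrightarrow> prefix \<sigma> \<tau> \<Longrightarrow> maps_onto \<tau> n m"
  unfolding maps_onto_def using maps_into_mono Invr_mono by blast

lemma action_iff_maps_onto:
  assumes g: "g \<in> paths T"
  shows "act g n = m \<longleftrightarrow> (\<exists>k. maps_onto (restr g k) n m)"
proof -
  have inv: "inv g <# A m \<subseteq> A n \<longleftrightarrow> A m \<subseteq> g <# A n"
  proof -
    have "inv g <# A m \<subseteq> A n \<longleftrightarrow> (\<forall>x\<in>A m. inv g \<otimes> x \<in> A n)" by (auto simp: l_coset_def)
    also have "\<dots> \<longleftrightarrow> A m \<subseteq> g <# A n"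
      using mem_l_coset_iff[OF g coset_seq_subset] coset_seq_subset[of m] by blast
    finally show ?thesis .
  qed
  show ?thesis
  proof
    assume "act g n = m"
    then have eq: "g <# A n = A m" using action_eq_iff[OF g] by blast
    then obtain k where k: "maps_into (restr g k) n m" using maps_into_complete[OF g] by blast
    obtain j where j: "maps_into (restr (inv g) j) m n"
      using maps_into_complete[of "inv g" m n] g eq inv by auto
    obtain l where l: "Invr (restr g l) (restr (inv g) j)" using Invr_complete[OF g] by blast
    have "maps_onto (restr g (max k l)) n m" unfolding maps_onto_def
      using maps_into_mono[OF k prefix_restr_mono] Invr_mono[OF l prefix_restr_mono] j
      by (meson max.cobounded1 max.cobounded2)
    then show "\<exists>k. maps_onto (restr g k) n m" by blast
  next
    assume "\<exists>k. maps_onto (restr g k) n m"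
    then obtain k \<alpha> where k: "maps_into (restr g k) n m" "Invr (restr g k) \<alpha>" "maps_into \<alpha> m n"
      by (auto simp: maps_onto_def)
    then have "maps_into (restr (inv g) (length \<alpha>)) m n" using Invr_sound[OF g] by simp
    then have "A m \<subseteq> g <# A n" using maps_into_sound[of "inv g"] g inv by simp
    with maps_into_sound[OF g k(1)] show "act g n = m" using action_eq_iff[OF g] by blast
  qed
qed

lemma computable_action: "computable_path_nat_fun T act"
proof (rule computable_path_nat_funI[OF _ tree_path ce_maps_onto])
  show "ce (\<lambda>\<sigma>. \<sigma> \<in> T)" by (intro ce_decidable decidable_tree computable_ident)
qed (auto intro: maps_onto_mono simp: action_iff_maps_onto)

definition Phi_info :: "nat list \<Rightarrow> nat \<Rightarrow> nat \<Rightarrow> bool" where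
  "Phi_info \<sigma> i m \<longleftrightarrow>
    (\<exists>j. i = 2 * j \<and> maps_onto \<sigma> j m) \<or> (\<exists>j. i = 2 * j + 1 \<and> maps_onto \<sigma> m j)"

lemma ce_Phi_info: "ce (\<lambda>z. Phi_info (fst z) (fst (snd z)) (snd (snd z)))"
  unfolding Phi_info_def
  by (intro ce_intros ce_compose3[OF ce_maps_onto] ce_decidable comp_intros)

lemma Phi_info_mono: "Phi_info \<sigma> i m \<Longrightarrow> prefix \<sigma> \<tau> \<Longrightarrow> Phi_info \<tau> i m"
  unfolding Phi_info_def using maps_onto_mono by blast

lemma Phi_eq_iff:
  assumes g: "g \<in> paths T"
  shows "Phi T G \<theta> g i = m \<longleftrightarrow> (\<exists>k. Phi_info (restr g k) i m)"
proof (cases "even i")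
  case True
  then obtain j where j: "i = 2 * j" by blast
  have "Phi_info \<sigma> i m \<longleftrightarrow> maps_onto \<sigma> j m" for \<sigma>
    unfolding Phi_info_def j by (metis double_not_eq_Suc_double Suc_eq_plus1 mult_left_cancel zero_neq_numeral)
  then show ?thesis using action_iff_maps_onto[OF g] by (simp add: Phi_def interleave_def j)
next
  case False
  then obtain j where j: "i = 2 * j + 1" by (blast elim: oddE)
  have "Phi_info \<sigma> i m \<longleftrightarrow> maps_onto \<sigma> m j" for \<sigma>
    unfolding Phi_info_def j by (metis Suc_double_not_eq_double Suc_eq_plus1 add_right_cancel mult_left_cancel zero_neq_numeral)
  moreover have "Phi T G \<theta> g i = m \<longleftrightarrow> act g m = j"
    using inv_action_eq_iff[OF g] by (simp add: Phi_def interleave_def j)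
  ultimately show ?thesis using action_iff_maps_onto[OF g] by simp
qed

lemma Phi_mem: "g \<in> paths T \<Longrightarrow> Phi T G \<theta> g \<in> paths (Tree_of (G_comp W))"
  using Phi_in_carrier paths_Tree_of_G_comp by simp

lemma computable_Phi: "computable_path_fun T (Tree_of (G_comp W)) (Phi T G \<theta>)"
proof (rule computable_path_funI[OF _ tree_path _ ce_Phi_info Phi_eq_iff])
  show "ce (\<lambda>\<sigma>. \<sigma> \<in> T)" by (intro ce_decidable decidable_tree computable_ident)
  show "Phi T G \<theta> \<in> paths T \<rightarrow> paths (Tree_of (G_comp W))" using Phi_mem by (rule Pi_I)
qed

section \<open>The target tree and the inverse of Phi\<close>

text \<open>Since \<open>Phi\<close> is onto, the nodes of the tree are the initial segments of its
  values, and finitely many entries of a value are certified by one string \<sigma>. The right-hand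
  side is enumerable, which is all that \<open>computable_path_funI\<close> asks of a domain tree
  besides a path through each node.\<close>

lemma Tree_of_G_comp_iff:
  "\<eta> \<in> Tree_of (G_comp W) \<longleftrightarrow> (\<exists>\<sigma>. \<sigma> \<in> T \<and> (\<forall>i<length \<eta>. Phi_info \<sigma> i (nthd \<eta> i)))"
proof
  assume "\<eta> \<in> Tree_of (G_comp W)"
  then obtain g where g: "g \<in> paths T" "restr (Phi T G \<theta> g) (length \<eta>) = \<eta>"
    unfolding Tree_of_iff[OF carrier_G_comp_subset] Phi_image[symmetric] by blast
  have "\<exists>k. Phi_info (restr g k) i (nthd \<eta> i)" if "i < length \<eta>" for i
  proof -
    have "Phi T G \<theta> g i = nthd \<eta> i" using g(2) that by (metis nthd_eq nth_restr)
    then show ?thesis using Phi_eq_iff[OF g(1)] by blast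
  qed
  then obtain k where k: "\<And>i. i < length \<eta> \<Longrightarrow> Phi_info (restr g (k i)) i (nthd \<eta> i)" by metis
  define K where "K = (\<Sum>i<length \<eta>. k i)"
  have "Phi_info (restr g K) i (nthd \<eta> i)" if "i < length \<eta>" for i
  proof -
    have "k i \<le> K" unfolding K_def using that by (intro member_le_sum) auto
    then show ?thesis using Phi_info_mono[OF k[OF that]] by blast
  qed
  then show "\<exists>\<sigma>. \<sigma> \<in> T \<and> (\<forall>i<length \<eta>. Phi_info \<sigma> i (nthd \<eta> i))"
    using restr_in_tree[OF g(1)] by blast
next
  assume "\<exists>\<sigma>. \<sigma> \<in> T \<and> (\<forall>i<length \<eta>. Phi_info \<sigma> i (nthd \<eta> i))"
  then obtain \<sigma> where \<sigma>: "\<sigma> \<in> T" "\<And>i. i < length \<eta> \<Longrightarrow> Phi_info \<sigma> i (nthd \<eta> i)" by blast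
  then obtain g where g: "g \<in> paths T" "restr g (length \<sigma>) = \<sigma>" using tree_path by blast
  have "Phi T G \<theta> g i = \<eta> ! i" if "i < length \<eta>" for i
    using Phi_eq_iff[OF g(1)] \<sigma>(2)[OF that] g(2) that by (metis nthd_eq)
  then have "restr (Phi T G \<theta> g) (length \<eta>) = \<eta>" by (simp add: list_eq_iff_nth_eq)
  then show "\<eta> \<in> Tree_of (G_comp W)"
    unfolding Tree_of_iff[OF carrier_G_comp_subset] Phi_image[symmetric] using g(1) by blast
qed

lemma ce_Tree_of_G_comp: "ce (\<lambda>\<eta>. \<eta> \<in> Tree_of (G_comp W))"
  unfolding Tree_of_G_comp_iff
  by (intro ce_intros ce_compose3[OF ce_Phi_info] ce_decidable[OF decidable_tree] comp_intros)

text \<open>If some \<open>g \<in> A n\<close> satisfies \<open>g A n = A n\<close>, then \<open>A n\<close> contains the identity.\<close>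

definition contains_one :: "nat \<Rightarrow> bool" where
  "contains_one n \<longleftrightarrow> (\<exists>\<sigma>. \<sigma> \<in> T \<and> (\<exists>j\<le>length \<sigma>. code_mem (code n) (take j \<sigma>)) \<and> maps_onto \<sigma> n n)"

lemma ce_contains_one: "ce contains_one"
proof -
  have "ce (\<lambda>n. contains_one n)" unfolding contains_one_def
    by (intro ce_conj ce_ex ce_decidable[OF decidable_tree] ce_ex_le ce_decidable[OF decidable_code_mem]
      ce_compose3[OF ce_maps_onto] comp_intros)
  then show ?thesis .
qed

lemma contains_oneD:
  assumes "contains_one n" shows "\<one> \<in> A n"
proof -
  obtain \<sigma> j where \<sigma>: "\<sigma> \<in> T" "code_mem (code n) (take j \<sigma>)" "maps_onto \<sigma> n n"
    using assms by (auto simp: contains_one_def)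
  then obtain g where g: "g \<in> paths T" "restr g (length \<sigma>) = \<sigma>" using tree_path by blast
  then have "code_mem (code n) (restr g (min j (length \<sigma>)))" using \<sigma>(2) by (metis take_restr)
  then have "g \<in> A n" using g(1) mem_coset_seq_iff by blast
  moreover have "g <# A n = A n"
    using action_iff_maps_onto[OF g(1)] action_eq_iff[OF g(1)] \<sigma>(3) g(2) by metis
  ultimately have "inv g \<otimes> g \<in> A n" using mem_l_coset_iff[OF g(1) coset_seq_subset] by blast
  then show ?thesis using g(1) by (simp add: carrier)
qed

text \<open>The identity itself is the required \<open>g\<close>: it lies in the subgroup and fixes
  it.\<close>

lemma contains_oneI:
  assumes "compact_open_subgroup (A n) G" shows "contains_one n"
proof -
  have one: "\<one> \<in> A n" using compact_open_subgroupD(1)[OF assms] subgroup.one_closed by blast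
  then obtain j where j: "code_mem (code n) (restr \<one> j)" using mem_coset_seq_iff by blast
  have "act \<one> n = n" using coset_seq_subset by (simp add: action_eq_iff lcos_mult_one carrier)
  then obtain k where k: "maps_onto (restr \<one> k) n n" using action_iff_maps_onto by auto
  have "maps_onto (restr \<one> (max j k)) n n" using maps_onto_mono[OF k prefix_restr_mono] by simp
  moreover have "\<exists>i\<le>max j k. code_mem (code n) (take i (restr \<one> (max j k)))"
    using j by (intro exI[of _ j]) (simp add: min_def)
  ultimately show ?thesis unfolding contains_one_def
    using restr_in_tree[OF closed_paths(3)] by (metis length_restr)
qed

text \<open>Entry \<open>2 * n\<close> of \<eta> is the index of \<open>g A n\<close>. If
  \<open>A n\<close> contains the identity, then \<open>g\<close> lies in \<open>g A n\<close>, so a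
  value \<open>k\<close> shared by all points of \<open>g A n\<close> at position \<open>i\<close>
  is the value \<open>g i\<close>. The guard on the length excludes the default value of
  \<open>nthd\<close>.\<close>

definition Phi_inv_info :: "nat list \<Rightarrow> nat \<Rightarrow> nat \<Rightarrow> bool" where
  "Phi_inv_info \<eta> i k \<longleftrightarrow> (\<exists>n. 2 * n < length \<eta> \<and> contains_one n \<and>
    (\<forall>x\<in>A (nthd \<eta> (2 * n)). \<exists>l. i < length (restr x l) \<and> nthd (restr x l) i = k))"

lemma ce_Phi_inv_info: "ce (\<lambda>z. Phi_inv_info (fst z) (fst (snd z)) (snd (snd z)))"
proof -
  \<comment> \<open>The pair \<open>p\<close> packs \<open>i\<close> and \<open>k\<close>, as
    \<open>ce_all_coset\<close> takes a single parameter. Naming the predicate by an equation lets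
    it be matched as a whole.\<close>
  have "ce (\<lambda>z. i_lt (fst z) (snd z))"
    if "i_lt = (\<lambda>(p :: nat \<times> nat) t. fst p < length t \<and> nthd t (fst p) = snd p)" for i_lt
    unfolding that by (intro ce_decidable comp_intros)
  from ce_all_coset[OF this[OF refl]]
  have "ce (\<lambda>z. \<forall>x\<in>A (snd z). \<exists>l. fst (fst z) < length (restr x l) \<and>
      nthd (restr x l) (fst (fst z)) = snd (fst z))" .
  note all = ce_compose[OF this, of "\<lambda>z. ((fst (snd (fst z)), snd (snd (fst z))), nthd (fst (fst z)) (2 * snd z))"]
  have "ce (\<lambda>z. \<forall>x\<in>A (nthd (fst (fst z)) (2 * snd z)). \<exists>l. fst (snd (fst z)) < length (restr x l) \<and>
      nthd (restr x l) (fst (snd (fst z))) = snd (snd (fst z)))"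
    using all by (simp add: comp_intros)
  then show ?thesis unfolding Phi_inv_info_def
    by (intro ce_ex ce_conj ce_compose[OF ce_contains_one] ce_decidable[OF decidable_less] comp_intros)
qed

lemma Phi_inv_info_iff:
  assumes g: "g \<in> paths T"
  shows "g i = k \<longleftrightarrow> (\<exists>l. Phi_inv_info (restr (Phi T G \<theta> g) l) i k)"
proof
  have Phi: "nthd (restr (Phi T G \<theta> g) l) (2 * n) = act g n" if "2 * n < l" for n l
    using that by (simp add: Phi_def interleave_def)
  {
    assume "g i = k"
    obtain U where U: "compact_open_subgroup U G" "\<forall>x\<in>g <# U. restr x (Suc i) = restr g (Suc i)"
      by (rule small_compact_open_subgroup[OF g])
    then obtain n where n: "A n = U" using ex_coset_index[OF compact_open_subgroup_coset] by blast
    have "i < length (restr x (Suc i)) \<and> nthd (restr x (Suc i)) i = k" if "x \<in> A (act g n)" for x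
    proof -
      have "restr x (Suc i) = restr g (Suc i)" using U(2) that by (simp add: coset_seq_action[OF g] n)
      then show ?thesis using \<open>g i = k\<close> by (simp add: restr_eq_iff)
    qed
    moreover have "contains_one n" using contains_oneI U(1) n by simp
    \<comment> \<open>The length \<open>Suc (2 * n)\<close> just includes position
      \<open>2 * n\<close>, where the image of \<open>A n\<close> is recorded.\<close>
    ultimately have "Phi_inv_info (restr (Phi T G \<theta> g) (Suc (2 * n))) i k"
      unfolding Phi_inv_info_def by (intro exI[of _ n]) (simp add: Phi del: nthd_eq, blast)
    then show "\<exists>l. Phi_inv_info (restr (Phi T G \<theta> g) l) i k" by blast
  }
  assume "\<exists>l. Phi_inv_info (restr (Phi T G \<theta> g) l) i k"
  then obtain l n where n: "2 * n < l" "contains_one n"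
    and x: "\<forall>x\<in>A (act g n). \<exists>l. i < length (restr x l) \<and> nthd (restr x l) i = k"
    unfolding Phi_inv_info_def by (auto simp: Phi simp del: nthd_eq)
  have "g \<in> A (act g n)"
    unfolding coset_seq_action[OF g] using mem_l_coset_iff[OF g coset_seq_subset] contains_oneD[OF n(2)] g
    by (simp add: carrier)
  then show "g i = k" using x by auto
qed

lemma bij_betw_Phi: "bij_betw (Phi T G \<theta>) (paths T) (paths (Tree_of (G_comp W)))"
  by (simp add: bij_betw_def inj_on_Phi Phi_image paths_Tree_of_G_comp)

lemma computable_Phi_inverse:
  "computable_path_fun (Tree_of (G_comp W)) T (inv_into (paths T) (Phi T G \<theta>))"
proof (rule computable_path_funI[OF ce_Tree_of_G_comp _ _ ce_Phi_inv_info])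
  show "\<exists>h\<in>paths (Tree_of (G_comp W)). restr h (length \<eta>) = \<eta>" if "\<eta> \<in> Tree_of (G_comp W)" for \<eta>
    using that Tree_of_iff[OF carrier_G_comp_subset] paths_Tree_of_G_comp by blast
  show "inv_into (paths T) (Phi T G \<theta>) \<in> paths (Tree_of (G_comp W)) \<rightarrow> paths T"
    using bij_betw_inv_into[OF bij_betw_Phi] bij_betwE by blast
  show "inv_into (paths T) (Phi T G \<theta>) h i = k \<longleftrightarrow> (\<exists>l. Phi_inv_info (restr h l) i k)"
    if "h \<in> paths (Tree_of (G_comp W))" for h i k
  proof -
    obtain g where g: "g \<in> paths T" "h = Phi T G \<theta> g"
      using \<open>h \<in> paths (Tree_of (G_comp W))\<close> Phi_image paths_Tree_of_G_comp by blast
    then have "inv_into (paths T) (Phi T G \<theta>) h = g" by (simp add: inj_on_Phi)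
    then show ?thesis using Phi_inv_info_iff[OF g(1)] g(2) by simp
  qed
qed

end

theorem theorem9p2:
  fixes T :: "nat list set" and G :: "(nat \<Rightarrow> nat) monoid" and \<theta> :: "nat \<Rightarrow> nat"
  assumes "computable_Baire_presentation T G"
    and "coset_enumeration T G \<theta>"
  shows "(bij_betw (Phi T G \<theta>) (paths T) (paths (Tree_of (G_comp (W_comp T G \<theta>)))) \<and>
      computable_path_fun T (Tree_of (G_comp (W_comp T G \<theta>))) (Phi T G \<theta>) \<and>
      computable_path_fun (Tree_of (G_comp (W_comp T G \<theta>))) T (inv_into (paths T) (Phi T G \<theta>)))
    \<and> computable_path_nat_fun T (coset_action T G \<theta>)"
proof -
  have mult: "computable_path_fun2 T T (\<lambda>x y. x \<otimes>\<^bsub>G\<^esub> y)"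
    and inverse: "computable_path_fun T T (\<lambda>x. inv\<^bsub>G\<^esub> x)"
    using assms(1) by (simp_all add: computable_Baire_presentation_def)
  \<comment> \<open>The programs for the group operations enter only through these monotone
    enumerable relations, which instantiate the locale parameters.\<close>
  obtain Mul where Mul: "ce (\<lambda>z. Mul (fst z) (fst (snd z)) (snd (snd z)))"
    "\<And>\<sigma> \<tau> \<sigma>' \<tau>' \<alpha>. Mul \<sigma> \<tau> \<alpha> \<Longrightarrow> prefix \<sigma> \<sigma>' \<Longrightarrow> prefix \<tau> \<tau>' \<Longrightarrow> Mul \<sigma>' \<tau>' \<alpha>"
    "\<And>g h k l \<alpha>. g \<in> paths T \<Longrightarrow> h \<in> paths T \<Longrightarrow> Mul (restr g k) (restr h l) \<alpha> \<Longrightarrow>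
      restr (g \<otimes>\<^bsub>G\<^esub> h) (length \<alpha>) = \<alpha>"
    "\<And>g h n. g \<in> paths T \<Longrightarrow> h \<in> paths T \<Longrightarrow> \<exists>k. Mul (restr g k) (restr h k) (restr (g \<otimes>\<^bsub>G\<^esub> h) n)"
    using computable_path_fun2_approx[OF mult] by blast
  obtain Invr where Invr: "ce (\<lambda>z. Invr (fst z) (snd z))"
    "\<And>\<sigma> \<tau> \<alpha>. Invr \<sigma> \<alpha> \<Longrightarrow> prefix \<sigma> \<tau> \<Longrightarrow> Invr \<tau> \<alpha>"
    "\<And>g k \<alpha>. g \<in> paths T \<Longrightarrow> Invr (restr g k) \<alpha> \<Longrightarrow> restr (inv\<^bsub>G\<^esub> g) (length \<alpha>) = \<alpha>"
    "\<And>g n. g \<in> paths T \<Longrightarrow> \<exists>k. Invr (restr g k) (restr (inv\<^bsub>G\<^esub> g) n)"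
    using computable_path_fun_approx[OF inverse] by blast
  interpret coset_presentation T G Mul Invr \<theta>
    by unfold_locales (fact assms Mul Invr)+
  show ?thesis
    using bij_betw_Phi computable_Phi computable_Phi_inverse computable_action by blast
qed

end
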